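(* Let $H$ be a continuous process and $X$ a continuous martingale. For any sequence of partitions $T^1,T^2,\dots$ that is fine for both $H$ and $X$, the processes $$(H\cdot X)^n_t:=\sum_{k=1}^{\infty}H_{T^n_{k-1}\wedge t}\bigl(X_{T^n_k\wedge t}-X_{T^n_{k-1}\wedge t}\bigr),\qquad n=1,2,\dots,$$ converge uniformly on compacts quasi-always (ucqa) as $n\to\infty$. Moreover, if $T^n$ is replaced by another sequence of partitions fine for $H$ and $X$, the limit stays the same quasi-always.
   Context: Setup. Fix integers $1\le J^*\le J$; sample space $\Omega:=C[0,\infty)^J$ with elements $\omega=(S_1,\dots,S_J)$ of continuous functions $[0,\infty)\to\mathbb{R}$, the first $J^*$ being price paths of traded securities and the rest information paths; $\omega^*:=(S_1,\dots,S_{J^*})$; $\mathcal F$ is the $\sigma$-algebra generated by $\omega\mapsto\omega(t)$. A stopping time is an $\mathcal F$-measurable $\tau:\Omega\to[0,\infty]$ with $\omega|_{[0,\tau(\omega)]}=\omega'|_{[0,\tau(\omega)]}\Rightarrow\tau(\omega)=\tau(\omega')$; $h$ is $\tau$-measurable if that restriction equality implies $h(\omega)=h(\omega')$. A process $X:[0,\infty)\times\Omega\to[-\infty,\infty]$ is adapted if $\omega|_{[0,t]}=\omega'|_{[0,t]}\Rightarrow X_t(\omega)=X_t(\omega')$. A simple capital process is $\mathcal K_t(\omega)=c+\sum_{n\ge1}h_n(\omega)\cdot(\omega^*(\tau_{n+1}\wedge t)-\omega^*(\tau_n\wedge t))$ with $c\in\mathbb R$, stopping times $\tau_1\le\tau_2\le\cdots$,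 $\tau_n(\omega)\to\infty$ for all $\omega$, and bounded $\tau_n$-measurable $h_n:\Omega\to\mathbb R^{J^*}$. Nonnegative supermartingales: the smallest class of nonnegative processes containing all nonnegative simple capital processes and closed under pointwise $\liminf_k$ of sequences. A set $E\subseteq[0,\infty)\times\Omega$ holds quasi-always (q.a.) if some nonnegative supermartingale $X$ with $X_0=1$ has $X_t(\omega)=\infty$ for all $(t,\omega)\notin E$. With a cemetery symbol $\partial\notin\mathbb R$, a continuous process is an adapted $X:[0,\infty)\times\Omega\to\mathbb R\cup\{\partial\}$ such that $\mathrm{dom}\,X:=\{(t,\omega):X_t(\omega)\in\mathbb R\}$ holds q.a. and for each $\omega$ the set $\{t:X_t(\omega)\in\mathbb R\}$ contains $0$, is connected, and $X(\omega)$ is continuous on it. Continuous martingales: the smallest class $\mathcal C$ of continuous processes containing all simple capital processes and containing every continuous process $X$ for which there are $X^k\in\mathcal C$ with $\mathrm{dom}\,X\subseteq\mathrm{dom}\,X^k$ and $\sup_{s\in[0,t]}|X^k_s(\omega)-X_s(\omega)|\to0$ for all $(t,\omega)\in\mathrm{dom}\,X$. A partition is a sequence of stopping times $0=T_0\le T_1\le T_2\le\cdots$ such that the property $\lim_kT_k(\omega)>t$ of $(t,\omega)$ holds q.a. A sequence of partitions $T^1,T^2,\dots$ is fine for a continuous process $Y$ if for all $n,k\ge1$ and $\omega$, $\sup Y_t(\omega)-\inf Y_t(\omega)\le2^{-n}$, where sup and inf are over $t\in[T^n_{k-1}(\omega),T^n_k(\omega)]$ with $Y_t(\omega)\in\mathbb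 R$. Processes $X^k$ converge ucqa to $X$ if the property $\lim_k\sup_{s\in[0,t]}|X^k_s(\omega)-X_s(\omega)|=0$ of $(t,\omega)$ holds q.a. *)

theory Defs
  imports "HOL-Analysis.Analysis"
begin

text \<open>A sample path: components j < J are continuous on [0,oo); by convention
  all other values (j \<ge> J or t < 0) are 0, giving canonical representatives.\<close>
type_synonym path = "nat \<Rightarrow> real \<Rightarrow> real"

definition Omega :: "nat \<Rightarrow> path set" where
  "Omega J = {\<omega>. (\<forall>j<J. continuous_on {0..} (\<omega> j)) \<and>
                  (\<forall>j t. (J \<le> j \<or> t < 0) \<longrightarrow> \<omega> j t = 0)}"

definition Fsig :: "nat \<Rightarrow> path measure" where
  "Fsig J = sigma (Omega J)
     {{\<omega> \<in> Omega J. \<omega> j t \<in> B} | j t B. j < J \<and> 0 \<le> t \<and> B \<in> sets borel}"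

definition agree_upto :: "nat \<Rightarrow> ereal \<Rightarrow> path \<Rightarrow> path \<Rightarrow> bool" where
  "agree_upto J u \<omega> \<omega>' \<longleftrightarrow> (\<forall>j<J. \<forall>t. 0 \<le> t \<and> ereal t \<le> u \<longrightarrow> \<omega> j t = \<omega>' j t)"

definition stopping_time :: "nat \<Rightarrow> (path \<Rightarrow> ereal) \<Rightarrow> bool" where
  "stopping_time J \<tau> \<longleftrightarrow> \<tau> \<in> borel_measurable (Fsig J) \<and> (\<forall>\<omega>\<in>Omega J. 0 \<le> \<tau> \<omega>) \<and>
     (\<forall>\<omega>\<in>Omega J. \<forall>\<omega>'\<in>Omega J. agree_upto J (\<tau> \<omega>) \<omega> \<omega>' \<longrightarrow> \<tau> \<omega> = \<tau> \<omega>')"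

definition tau_measurable :: "nat \<Rightarrow> (path \<Rightarrow> ereal) \<Rightarrow> (path \<Rightarrow> 'a) \<Rightarrow> bool" where
  "tau_measurable J \<tau> h \<longleftrightarrow>
     (\<forall>\<omega>\<in>Omega J. \<forall>\<omega>'\<in>Omega J. agree_upto J (\<tau> \<omega>) \<omega> \<omega>' \<longrightarrow> h \<omega> = h \<omega>')"

definition stop_at :: "ereal \<Rightarrow> real \<Rightarrow> real" where
  "stop_at u t = real_of_ereal (min u (ereal t))"

text \<open>Simple capital processes; traded components are j < Js, h n \<omega> j is the
  j-th component of h_n(\<omega>) (indexing of n starts at 0 here).\<close>
definition simple_capital :: "nat \<Rightarrow> nat \<Rightarrow> (real \<Rightarrow> path \<Rightarrow> real) \<Rightarrow> bool" where
  "simple_capital J Js K \<longleftrightarrow>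
     (\<exists>(c::real) (\<tau>::nat \<Rightarrow> path \<Rightarrow> ereal) (h::nat \<Rightarrow> path \<Rightarrow> nat \<Rightarrow> real).
        (\<forall>n. stopping_time J (\<tau> n)) \<and>
        (\<forall>n. \<forall>\<omega>\<in>Omega J. \<tau> n \<omega> \<le> \<tau> (Suc n) \<omega>) \<and>
        (\<forall>\<omega>\<in>Omega J. (\<lambda>n. \<tau> n \<omega>) \<longlonglongrightarrow> \<infinity>) \<and>
        (\<forall>n. \<forall>j<Js. tau_measurable J (\<tau> n) (\<lambda>\<omega>. h n \<omega> j)) \<and>
        (\<forall>n. \<exists>C. \<forall>\<omega>\<in>Omega J. \<forall>j<Js. \<bar>h n \<omega> j\<bar> \<le> C) \<and>
        (\<forall>t \<omega>. K t \<omega> = c + (\<Sum>n. \<Sum>j<Js. h n \<omega> j *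
              (\<omega> j (stop_at (\<tau> (Suc n) \<omega>) t) - \<omega> j (stop_at (\<tau> n \<omega>) t)))))"

inductive_set NSM :: "nat \<Rightarrow> nat \<Rightarrow> (real \<Rightarrow> path \<Rightarrow> ereal) set" for J Js where
  base: "simple_capital J Js K \<Longrightarrow> (\<forall>t\<ge>0. \<forall>\<omega>\<in>Omega J. 0 \<le> K t \<omega>) \<Longrightarrow>
         (\<lambda>t \<omega>. ereal (K t \<omega>)) \<in> NSM J Js"
| liminf: "(\<And>k. X k \<in> NSM J Js) \<Longrightarrow> (\<lambda>t \<omega>. liminf (\<lambda>k. X k t \<omega>)) \<in> NSM J Js"

definition qa :: "nat \<Rightarrow> nat \<Rightarrow> (real \<Rightarrow> path \<Rightarrow> bool) \<Rightarrow> bool" where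
  "qa J Js P \<longleftrightarrow> (\<exists>X\<in>NSM J Js. (\<forall>\<omega>\<in>Omega J. X 0 \<omega> = 1) \<and>
      (\<forall>t\<ge>0. \<forall>\<omega>\<in>Omega J. \<not> P t \<omega> \<longrightarrow> X t \<omega> = \<infinity>))"

text \<open>Processes with values in R \<union> {cemetery}: None plays the role of the cemetery.\<close>
definition cont_process :: "nat \<Rightarrow> nat \<Rightarrow> (real \<Rightarrow> path \<Rightarrow> real option) \<Rightarrow> bool" where
  "cont_process J Js X \<longleftrightarrow>
     (\<forall>t\<ge>0. \<forall>\<omega>\<in>Omega J. \<forall>\<omega>'\<in>Omega J. agree_upto J (ereal t) \<omega> \<omega>' \<longrightarrow> X t \<omega> = X t \<omega>') \<and>
     qa J Js (\<lambda>t \<omega>. X t \<omega> \<noteq> None) \<and>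
     (\<forall>\<omega>\<in>Omega J. 0 \<in> {t. 0 \<le> t \<and> X t \<omega> \<noteq> None} \<and>
        connected {t. 0 \<le> t \<and> X t \<omega> \<noteq> None} \<and>
        continuous_on {t. 0 \<le> t \<and> X t \<omega> \<noteq> None} (\<lambda>t. the (X t \<omega>)))"

inductive_set CM :: "nat \<Rightarrow> nat \<Rightarrow> (real \<Rightarrow> path \<Rightarrow> real option) set" for J Js where
  base: "simple_capital J Js K \<Longrightarrow> (\<lambda>t \<omega>. Some (K t \<omega>)) \<in> CM J Js"
| limit: "cont_process J Js X \<Longrightarrow> (\<And>k. Xk k \<in> CM J Js) \<Longrightarrow>
     (\<forall>k. \<forall>t\<ge>0. \<forall>\<omega>\<in>Omega J. X t \<omega> \<noteq> None \<longrightarrow> Xk k t \<omega> \<noteq> None) \<Longrightarrow>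
     (\<forall>t\<ge>0. \<forall>\<omega>\<in>Omega J. X t \<omega> \<noteq> None \<longrightarrow>
        (\<lambda>k. SUP s\<in>{0..t}. ereal \<bar>the (Xk k s \<omega>) - the (X s \<omega>)\<bar>) \<longlonglongrightarrow> 0) \<Longrightarrow>
     X \<in> CM J Js"

definition partition :: "nat \<Rightarrow> nat \<Rightarrow> (nat \<Rightarrow> path \<Rightarrow> ereal) \<Rightarrow> bool" where
  "partition J Js T \<longleftrightarrow> (\<forall>k. stopping_time J (T k)) \<and> (\<forall>\<omega>\<in>Omega J. T 0 \<omega> = 0) \<and>
     (\<forall>k. \<forall>\<omega>\<in>Omega J. T k \<omega> \<le> T (Suc k) \<omega>) \<and>
     qa J Js (\<lambda>t \<omega>. ereal t < (SUP k. T k \<omega>))"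

definition fine_for :: "nat \<Rightarrow> nat \<Rightarrow> (nat \<Rightarrow> nat \<Rightarrow> path \<Rightarrow> ereal) \<Rightarrow>
    (real \<Rightarrow> path \<Rightarrow> real option) \<Rightarrow> bool" where
  "fine_for J Js TT Y \<longleftrightarrow> (\<forall>n\<ge>1. partition J Js (TT n)) \<and>
     (\<forall>n\<ge>1. \<forall>k\<ge>1. \<forall>\<omega>\<in>Omega J.
        (let S = {t. 0 \<le> t \<and> TT n (k - 1) \<omega> \<le> ereal t \<and> ereal t \<le> TT n k \<omega> \<and> Y t \<omega> \<noteq> None}
         in (SUP t\<in>S. ereal (the (Y t \<omega>))) - (INF t\<in>S. ereal (the (Y t \<omega>)))
              \<le> ereal (2 powr (- real n))))"

text \<open>Riemann sums (H.X)^n_t; index k here corresponds to k+1 in the paper.\<close>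
definition riemann :: "(nat \<Rightarrow> nat \<Rightarrow> path \<Rightarrow> ereal) \<Rightarrow> (real \<Rightarrow> path \<Rightarrow> real option) \<Rightarrow>
    (real \<Rightarrow> path \<Rightarrow> real option) \<Rightarrow> nat \<Rightarrow> real \<Rightarrow> path \<Rightarrow> real" where
  "riemann TT H X n t \<omega> = (\<Sum>k. the (H (stop_at (TT n k \<omega>) t) \<omega>) *
      (the (X (stop_at (TT n (Suc k) \<omega>) t) \<omega>) - the (X (stop_at (TT n k \<omega>) t) \<omega>)))"

definition ucqa :: "nat \<Rightarrow> nat \<Rightarrow> (nat \<Rightarrow> real \<Rightarrow> path \<Rightarrow> real) \<Rightarrow> (real \<Rightarrow> path \<Rightarrow> real) \<Rightarrow> bool" where
  "ucqa J Js Xs Y \<longleftrightarrow>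
     qa J Js (\<lambda>t \<omega>. (\<lambda>k. SUP s\<in>{0..t}. ereal \<bar>Xs k s \<omega> - Y s \<omega>\<bar>) \<longlonglongrightarrow> 0)"

end

theory Submission
  imports Defs
begin

text \<open>For two partitions that are \<open>\<delta>\<close>-fine for \<open>H\<close> and \<open>X\<close> the difference \<open>D\<close> of the two Riemann
  sums is an integral \<open>\<integral> f dX\<close> over the common refinement with \<open>\<bar>f\<bar> \<le> \<delta>\<close>. While \<open>\<bar>X\<bar> \<le> L\<close>, the
  process \<open>D\<^sup>2 - \<Sum>(\<Delta>D)\<^sup>2 + \<delta>\<^sup>2 (L\<^sup>2 - X\<^sup>2 + \<Sum>(\<Delta>X)\<^sup>2)\<close> is nonnegative, dominates \<open>D\<^sup>2\<close>, starts at
  no more than \<open>\<delta>\<^sup>2 L\<^sup>2\<close>, and is a constant plus an integral with respect to \<open>X\<close>. Hence a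
  nonnegative supermartingale starting near \<open>\<delta>\<^sup>2 L\<^sup>2\<close> exceeds \<open>\<theta>\<^sup>2\<close> as soon as \<open>\<bar>D\<bar>\<close> has reached
  \<open>2 \<theta>\<close>. With \<open>\<delta> = 2\<^sup>-\<^sup>n\<close> and \<open>\<theta> = (3/4)\<^sup>n\<close> the ratios \<open>\<delta>\<^sup>2/\<theta>\<^sup>2\<close> are summable, and a Borel--Cantelli
  argument gives \<open>sup \<bar>D\<bar> \<le> 2 (3/4)\<^sup>n\<close> for all large \<open>n\<close>, quasi-always. Taking consecutive
  partitions of one sequence yields convergence, taking two sequences yields uniqueness.\<close>

section \<open>Integrals of step integrands along time grids\<close>

text \<open>A gamble against \<open>X\<close> must keep its capital nonnegative on every path and at
  all times, with bounded positions and exhausting times. But \<open>X\<close> is an iterated limit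
  of capital processes, defined only quasi-always, and a partition may accumulate. So the
  nonnegative process is never claimed to be a supermartingale itself: \<open>hedges\<close> only
  asks that some member of \<open>NSM\<close> dominate it at those \<open>(t, \<omega>)\<close> up
  to which it has stayed above some positive \<epsilon>, and this passes through the limits that
  build \<open>CM\<close>. The room for \<epsilon> is bought by starting at \<delta>^2 (L^2 + 1)
  instead of \<delta>^2 L^2. \<open>D\<close> is frozen at the first grid point where it has reached
  \<theta>: a bound that fails at some s <= t must be punished at t, when \<open>D\<close> may long
  have returned to 0. The base 3/4 of \<theta> stands for any number strictly between 1/2 and 1:
  (\<delta>/\<theta>)^2 has to be summable for Borel-Cantelli, and \<theta> itself for convergence.
  Then also \<delta>^2 <= \<theta>, which controls the movement of \<open>D\<close> between grid
  points.\<close>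

definition time_grid :: "(nat \<Rightarrow> ereal) \<Rightarrow> bool" where
  "time_grid r \<longleftrightarrow> r 0 = 0 \<and> incseq r"

text \<open>Cell \<open>n\<close> carries its own function \<open>u n\<close>, of which only the
  increment over that cell counts. With \<open>u n s = g n * x s\<close> this is the integral of the
  step integrand \<open>g\<close> against \<open>x\<close>; with \<open>gain\<close> it is the gain
  of a trading strategy.\<close>

definition gint :: "(nat \<Rightarrow> ereal) \<Rightarrow> (nat \<Rightarrow> real \<Rightarrow> real) \<Rightarrow> real \<Rightarrow> real" where
  "gint r u t = (\<Sum>n. u n (stop_at (r (Suc n)) t) - u n (stop_at (r n) t))"

lemma time_grid_mono: "time_grid r \<Longrightarrow> i \<le> j \<Longrightarrow> r i \<le> r j"
  by (auto simp: time_grid_def dest: incseqD)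

lemma time_grid_zero [simp]: "time_grid r \<Longrightarrow> r 0 = 0"
  by (simp add: time_grid_def)

lemma time_grid_nonneg: "time_grid r \<Longrightarrow> 0 \<le> r i"
  using time_grid_mono[of r 0 i] by simp

lemma stop_at_below: "r \<le> ereal t \<Longrightarrow> stop_at r t = real_of_ereal r"
  by (simp add: stop_at_def min_def)

lemma stop_at_above: "ereal t \<le> r \<Longrightarrow> stop_at r t = t"
  by (auto simp: stop_at_def min_def)

lemma ereal_stop_at: "0 \<le> r \<Longrightarrow> 0 \<le> t \<Longrightarrow> ereal (stop_at r t) = min r (ereal t)"
  by (cases r) (auto simp: stop_at_def min_def)

lemma stop_at_bounds: "0 \<le> r \<Longrightarrow> 0 \<le> t \<Longrightarrow> 0 \<le> stop_at r t \<and> stop_at r t \<le> t"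
  by (cases r) (auto simp: stop_at_def min_def)

lemma real_of_finite_time:
  "0 \<le> (r::ereal) \<Longrightarrow> r \<le> ereal t \<Longrightarrow> ereal (real_of_ereal r) = r"
  by (cases r) auto

lemma gint_eq_sum:
  assumes "time_grid r" "ereal t \<le> r m"
  shows "gint r u t = (\<Sum>n<m. u n (stop_at (r (Suc n)) t) - u n (stop_at (r n) t))"
proof -
  have "stop_at (r n) t = t" if "m \<le> n" for n
    using time_grid_mono[OF assms(1) that] assms(2) by (intro stop_at_above) auto
  then show ?thesis
    unfolding gint_def by (intro suminf_finite) auto
qed

lemma gint_0 [simp]: "time_grid r \<Longrightarrow> gint r u 0 = 0"
  by (subst gint_eq_sum[where m = 0]) auto

text \<open>The cell inequalities add up along the grid stopped at \<open>t\<close>, where the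
  increments of \<open>G\<close> telescope. An inequality is wanted, not only an identity, because
  the quadratic functional in the comparison of Riemann sums is compared with an integral after a
  term of known sign has been discarded.\<close>

lemma gint_compare:
  fixes G :: "real \<Rightarrow> real"
  assumes r: "time_grid r" and t: "0 \<le> t" "ereal t \<le> r m"
    and step: "\<And>k s. \<lbrakk>0 \<le> s; s \<le> t; k < m; r k \<le> ereal s; ereal s \<le> r (Suc k)\<rbrakk> \<Longrightarrow>
      G s - G (real_of_ereal (r k)) \<le> u k s - u k (real_of_ereal (r k))"
  shows "G t - G 0 \<le> gint r u t"
proof -
  have "G (stop_at (r k) t) - G 0 \<le>
      (\<Sum>n<k. u n (stop_at (r (Suc n)) t) - u n (stop_at (r n) t))" if "k \<le> m" for k
    using that
  proof (induction k)
    case 0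
    then show ?case using r t by (simp add: stop_at_below)
  next
    case (Suc k)
    let ?s = "stop_at (r (Suc k)) t" and ?p = "stop_at (r k) t"
    have "G ?s - G ?p \<le> u k ?s - u k ?p"
    proof (cases "r k \<le> ereal t")
      case True
      have p: "?p = real_of_ereal (r k)" by (rule stop_at_below[OF True])
      have "ereal ?s = min (r (Suc k)) (ereal t)"
        using r t by (simp add: ereal_stop_at time_grid_nonneg)
      then have "r k \<le> ereal ?s" "ereal ?s \<le> r (Suc k)"
        using True time_grid_mono[OF r, of k "Suc k"] by auto
      then show ?thesis
        unfolding p using step[of ?s k] stop_at_bounds[of "r (Suc k)" t] r t Suc.prems
        by (simp add: time_grid_nonneg)
    next
      case False
      then have "ereal t \<le> r k" "ereal t \<le> r (Suc k)"
        using time_grid_mono[OF r, of k "Suc k"] by auto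
      then show ?thesis by (simp add: stop_at_above)
    qed
    with Suc show ?case by simp
  qed
  from this[of m] show ?thesis
    using t gint_eq_sum[OF r t(2)] by (simp add: stop_at_above)
qed

text \<open>The increments inside the cells characterise the integral. Changes of grid are proved
  through this, without rearranging sums.\<close>

lemma gint_unique:
  fixes G :: "real \<Rightarrow> real"
  assumes r: "time_grid r" and t: "0 \<le> t" "ereal t \<le> r m"
    and step: "\<And>k s. \<lbrakk>0 \<le> s; s \<le> t; k < m; r k \<le> ereal s; ereal s \<le> r (Suc k)\<rbrakk> \<Longrightarrow>
      G s - G (real_of_ereal (r k)) = u k s - u k (real_of_ereal (r k))"
  shows "gint r u t = G t - G 0"
proof (rule antisym)
  have "- G t - - G 0 \<le> gint r (\<lambda>n s. - u n s) t"
    by (rule gint_compare[OF r t, where G = "\<lambda>s. - G s"]) (use step in force)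
  also have "\<dots> = - gint r u t"
    by (simp add: gint_eq_sum[OF r t(2)] flip: sum_negf)
  finally show "gint r u t \<le> G t - G 0" by simp
qed (rule gint_compare[OF r t], use step in force)

lemma gint_step:
  assumes r: "time_grid r" and s: "r k \<le> ereal s" "ereal s \<le> r (Suc k)"
  shows "gint r u s - gint r u (real_of_ereal (r k)) = u k s - u k (real_of_ereal (r k))"
proof -
  let ?p = "real_of_ereal (r k)"
  have p: "ereal ?p = r k"
    using real_of_finite_time[OF time_grid_nonneg[OF r] s(1)] .
  have eq: "stop_at (r n) s = stop_at (r n) ?p" if "n \<le> k" for n
    using time_grid_mono[OF r that] s p by (metis order_trans stop_at_below)
  have "gint r u s = (\<Sum>n<Suc k. u n (stop_at (r (Suc n)) s) - u n (stop_at (r n) s))"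
    by (rule gint_eq_sum[OF r s(2)])
  also have "\<dots> = (\<Sum>n<k. u n (stop_at (r (Suc n)) s) - u n (stop_at (r n) s)) + (u k s - u k ?p)"
    using s by (simp add: stop_at_above stop_at_below)
  also have "(\<Sum>n<k. u n (stop_at (r (Suc n)) s) - u n (stop_at (r n) s)) = gint r u ?p"
    using p by (subst gint_eq_sum[OF r, where m = k]) (auto intro!: sum.cong simp: eq)
  finally show ?thesis by simp
qed

lemma gint_step2:
  assumes r: "time_grid r" and s: "r k \<le> ereal p" "p \<le> s" "ereal s \<le> r (Suc k)"
  shows "gint r u s - gint r u p = u k s - u k p"
proof -
  have "r k \<le> ereal s" "ereal p \<le> r (Suc k)"
    using s by (meson ereal_less_eq(3) order_trans)+
  from gint_step[OF r this(1) s(3), of u] gint_step[OF r s(1) this(2), of u] show ?thesis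
    by simp
qed

section \<open>Common refinement of two grids\<close>

text \<open>For grids this is the sorted list of all times of \<open>P\<close> and \<open>Q\<close>
  with repetitions, the two initial zeros counted once. The min-max formula makes each entry a
  finite lattice expression in the given times, so that stopping times stay stopping times.\<close>

definition merge_times :: "(nat \<Rightarrow> ereal) \<Rightarrow> (nat \<Rightarrow> ereal) \<Rightarrow> nat \<Rightarrow> ereal" where
  "merge_times P Q m = Min ((\<lambda>i. max (P i) (Q (m - i))) ` {..m})"

text \<open>The index of the cell of \<open>P\<close> in which cell \<open>m\<close> of
  \<open>r\<close> is meant to lie. The cap \<open>i \<le> m\<close> keeps the set finite when times
  of \<open>P\<close> repeat or accumulate; \<open>merge_interval\<close> shows that on a merged
  grid the capped index is still a right one.\<close>

definition last_index :: "(nat \<Rightarrow> ereal) \<Rightarrow> (nat \<Rightarrow> ereal) \<Rightarrow> nat \<Rightarrow> nat" where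
  "last_index P r m = Max {i. i \<le> m \<and> P i \<le> r m}"

lemma merge_le: "i + j = m \<Longrightarrow> merge_times P Q m \<le> max (P i) (Q j)"
  unfolding merge_times_def by (rule Min_le) (auto intro!: image_eqI[where x = i])

lemma merge_attained: "\<exists>i j. i + j = m \<and> merge_times P Q m = max (P i) (Q j)"
proof -
  have "merge_times P Q m \<in> (\<lambda>i. max (P i) (Q (m - i))) ` {..m}"
    unfolding merge_times_def by (rule Min_in) auto
  then show ?thesis
    by (metis (no_types, lifting) atMost_iff image_iff le_add_diff_inverse)
qed

lemma merge_times_commute: "merge_times P Q = merge_times Q P"
proof
  fix m
  have *: "merge_times P Q m \<le> merge_times Q P m" for P Q
    by (metis add.commute max.commute merge_attained merge_le)
  show "merge_times P Q m = merge_times Q P m" by (intro antisym *)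
qed

lemma time_grid_merge:
  assumes "time_grid P" "time_grid Q"
  shows "time_grid (merge_times P Q)"
  unfolding time_grid_def
proof
  show "merge_times P Q 0 = 0" using assms by (simp add: merge_times_def)
  show "incseq (merge_times P Q)"
  proof (rule incseq_SucI)
    fix m
    obtain i j where ij: "i + j = Suc m" "merge_times P Q (Suc m) = max (P i) (Q j)"
      using merge_attained by blast
    show "merge_times P Q m \<le> merge_times P Q (Suc m)"
    proof (cases i)
      case 0
      then have "merge_times P Q m \<le> max (P 0) (Q m)" by (intro merge_le) simp
      also have "\<dots> \<le> max (P i) (Q j)"
        using 0 ij time_grid_mono[OF assms(2), of m j] by (intro max.mono) auto
      finally show ?thesis using ij by simp
    next
      case (Suc i')
      then have "merge_times P Q m \<le> max (P i') (Q j)" using ij by (intro merge_le) simp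
      also have "\<dots> \<le> max (P i) (Q j)"
        using Suc time_grid_mono[OF assms(1), of i' i] by (intro max.mono) auto
      finally show ?thesis using ij by simp
    qed
  qed
qed

lemma merge_greater:
  assumes "time_grid P" "time_grid Q" "a < P i" "a < Q j"
  shows "a < merge_times P Q (i + j)"
proof -
  obtain i' j' where ij: "i' + j' = i + j" "merge_times P Q (i + j) = max (P i') (Q j')"
    using merge_attained by blast
  then have "i \<le> i' \<or> j \<le> j'" by linarith
  then show ?thesis
    using ij(2) assms time_grid_mono[OF assms(1), of i i'] time_grid_mono[OF assms(2), of j j']
    by (auto simp: less_max_iff_disj)
qed

lemma last_index:
  assumes "P 0 \<le> r m"
  shows "last_index P r m \<le> m" "P (last_index P r m) \<le> r m"
    "\<And>i. i \<le> m \<Longrightarrow> P i \<le> r m \<Longrightarrow> i \<le> last_index P r m"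
proof -
  have "last_index P r m \<in> {i. i \<le> m \<and> P i \<le> r m}"
    unfolding last_index_def using assms by (intro Max_in) auto
  then show "last_index P r m \<le> m" "P (last_index P r m) \<le> r m" by auto
  show "i \<le> last_index P r m" if "i \<le> m" "P i \<le> r m" for i
    unfolding last_index_def using that by (intro Max_ge) auto
qed

text \<open>If \<open>i < m\<close>, maximality of \<open>i\<close> puts \<open>P (Suc i)\<close>
  beyond the merged time \<open>m\<close>. The split \<open>(i', j')\<close> attaining that time has
  \<open>i' \<le> i\<close>, so \<open>Q (m - i) \<le> Q j'\<close> lies before
  \<open>P (Suc i)\<close> as well. If \<open>i = m\<close>, then \<open>Q (m - i)\<close> is 0.
  Either way the split \<open>(Suc i, m - i)\<close> bounds the next merged time by
  \<open>P (Suc i)\<close>.\<close>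

lemma merge_interval:
  fixes m :: nat
  assumes P: "time_grid P" and Q: "time_grid Q"
  defines "i \<equiv> last_index P (merge_times P Q) m"
  shows "P i \<le> merge_times P Q m" "merge_times P Q (Suc m) \<le> P (Suc i)" "i \<le> m"
proof -
  have "P 0 \<le> merge_times P Q m" using P Q time_grid_merge time_grid_nonneg by simp
  note li = last_index[of P "merge_times P Q" m, OF this, folded i_def]
  show "P i \<le> merge_times P Q m" "i \<le> m" using li by auto
  obtain i' j' where ij: "i' + j' = m" "merge_times P Q m = max (P i') (Q j')"
    using merge_attained by blast
  have "i' \<le> i" using li(3)[of i'] ij by auto
  have "Q (m - i) \<le> P (Suc i)"
  proof (cases "i = m")
    case True
    then show ?thesis using P Q by (simp add: time_grid_nonneg)
  next
    case False
    have "Q (m - i) \<le> Q j'" using \<open>i' \<le> i\<close> ij(1) by (intro time_grid_mono[OF Q]) auto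
    also have "\<dots> \<le> merge_times P Q m" using ij by simp
    also have "\<dots> \<le> P (Suc i)"
    proof -
      have "\<not> P (Suc i) \<le> merge_times P Q m"
        using li(3)[of "Suc i"] li(1) False by auto
      then show ?thesis by simp
    qed
    finally show ?thesis .
  qed
  moreover have "merge_times P Q (Suc m) \<le> max (P (Suc i)) (Q (m - i))"
    using li(1) by (intro merge_le) simp
  ultimately show "merge_times P Q (Suc m) \<le> P (Suc i)" by (simp add: max_def split: if_splits)
qed

lemma merge_interval2:
  fixes m :: nat
  assumes P: "time_grid P" and Q: "time_grid Q"
  defines "i \<equiv> last_index Q (merge_times P Q) m"
  shows "Q i \<le> merge_times P Q m" "merge_times P Q (Suc m) \<le> Q (Suc i)" "i \<le> m"
  using merge_interval[OF Q P] by (auto simp: i_def merge_times_commute[of Q P])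

section \<open>Stopping times and adapted quantities\<close>

lemma agree_upto_sym: "agree_upto J u \<omega> \<omega>' \<Longrightarrow> agree_upto J u \<omega>' \<omega>"
  by (simp add: agree_upto_def)

lemma agree_upto_mono: "agree_upto J u \<omega> \<omega>' \<Longrightarrow> v \<le> u \<Longrightarrow> agree_upto J v \<omega> \<omega>'"
  unfolding agree_upto_def using order_trans[of _ v u] by blast

lemma stopping_timeD:
  assumes "stopping_time J \<tau>" "\<omega> \<in> Omega J" "\<omega>' \<in> Omega J" "agree_upto J u \<omega> \<omega>'" "\<tau> \<omega> \<le> u"
  shows "\<tau> \<omega>' = \<tau> \<omega>"
  using assms(1-3) agree_upto_mono[OF assms(4,5)] unfolding stopping_time_def by metis

lemma stopping_time_nonneg: "stopping_time J \<tau> \<Longrightarrow> \<omega> \<in> Omega J \<Longrightarrow> 0 \<le> \<tau> \<omega>"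
  unfolding stopping_time_def by blast

lemma stopping_time_measurable: "stopping_time J \<tau> \<Longrightarrow> \<tau> \<in> borel_measurable (Fsig J)"
  unfolding stopping_time_def by blast

lemma stopping_time_le_iff:
  assumes "stopping_time J \<tau>" "\<omega> \<in> Omega J" "\<omega>' \<in> Omega J" "agree_upto J u \<omega> \<omega>'"
  shows "\<tau> \<omega> \<le> u \<longleftrightarrow> \<tau> \<omega>' \<le> u"
  using stopping_timeD[OF assms] stopping_timeD[OF assms(1,3,2) agree_upto_sym[OF assms(4)]] by auto

lemma stopping_timeI:
  assumes "\<tau> \<in> borel_measurable (Fsig J)" "\<And>\<omega>. \<omega> \<in> Omega J \<Longrightarrow> 0 \<le> \<tau> \<omega>"
    and "\<And>\<omega> \<omega>'. \<omega> \<in> Omega J \<Longrightarrow> \<omega>' \<in> Omega J \<Longrightarrow> agree_upto J (\<tau> \<omega>) \<omega> \<omega>' \<Longrightarrow> \<tau> \<omega> = \<tau> \<omega>'"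
  shows "stopping_time J \<tau>"
  unfolding stopping_time_def by (intro conjI ballI impI assms)

lemma stopping_time_const: "0 \<le> c \<Longrightarrow> stopping_time J (\<lambda>_. c)"
  by (simp add: stopping_time_def)

lemma stopping_time_min:
  assumes "stopping_time J \<sigma>" "stopping_time J \<tau>"
  shows "stopping_time J (\<lambda>\<omega>. min (\<sigma> \<omega>) (\<tau> \<omega>))"
proof (rule stopping_timeI)
  show "(\<lambda>\<omega>. min (\<sigma> \<omega>) (\<tau> \<omega>)) \<in> borel_measurable (Fsig J)"
    using assms[THEN stopping_time_measurable] by measurable
  fix \<omega> \<omega>' assume *: "\<omega> \<in> Omega J" "\<omega>' \<in> Omega J" "agree_upto J (min (\<sigma> \<omega>) (\<tau> \<omega>)) \<omega> \<omega>'"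
  show "min (\<sigma> \<omega>) (\<tau> \<omega>) = min (\<sigma> \<omega>') (\<tau> \<omega>')"
    using stopping_timeD[OF assms(1) *] stopping_timeD[OF assms(2) *]
      stopping_time_le_iff[OF assms(1) *] stopping_time_le_iff[OF assms(2) *]
    by (auto simp: min_def split: if_splits)
qed (use assms stopping_time_nonneg in simp)

lemma stopping_time_max:
  assumes "stopping_time J \<sigma>" "stopping_time J \<tau>"
  shows "stopping_time J (\<lambda>\<omega>. max (\<sigma> \<omega>) (\<tau> \<omega>))"
proof (rule stopping_timeI)
  show "(\<lambda>\<omega>. max (\<sigma> \<omega>) (\<tau> \<omega>)) \<in> borel_measurable (Fsig J)"
    using assms[THEN stopping_time_measurable] by measurable
  fix \<omega> \<omega>' assume *: "\<omega> \<in> Omega J" "\<omega>' \<in> Omega J" "agree_upto J (max (\<sigma> \<omega>) (\<tau> \<omega>)) \<omega> \<omega>'"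
  show "max (\<sigma> \<omega>) (\<tau> \<omega>) = max (\<sigma> \<omega>') (\<tau> \<omega>')"
    using stopping_timeD[OF assms(1) *] stopping_timeD[OF assms(2) *] by auto
qed (use assms stopping_time_nonneg in \<open>simp add: max.coboundedI1\<close>)

lemma stopping_time_Min:
  assumes "finite A" "A \<noteq> {}" "\<And>i. i \<in> A \<Longrightarrow> stopping_time J (f i)"
  shows "stopping_time J (\<lambda>\<omega>. Min ((\<lambda>i. f i \<omega>) ` A))"
  using assms
  by (induction rule: finite_ne_induct) (auto intro!: stopping_time_min)

lemma stopping_time_merge:
  assumes "\<And>k. stopping_time J (P k)" "\<And>k. stopping_time J (Q k)"
  shows "stopping_time J (\<lambda>\<omega>. merge_times (\<lambda>i. P i \<omega>) (\<lambda>i. Q i \<omega>) m)"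
  unfolding merge_times_def
  by (rule stopping_time_Min) (auto intro!: stopping_time_max assms)

definition st_grid :: "nat \<Rightarrow> (nat \<Rightarrow> path \<Rightarrow> ereal) \<Rightarrow> bool" where
  "st_grid J P \<longleftrightarrow> (\<forall>k. stopping_time J (P k)) \<and> (\<forall>\<omega>\<in>Omega J. time_grid (\<lambda>k. P k \<omega>))"

text \<open>Kept apart from \<open>st_grid\<close>: strategies must exhaust the half-line on every
  path, a partition does so only quasi-always.\<close>

definition exhausting :: "nat \<Rightarrow> (nat \<Rightarrow> path \<Rightarrow> ereal) \<Rightarrow> bool" where
  "exhausting J P \<longleftrightarrow> (\<forall>\<omega>\<in>Omega J. \<forall>t. \<exists>k. ereal t < P k \<omega>)"

abbreviation mergeg :: "(nat \<Rightarrow> path \<Rightarrow> ereal) \<Rightarrow> (nat \<Rightarrow> path \<Rightarrow> ereal) \<Rightarrow> nat \<Rightarrow> path \<Rightarrow> ereal" where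
  "mergeg P Q m \<omega> \<equiv> merge_times (\<lambda>i. P i \<omega>) (\<lambda>i. Q i \<omega>) m"

lemma st_gridD:
  assumes "st_grid J P"
  shows "stopping_time J (P k)" "\<omega> \<in> Omega J \<Longrightarrow> time_grid (\<lambda>k. P k \<omega>)"
  using assms by (auto simp: st_grid_def)

lemma st_grid_merge: "st_grid J P \<Longrightarrow> st_grid J Q \<Longrightarrow> st_grid J (mergeg P Q)"
  by (auto simp: st_grid_def intro!: stopping_time_merge time_grid_merge)

lemma exhausting_merge:
  assumes "st_grid J P" "st_grid J Q" "exhausting J P" "exhausting J Q"
  shows "exhausting J (mergeg P Q)"
  unfolding exhausting_def
proof (intro ballI allI)
  fix \<omega> t assume \<omega>: "\<omega> \<in> Omega J"
  then obtain i j where "ereal t < P i \<omega>" "ereal t < Q j \<omega>"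
    using assms(3,4) unfolding exhausting_def by blast
  then show "\<exists>k. ereal t < mergeg P Q k \<omega>"
    using merge_greater[OF st_gridD(2)[OF assms(1) \<omega>] st_gridD(2)[OF assms(2) \<omega>]] by blast
qed

lemma exhausting_tendsto:
  assumes "st_grid J P" "exhausting J P" "\<omega> \<in> Omega J"
  shows "(\<lambda>k. P k \<omega>) \<longlonglongrightarrow> \<infinity>"
  unfolding tendsto_PInfty
proof
  fix r
  obtain k where "ereal r < P k \<omega>" using assms unfolding exhausting_def by blast
  then have "ereal r < P i \<omega>" if "i \<ge> k" for i
    using time_grid_mono[OF st_gridD(2)[OF assms(1,3)] that] by (rule less_le_trans)
  then show "eventually (\<lambda>k. ereal r < P k \<omega>) sequentially"
    by (auto simp: eventually_sequentially)
qed

lemma last_index_adapted: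
  assumes "\<And>k. stopping_time J (P k)" "\<And>k. stopping_time J (r k)"
    and "\<omega> \<in> Omega J" "\<omega>' \<in> Omega J" "agree_upto J (r m \<omega>) \<omega> \<omega>'"
  shows "last_index (\<lambda>k. P k \<omega>) (\<lambda>k. r k \<omega>) m = last_index (\<lambda>k. P k \<omega>') (\<lambda>k. r k \<omega>') m"
proof -
  have "r m \<omega>' = r m \<omega>" using stopping_timeD[OF assms(2-5)] by simp
  then show ?thesis
    unfolding last_index_def using stopping_time_le_iff[OF assms(1,3-5)] by simp
qed

text \<open>The index is known at time \<open>r m\<close>, since each comparison
  \<open>P i \<le> r m\<close> is decided by the path up to \<open>r m\<close>, and the selected
  time of \<open>P\<close> is no later than \<open>r m\<close>. This is how positions are carried
  over to a finer grid.\<close>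

lemma tau_measurable_last_index:
  assumes P: "st_grid J P" and r: "st_grid J r" and h: "\<And>k. tau_measurable J (P k) (h k)"
  shows "tau_measurable J (r m) (\<lambda>\<omega>. h (last_index (\<lambda>k. P k \<omega>) (\<lambda>k. r k \<omega>) m) \<omega>)"
  unfolding tau_measurable_def
proof (intro ballI impI)
  fix \<omega> \<omega>' assume *: "\<omega> \<in> Omega J" "\<omega>' \<in> Omega J" "agree_upto J (r m \<omega>) \<omega> \<omega>'"
  let ?i = "last_index (\<lambda>k. P k \<omega>) (\<lambda>k. r k \<omega>) m"
  have "P 0 \<omega> \<le> r m \<omega>"
    using time_grid_nonneg[OF st_gridD(2)[OF r *(1)], of m] time_grid_zero[OF st_gridD(2)[OF P *(1)]]
    by simp
  then have "P ?i \<omega> \<le> r m \<omega>" by (rule last_index)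
  then have "agree_upto J (P ?i \<omega>) \<omega> \<omega>'" by (rule agree_upto_mono[OF *(3)])
  then show "h ?i \<omega> = h (last_index (\<lambda>k. P k \<omega>') (\<lambda>k. r k \<omega>') m) \<omega>'"
    using h[of ?i] * last_index_adapted[where P = P and r = r, OF st_gridD(1)[OF P] st_gridD(1)[OF r] *]
    by (simp add: tau_measurable_def)
qed

lemma tau_measurable_mono:
  assumes "tau_measurable J \<sigma> h" "\<And>\<omega>. \<omega> \<in> Omega J \<Longrightarrow> \<sigma> \<omega> \<le> \<tau> \<omega>"
  shows "tau_measurable J \<tau> h"
  unfolding tau_measurable_def
proof (intro ballI impI)
  fix \<omega> \<omega>' assume *: "\<omega> \<in> Omega J" "\<omega>' \<in> Omega J" "agree_upto J (\<tau> \<omega>) \<omega> \<omega>'"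
  show "h \<omega> = h \<omega>'"
    using assms(1) * agree_upto_mono[OF *(3) assms(2)[OF *(1)]] by (simp add: tau_measurable_def)
qed

text \<open>The notion only demands that the value be determined by the path up to \<tau>, so
  \<open>F\<close> may be any function, with no measurability to check. The price is paid later:
  quantities built this way cannot define hitting times that are stopping times.\<close>

lemma tau_measurable_comp2:
  assumes "tau_measurable J \<tau> f" "tau_measurable J \<tau> g"
  shows "tau_measurable J \<tau> (\<lambda>\<omega>. F (f \<omega>) (g \<omega>))"
  unfolding tau_measurable_def
proof (intro ballI impI)
  fix \<omega> \<omega>' assume "\<omega> \<in> Omega J" "\<omega>' \<in> Omega J" "agree_upto J (\<tau> \<omega>) \<omega> \<omega>'"
  then have "f \<omega> = f \<omega>'" "g \<omega> = g \<omega>'"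
    using assms unfolding tau_measurable_def by blast+
  then show "F (f \<omega>) (g \<omega>) = F (f \<omega>') (g \<omega>')" by simp
qed

lemma tau_measurable_comp:
  assumes "tau_measurable J \<tau> f"
  shows "tau_measurable J \<tau> (\<lambda>\<omega>. F (f \<omega>))"
  using tau_measurable_comp2[OF assms assms, of "\<lambda>x _. F x"] .

lemma tau_measurable_const: "tau_measurable J \<tau> (\<lambda>_. c)"
  by (simp add: tau_measurable_def)

definition adapted :: "nat \<Rightarrow> (real \<Rightarrow> path \<Rightarrow> 'a) \<Rightarrow> bool" where
  "adapted J X \<longleftrightarrow> (\<forall>t\<ge>0. \<forall>\<omega>\<in>Omega J. \<forall>\<omega>'\<in>Omega J.
     agree_upto J (ereal t) \<omega> \<omega>' \<longrightarrow> X t \<omega> = X t \<omega>')"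

text \<open>Where the stopping time is infinite, \<^const>\<open>real_of_ereal\<close> yields the junk time 0, which
  is harmless for measurability.\<close>

lemma tau_measurable_at:
  assumes X: "adapted J X" and \<tau>: "stopping_time J \<tau>"
  shows "tau_measurable J \<tau> (\<lambda>\<omega>. X (real_of_ereal (\<tau> \<omega>)) \<omega>)"
  unfolding tau_measurable_def
proof (intro ballI impI)
  fix \<omega> \<omega>' assume *: "\<omega> \<in> Omega J" "\<omega>' \<in> Omega J" "agree_upto J (\<tau> \<omega>) \<omega> \<omega>'"
  have eq: "\<tau> \<omega>' = \<tau> \<omega>" using stopping_timeD[OF \<tau> *] by simp
  have "0 \<le> \<tau> \<omega>" using \<tau> *(1) by (rule stopping_time_nonneg)
  then have "ereal (real_of_ereal (\<tau> \<omega>)) \<le> \<tau> \<omega>" "0 \<le> real_of_ereal (\<tau> \<omega>)"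
    by (cases "\<tau> \<omega>"; simp)+
  then show "X (real_of_ereal (\<tau> \<omega>)) \<omega> = X (real_of_ereal (\<tau> \<omega>')) \<omega>'"
    using X * agree_upto_mono[OF *(3)] unfolding eq adapted_def by blast
qed

section \<open>Hitting times and grids of small oscillation\<close>

lemma space_Fsig [simp]: "space (Fsig J) = Omega J"
  unfolding Fsig_def by (rule space_measure_of) auto

lemma coordinate_measurable:
  assumes "j < J" "0 \<le> t"
  shows "(\<lambda>\<omega>. \<omega> j t) \<in> borel_measurable (Fsig J)"
proof (rule measurableI)
  fix B :: "real set" assume "B \<in> sets borel"
  then have "{\<omega> \<in> Omega J. \<omega> j t \<in> B} \<in> sets (Fsig J)"
    unfolding Fsig_def using assms by (subst sets_measure_of) (auto intro!: sigma_sets.Basic)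
  moreover have "(\<lambda>\<omega>. \<omega> j t) -` B \<inter> space (Fsig J) = {\<omega> \<in> Omega J. \<omega> j t \<in> B}" by auto
  ultimately show "(\<lambda>\<omega>. \<omega> j t) -` B \<inter> space (Fsig J) \<in> sets (Fsig J)" by simp
qed simp

lemma coordinate_continuous: "\<omega> \<in> Omega J \<Longrightarrow> j < J \<Longrightarrow> continuous_on {0..} (\<omega> j)"
  by (simp add: Omega_def)

lemma closure_rats_unit: "{0..1::real} \<subseteq> closure (\<rat> \<inter> {0..1})"
proof
  fix r :: real assume r: "r \<in> {0..1}"
  show "r \<in> closure (\<rat> \<inter> {0..1})"
  proof (cases "r = 1")
    case True
    then show ?thesis using closure_subset by fastforce
  next
    case False
    show ?thesis unfolding closure_approachable
    proof (intro allI impI)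
      fix e :: real assume "0 < e"
      then obtain q where "q \<in> \<rat>" "r < q" "q < min 1 (r + e)"
        using Rats_dense_in_real[of r "min 1 (r + e)"] r False by auto
      then show "\<exists>y\<in>\<rat> \<inter> {0..1}. dist y r < e"
        using r by (intro bexI[of _ q]) (auto simp: dist_real_def)
    qed
  qed
qed

text \<open>Reduces the event that the level is reached by time \<open>a\<close> to countably many
  coordinates. The rationals are fractions of \<open>a\<close> rather than times, so that the
  endpoint \<open>a\<close> is always among the sampled times. Conversely, compactness turns the
  supremum into a value that is attained.\<close>

lemma running_max_rational:
  fixes y :: "real \<Rightarrow> real"
  assumes y: "continuous_on {0..} y" and a: "0 \<le> a"
  shows "(\<exists>s\<ge>0. s \<le> a \<and> \<delta> \<le> y s) \<longleftrightarrow> ereal \<delta> \<le> (SUP r\<in>\<rat> \<inter> {0..1}. ereal (y (r * a)))"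
    (is "?L \<longleftrightarrow> _ \<le> ?S")
proof -
  have c: "continuous_on {0..1} (\<lambda>r. y (r * a))"
    by (intro continuous_on_compose2[OF y] continuous_intros) (use a in auto)
  show ?thesis
  proof
    assume ?L
    then obtain s where s: "0 \<le> s" "s \<le> a" "\<delta> \<le> y s" by blast
    show "ereal \<delta> \<le> ?S"
    proof (rule ccontr)
      assume "\<not> ereal \<delta> \<le> ?S"
      then have "?S < ereal \<delta>" by (rule not_le_imp_less)
      from ereal_dense2[OF this] obtain b where b: "?S < ereal b" "b < \<delta>"
        unfolding less_ereal.simps by blast
      have *: "y (r * a) \<le> b" if "r \<in> \<rat> \<inter> {0..1}" for r
        using that b(1) SUP_upper[of r "\<rat> \<inter> {0..1}" "\<lambda>r. ereal (y (r * a))"]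
        by (metis ereal_less_eq(3) less_imp_le order_trans)
      have cl: "closure (\<rat> \<inter> {0..1}) = {0..1::real}"
        using closure_rats_unit closure_minimal[of "\<rat> \<inter> {0..1}" "{0..1::real}"] by auto
      have "y (s / a * a) \<le> b"
        by (rule continuous_le_on_closure[of "\<rat> \<inter> {0..1}" "\<lambda>r. y (r * a)"])
          (use c cl * s a in \<open>auto simp: field_simps zero_le_divide_iff divide_le_eq_1\<close>)
      \<comment> \<open>If \<open>a = 0\<close> then \<open>s = 0\<close> as well, and division by
        zero gives 0, which is still in the unit interval.\<close>
      moreover have "s / a * a = s" using s by auto
      ultimately show False using s b by simp
    qed
  next
    assume S: "ereal \<delta> \<le> ?S"
    obtain r where r: "r \<in> {0..1}" "\<And>r'. r' \<in> {0..1} \<Longrightarrow> y (r' * a) \<le> y (r * a)"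
      using continuous_attains_sup[OF compact_Icc _ c] by auto
    have "?S \<le> ereal (y (r * a))" by (rule SUP_least) (use r in auto)
    with S have "\<delta> \<le> y (r * a)" using ereal_less_eq(3) order_trans by blast
    moreover have "0 \<le> r * a" "r * a \<le> a" using r(1) a by (auto simp: mult_left_le_one_le)
    ultimately show ?L by blast
  qed
qed

definition hitting_time :: "(real \<Rightarrow> real) \<Rightarrow> real \<Rightarrow> ereal" where
  "hitting_time y \<delta> = (INF s\<in>{s. 0 \<le> s \<and> \<delta> \<le> y s}. ereal s)"

lemma hitting_time_cases:
  fixes y :: "real \<Rightarrow> real"
  assumes y: "continuous_on {0..} y"
  obtains "hitting_time y \<delta> = \<infinity>" "\<And>s. 0 \<le> s \<Longrightarrow> y s < \<delta>"
  | p where "hitting_time y \<delta> = ereal p" "0 \<le> p" "\<delta> \<le> y p" "\<And>s. 0 \<le> s \<Longrightarrow> s < p \<Longrightarrow> y s < \<delta>"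
proof -
  let ?S = "{s. 0 \<le> s \<and> \<delta> \<le> y s}"
  show thesis
  proof (cases "?S = {}")
    case True
    then have "\<And>s. 0 \<le> s \<Longrightarrow> y s < \<delta>" by force
    moreover have "hitting_time y \<delta> = \<infinity>" unfolding hitting_time_def True by (simp add: top_ereal_def)
    ultimately show thesis using that(1) by blast
  next
    case False
    have eq: "?S = {0..} \<inter> y -` {\<delta>..}" by auto
    have "closed ?S" unfolding eq by (intro continuous_closed_preimage y) auto
    moreover have bdd: "bdd_below ?S" by (rule bdd_belowI[of _ 0]) auto
    ultimately have p: "Inf ?S \<in> ?S" using False by (intro closed_contains_Inf)
    have low: "Inf ?S \<le> s" if "s \<in> ?S" for s using that bdd by (rule cInf_lower)
    have "hitting_time y \<delta> = ereal (Inf ?S)"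
      unfolding hitting_time_def
      by (rule antisym) (use p in \<open>auto intro!: INF_lower2[of "Inf ?S"] INF_greatest low\<close>)
    moreover have "y s < \<delta>" if "0 \<le> s" "s < Inf ?S" for s
      using low[of s] that by force
    ultimately show thesis using p that(2)[of "Inf ?S"] by auto
  qed
qed

lemma hitting_time_le_iff:
  fixes y :: "real \<Rightarrow> real"
  assumes y: "continuous_on {0..} y"
  shows "hitting_time y \<delta> \<le> ereal a \<longleftrightarrow> (\<exists>s\<ge>0. s \<le> a \<and> \<delta> \<le> y s)"
  by (rule hitting_time_cases[OF y, of \<delta>]) force+

lemma hitting_time_nonneg: "0 \<le> hitting_time y \<delta>"
  unfolding hitting_time_def by (rule INF_greatest) auto

lemma hitting_time_cong_upto:
  fixes y y' :: "real \<Rightarrow> real"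
  assumes y: "continuous_on {0..} y" and y': "continuous_on {0..} y'"
    and eq: "\<And>s. 0 \<le> s \<Longrightarrow> ereal s \<le> hitting_time y \<delta> \<Longrightarrow> y s = y' s"
  shows "hitting_time y \<delta> = hitting_time y' \<delta>"
proof (rule hitting_time_cases[OF y, of \<delta>])
  assume inf: "hitting_time y \<delta> = \<infinity>"
  then have "y s = y' s" if "0 \<le> s" for s using eq that by simp
  then show ?thesis unfolding hitting_time_def by (metis (no_types, lifting))
next
  fix p assume p: "hitting_time y \<delta> = ereal p" "0 \<le> p" "\<delta> \<le> y p" "\<And>s. 0 \<le> s \<Longrightarrow> s < p \<Longrightarrow> y s < \<delta>"
  then have "\<delta> \<le> y' p" "\<And>s. 0 \<le> s \<Longrightarrow> s < p \<Longrightarrow> y' s < \<delta>" using eq by force+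
  note y'p = this
  have "hitting_time y' \<delta> = ereal p"
  proof (rule antisym)
    show "hitting_time y' \<delta> \<le> ereal p"
      unfolding hitting_time_le_iff[OF y'] using y'p p(2) by blast
    show "ereal p \<le> hitting_time y' \<delta>"
      unfolding hitting_time_def by (rule INF_greatest) (use y'p(2) in \<open>force simp: not_less[symmetric]\<close>)
  qed
  with p show ?thesis by simp
qed

lemma stopping_time_hitting_time:
  fixes Y :: "real \<Rightarrow> path \<Rightarrow> real"
  assumes meas: "\<And>s. 0 \<le> s \<Longrightarrow> Y s \<in> borel_measurable (Fsig J)" and ad: "adapted J Y"
    and cont: "\<And>\<omega>. \<omega> \<in> Omega J \<Longrightarrow> continuous_on {0..} (\<lambda>s. Y s \<omega>)"
  shows "stopping_time J (\<lambda>\<omega>. hitting_time (\<lambda>s. Y s \<omega>) \<delta>)"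
proof (rule stopping_timeI)
  show "(\<lambda>\<omega>. hitting_time (\<lambda>s. Y s \<omega>) \<delta>) \<in> borel_measurable (Fsig J)"
    unfolding borel_measurable_iff_Iic_ereal
  proof
    fix a :: ereal
    let ?A = "(\<lambda>\<omega>. hitting_time (\<lambda>s. Y s \<omega>) \<delta>) -` {..a} \<inter> space (Fsig J)"
    consider "a = \<infinity>" | "a < 0" | b where "a = ereal b" "0 \<le> b"
      by (cases a) (auto simp: not_less[symmetric])
    then show "?A \<in> sets (Fsig J)"
    proof cases
      case 1
      then have "?A = space (Fsig J)" by auto
      then show ?thesis by (metis sets.top)
    next
      case 2
      then have "?A = {}" using hitting_time_nonneg by (auto simp: not_le[symmetric] intro: order_trans)
      then show ?thesis by (metis sets.empty_sets)
    next
      case 3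
      have "?A = {\<omega>\<in>space (Fsig J). ereal \<delta> \<le> (SUP r\<in>\<rat> \<inter> {0..1}. ereal (Y (r * b) \<omega>))}"
        using 3 by (auto simp: hitting_time_le_iff[OF cont] running_max_rational[OF cont])
      also have "\<dots> \<in> sets (Fsig J)"
      proof -
        have "(\<lambda>\<omega>. SUP r\<in>\<rat> \<inter> {0..1}. ereal (Y (r * b) \<omega>)) \<in> borel_measurable (Fsig J)"
          using 3 by (intro borel_measurable_SUP borel_measurable_ereal meas)
            (auto intro: countable_Int1 countable_rat)
        then show ?thesis by measurable
      qed
      finally show ?thesis .
    qed
  qed
next
  fix \<omega> \<omega>' assume *: "\<omega> \<in> Omega J" "\<omega>' \<in> Omega J"
    "agree_upto J (hitting_time (\<lambda>s. Y s \<omega>) \<delta>) \<omega> \<omega>'"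
  show "hitting_time (\<lambda>s. Y s \<omega>) \<delta> = hitting_time (\<lambda>s. Y s \<omega>') \<delta>"
  proof (rule hitting_time_cong_upto[OF cont[OF *(1)] cont[OF *(2)]])
    fix s assume "0 \<le> s" "ereal s \<le> hitting_time (\<lambda>s. Y s \<omega>) \<delta>"
    then show "Y s \<omega> = Y s \<omega>'"
      using ad *(1,2) agree_upto_mono[OF *(3)] unfolding adapted_def by blast
  qed
qed (rule hitting_time_nonneg)

text \<open>Each time is the first at which the path has moved by \<delta>, in the l1 norm over all
  components, from its position at the preceding time. Only coordinates enter, which are measurable,
  so these are genuine stopping times. Through \<open>stop_at\<close> the displacement is 0 before
  the preceding time, hence continuous on the whole half-line.\<close>

fun osc_grid :: "nat \<Rightarrow> real \<Rightarrow> nat \<Rightarrow> path \<Rightarrow> ereal" where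
  "osc_grid J \<delta> 0 = (\<lambda>\<omega>. 0)"
| "osc_grid J \<delta> (Suc i) = (\<lambda>\<omega>. hitting_time
     (\<lambda>s. \<Sum>j<J. \<bar>\<omega> j s - \<omega> j (stop_at (osc_grid J \<delta> i \<omega>) s)\<bar>) \<delta>)"

lemma continuous_stop_at: "0 \<le> r \<Longrightarrow> continuous_on {0..} (stop_at r)"
proof (cases r)
  case (real x)
  then have "stop_at r = (\<lambda>s. min x s)" by (auto simp: stop_at_def min_def)
  then show ?thesis by (simp add: continuous_intros)
next
  case PInf
  then have "stop_at r = (\<lambda>s. s)" by (auto simp: stop_at_def min_def)
  then show ?thesis by (simp add: continuous_intros)
qed auto

lemma continuous_displacement:
  assumes "\<omega> \<in> Omega J" "0 \<le> r"
  shows "continuous_on {0..} (\<lambda>s. \<Sum>j<J. \<bar>\<omega> j s - \<omega> j (stop_at r s)\<bar>)"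
  by (intro continuous_intros coordinate_continuous[OF assms(1)]
      continuous_on_compose2[OF coordinate_continuous[OF assms(1)]] continuous_stop_at assms(2))
    (use assms(2) stop_at_bounds in auto)

lemma stop_at_adapted:
  assumes "stopping_time J \<tau>" "\<omega> \<in> Omega J" "\<omega>' \<in> Omega J" "agree_upto J (ereal s) \<omega> \<omega>'"
  shows "stop_at (\<tau> \<omega>) s = stop_at (\<tau> \<omega>') s"
  using stopping_timeD[OF assms] stopping_time_le_iff[OF assms]
  by (cases "\<tau> \<omega> \<le> ereal s") (auto simp: stop_at_def min_def)

lemma stop_at_measurable:
  assumes "stopping_time J \<tau>"
  shows "(\<lambda>\<omega>. stop_at (\<tau> \<omega>) s) \<in> borel_measurable (Fsig J)"
proof -
  have [measurable]: "\<tau> \<in> borel_measurable (Fsig J)" by (rule stopping_time_measurable[OF assms])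
  show ?thesis unfolding stop_at_def by measurable
qed

lemma floor_grid_tendsto:
  assumes "0 \<le> (x::real)"
  shows "(\<lambda>n. real (nat \<lfloor>x * real (Suc n)\<rfloor>) / real (Suc n)) \<longlonglongrightarrow> x"
proof (rule tendsto_sandwich)
  show "(\<lambda>n. x - 1 / real (Suc n)) \<longlonglongrightarrow> x"
    using tendsto_diff[OF tendsto_const LIMSEQ_inverse_real_of_nat, of x] by (simp add: inverse_eq_divide)
  have *: "0 \<le> x * real (Suc n)" for n using assms by simp
  have "x - 1 / real (Suc n) \<le> real (nat \<lfloor>x * real (Suc n)\<rfloor>) / real (Suc n)" for n
  proof -
    have "x * real (Suc n) - 1 \<le> real_of_int \<lfloor>x * real (Suc n)\<rfloor>" by linarith
    also have "\<dots> = real (nat \<lfloor>x * real (Suc n)\<rfloor>)" using *[of n] by simp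
    finally have "(x * real (Suc n) - 1) / real (Suc n) \<le> real (nat \<lfloor>x * real (Suc n)\<rfloor>) / real (Suc n)"
      by (rule divide_right_mono) simp
    moreover have "(x * real (Suc n) - 1) / real (Suc n) = x - 1 / real (Suc n)"
      by (simp add: field_simps)
    ultimately show ?thesis by simp
  qed
  then show "\<forall>\<^sub>F n in sequentially. x - 1 / real (Suc n) \<le> real (nat \<lfloor>x * real (Suc n)\<rfloor>) / real (Suc n)"
    by simp
  have "real (nat \<lfloor>x * real (Suc n)\<rfloor>) / real (Suc n) \<le> x" for n
  proof -
    have "real (nat \<lfloor>x * real (Suc n)\<rfloor>) = real_of_int \<lfloor>x * real (Suc n)\<rfloor>" using *[of n] by simp
    also have "\<dots> \<le> x * real (Suc n)" by linarith
    finally show ?thesis by (simp add: pos_divide_le_eq del: of_nat_Suc)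
  qed
  then show "\<forall>\<^sub>F n in sequentially. real (nat \<lfloor>x * real (Suc n)\<rfloor>) / real (Suc n) \<le> x"
    by simp
qed (rule tendsto_const)

text \<open>Rounding \<open>f\<close> down to multiples of 1/(n+1) leaves countably many fixed
  times, each giving a measurable coordinate; continuity of the path passes this to the
  limit.\<close>

lemma coordinate_at_random_time_measurable:
  assumes j: "j < J" and f: "f \<in> borel_measurable (Fsig J)" "\<And>\<omega>. \<omega> \<in> Omega J \<Longrightarrow> 0 \<le> f \<omega>"
  shows "(\<lambda>\<omega>. \<omega> j (f \<omega>)) \<in> borel_measurable (Fsig J)"
proof (rule borel_measurable_LIMSEQ_real)
  let ?k = "\<lambda>n \<omega>. nat \<lfloor>f \<omega> * real (Suc n)\<rfloor>"
  fix n
  have "(\<lambda>\<omega>. ?k n \<omega>) \<in> measurable (Fsig J) (count_space UNIV)"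
    using f(1) by measurable
  moreover have "(\<lambda>\<omega>. \<omega> j (real i / real (Suc n))) \<in> borel_measurable (Fsig J)" for i
    using j by (intro coordinate_measurable) auto
  ultimately show "(\<lambda>\<omega>. \<omega> j (real (?k n \<omega>) / real (Suc n))) \<in> borel_measurable (Fsig J)"
    by (rule measurable_compose_countable[rotated])
next
  fix \<omega> assume "\<omega> \<in> space (Fsig J)"
  then have \<omega>: "\<omega> \<in> Omega J" by simp
  show "(\<lambda>n. \<omega> j (real (nat \<lfloor>f \<omega> * real (Suc n)\<rfloor>) / real (Suc n))) \<longlonglongrightarrow> \<omega> j (f \<omega>)"
    by (rule continuous_on_tendsto_compose[OF coordinate_continuous[OF \<omega> j]
          floor_grid_tendsto[OF f(2)[OF \<omega>]]]) (use f(2)[OF \<omega>] in auto)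
qed

lemma stopping_time_osc_grid: "stopping_time J (osc_grid J \<delta> i)"
proof (induction i)
  case 0
  show ?case by (simp add: stopping_time_const)
next
  case (Suc i)
  let ?G = "osc_grid J \<delta> i"
  have nn: "0 \<le> ?G \<omega>" if "\<omega> \<in> Omega J" for \<omega> using stopping_time_nonneg[OF Suc that] .
  let ?Y = "\<lambda>s \<omega>. \<Sum>j<J. \<bar>\<omega> j s - \<omega> j (stop_at (?G \<omega>) s)\<bar>"
  have "stopping_time J (\<lambda>\<omega>. hitting_time (\<lambda>s. ?Y s \<omega>) \<delta>)"
  proof (rule stopping_time_hitting_time)
    fix s :: real assume s: "0 \<le> s"
    show "?Y s \<in> borel_measurable (Fsig J)"
      by (intro borel_measurable_sum borel_measurable_abs borel_measurable_diff coordinate_measurable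
            coordinate_at_random_time_measurable stop_at_measurable Suc)
        (use s stop_at_bounds[OF nn s] in auto)
  next
    show "adapted J ?Y"
      unfolding adapted_def
    proof (intro allI ballI impI)
      fix s :: real and \<omega> \<omega>' assume s: "0 \<le> s" and *: "\<omega> \<in> Omega J" "\<omega>' \<in> Omega J" "agree_upto J (ereal s) \<omega> \<omega>'"
      have "\<omega> j u = \<omega>' j u" if "j < J" "0 \<le> u" "u \<le> s" for j u
        using *(3) that by (simp add: agree_upto_def)
      then show "?Y s \<omega> = ?Y s \<omega>'"
        using stop_at_adapted[OF Suc *] stop_at_bounds[OF nn[OF *(1)] s] s by (intro sum.cong) auto
    qed
  qed (intro continuous_displacement nn)
  then show ?case by simp
qed

text \<open>The second claim bounds the movement within a cell; the third, that a cell of finite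
  length ends with a displacement of at least \<delta>, keeps the times from accumulating.\<close>

lemma osc_grid_Suc:
  assumes "0 < \<delta>" and \<omega>: "\<omega> \<in> Omega J" and r: "r = osc_grid J \<delta> i \<omega>"
  shows "r \<le> osc_grid J \<delta> (Suc i) \<omega>"
    and "\<And>s. r \<le> ereal s \<Longrightarrow> ereal s \<le> osc_grid J \<delta> (Suc i) \<omega> \<Longrightarrow>
           (\<Sum>j<J. \<bar>\<omega> j s - \<omega> j (real_of_ereal r)\<bar>) \<le> \<delta>"
    and "\<And>p. osc_grid J \<delta> (Suc i) \<omega> = ereal p \<Longrightarrow>
           \<delta> \<le> (\<Sum>j<J. \<bar>\<omega> j p - \<omega> j (real_of_ereal r)\<bar>)"
proof -
  define y where "y s = (\<Sum>j<J. \<bar>\<omega> j s - \<omega> j (stop_at r s)\<bar>)" for s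
  have nn: "0 \<le> r" unfolding r by (rule stopping_time_nonneg[OF stopping_time_osc_grid \<omega>])
  have c: "continuous_on {0..} y" unfolding y_def by (rule continuous_displacement[OF \<omega> nn])
  have G: "osc_grid J \<delta> (Suc i) \<omega> = hitting_time y \<delta>" by (simp add: r y_def[abs_def])
  have y_after: "y s = (\<Sum>j<J. \<bar>\<omega> j s - \<omega> j (real_of_ereal r)\<bar>)" if "r \<le> ereal s" for s
    using that by (simp add: y_def stop_at_below)
  have y_before: "y s = 0" if "ereal s \<le> r" for s
    using that by (simp add: y_def stop_at_above)
  show le: "r \<le> osc_grid J \<delta> (Suc i) \<omega>"
    unfolding G hitting_time_def
  proof (rule INF_greatest)
    fix s assume "s \<in> {s. 0 \<le> s \<and> \<delta> \<le> y s}"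
    then show "r \<le> ereal s" using y_before[of s] assms(1) by (cases "ereal s \<le> r") auto
  qed
  have y_le: "y s \<le> \<delta>" if s: "0 \<le> s" "ereal s \<le> hitting_time y \<delta>" for s
  proof (rule hitting_time_cases[OF c, of \<delta>])
    assume "\<And>s. 0 \<le> s \<Longrightarrow> y s < \<delta>" then show ?thesis using s by (simp add: less_imp_le)
  next
    fix p assume p: "hitting_time y \<delta> = ereal p" "0 \<le> p" "\<And>s. 0 \<le> s \<Longrightarrow> s < p \<Longrightarrow> y s < \<delta>"
    consider "s < p" | "s = p" "0 < p" | "s = p" "p = 0" using s p by fastforce
    then show ?thesis
    proof cases
      case 1 then show ?thesis using p(3)[of s] s by simp
    next
      case 2
      have cl: "closure {0..<p} = {0..p}" using 2(2) by (rule closure_atLeastLessThan)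
      have "y p \<le> \<delta>"
      proof (rule continuous_le_on_closure[of "{0..<p}" y])
        show "continuous_on (closure {0..<p}) y"
          unfolding cl by (rule continuous_on_subset[OF c]) auto
        show "p \<in> closure {0..<p}" unfolding cl using 2(2) by simp
        show "\<And>x. x \<in> {0..<p} \<Longrightarrow> y x \<le> \<delta>" using p(3) by (simp add: less_imp_le)
      qed
      then show ?thesis using 2 by simp
    next
      \<comment> \<open>The interval \<open>{0..<p}\<close> is empty here, so the closure argument
        gives nothing; instead \<open>y 0 = 0\<close>, as \<open>0 \<le> r\<close>.\<close>
      case 3
      then show ?thesis using y_before[of 0] nn assms(1) by (simp add: zero_ereal_def)
    qed
  qed
  show "(\<Sum>j<J. \<bar>\<omega> j s - \<omega> j (real_of_ereal r)\<bar>) \<le> \<delta>"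
    if "r \<le> ereal s" "ereal s \<le> osc_grid J \<delta> (Suc i) \<omega>" for s
  proof -
    have "0 \<le> s" using nn that(1) by (metis ereal_less_eq(5) order_trans)
    then show ?thesis using y_le[of s] that y_after[of s] unfolding G by simp
  qed
  show "\<delta> \<le> (\<Sum>j<J. \<bar>\<omega> j p - \<omega> j (real_of_ereal r)\<bar>)" if "osc_grid J \<delta> (Suc i) \<omega> = ereal p" for p
  proof -
    have "r \<le> ereal p" using le that by simp
    moreover have "\<delta> \<le> y p"
      by (rule hitting_time_cases[OF c, of \<delta>]) (use that G in auto)
    ultimately show ?thesis using y_after by simp
  qed
qed

lemma st_grid_osc_grid:
  assumes "0 < \<delta>" shows "st_grid J (osc_grid J \<delta>)"
  unfolding st_grid_def time_grid_def
  by (intro conjI allI ballI stopping_time_osc_grid incseq_SucI osc_grid_Suc(1)[OF assms _ refl]) auto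

text \<open>Bounded grid times would converge to some \<open>l\<close>. By continuity of the path at
  \<open>l\<close> the displacements between consecutive grid times would tend to 0, although each
  is at least \<delta>.\<close>

lemma exhausting_osc_grid:
  assumes "0 < \<delta>" shows "exhausting J (osc_grid J \<delta>)"
  unfolding exhausting_def
proof (intro ballI allI, rule ccontr)
  fix \<omega> t assume \<omega>: "\<omega> \<in> Omega J" and "\<not> (\<exists>k. ereal t < osc_grid J \<delta> k \<omega>)"
  then have le: "osc_grid J \<delta> k \<omega> \<le> ereal t" for k by (simp add: not_less)
  define g where "g k = real_of_ereal (osc_grid J \<delta> k \<omega>)" for k
  have r: "time_grid (\<lambda>k. osc_grid J \<delta> k \<omega>)" using st_gridD(2)[OF st_grid_osc_grid[OF assms] \<omega>] .
  have g: "osc_grid J \<delta> k \<omega> = ereal (g k)" for k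
    unfolding g_def by (rule real_of_finite_time[OF time_grid_nonneg[OF r] le, symmetric])
  have "incseq g" using r g by (auto simp: time_grid_def incseq_def)
  moreover have "\<forall>k. g k \<le> t" using le g by simp
  ultimately obtain l where l: "g \<longlonglongrightarrow> l" "\<forall>i. g i \<le> l" by (rule incseq_convergent)
  have g0: "0 \<le> g k" for k using time_grid_nonneg[OF r, of k] g by simp
  have "0 \<le> l" using l(2) g0[of 0] by (metis order_trans)
  have lim: "(\<lambda>k. \<omega> j (g k)) \<longlonglongrightarrow> \<omega> j l" if "j < J" for j
    by (rule continuous_on_tendsto_compose[OF coordinate_continuous[OF \<omega> that] l(1)])
      (use \<open>0 \<le> l\<close> g0 in auto)
  have "(\<lambda>k. \<Sum>j<J. \<bar>\<omega> j (g (Suc k)) - \<omega> j (g k)\<bar>) \<longlonglongrightarrow> (\<Sum>j<J. \<bar>\<omega> j l - \<omega> j l\<bar>)"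
    by (intro tendsto_sum tendsto_rabs tendsto_diff LIMSEQ_Suc[OF lim] lim) auto
  then have "(\<lambda>k. \<Sum>j<J. \<bar>\<omega> j (g (Suc k)) - \<omega> j (g k)\<bar>) \<longlonglongrightarrow> 0" by simp
  moreover have "\<delta> \<le> (\<Sum>j<J. \<bar>\<omega> j (g (Suc k)) - \<omega> j (g k)\<bar>)" for k
    using osc_grid_Suc(3)[OF assms \<omega> refl g, of k] by (simp add: g)
  ultimately have "\<delta> \<le> 0" by (intro LIMSEQ_le_const) auto
  with assms show False by simp
qed

section \<open>Simple capital processes\<close>

lemma time_grid_interval:
  assumes r: "time_grid r" and t: "0 \<le> t" "ereal t < r M"
  obtains m where "m < M" "r m \<le> ereal t" "ereal t < r (Suc m)"
proof -
  define k where "k = (LEAST k. ereal t < r k)"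
  have k: "ereal t < r k" unfolding k_def by (rule LeastI) (rule t(2))
  have min: "\<not> ereal t < r i" if "i < k" for i using not_less_Least that unfolding k_def .
  have "k \<noteq> 0" using k r t(1) by (metis ereal_less_eq(5) not_less time_grid_zero)
  then obtain m where m: "k = Suc m" by (metis not0_implies_Suc)
  have "k \<le> M" unfolding k_def by (rule Least_le) (rule t(2))
  then show thesis using that[of m] k min[of m] m by auto
qed

text \<open>Stopping an integral is done by making the integrand vanish from some cell on, with the
  grid left alone. The integral then keeps its value at the start of that cell.\<close>

lemma gint_frozen:
  assumes r: "time_grid r" and t: "r m \<le> ereal t" "ereal t \<le> r M"
    and const: "\<And>i s s'. m \<le> i \<Longrightarrow> u i s = u i s'"
  shows "gint r u t = gint r u (real_of_ereal (r m))"
proof -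
  let ?p = "real_of_ereal (r m)"
  have p: "ereal ?p = r m" using real_of_finite_time[OF time_grid_nonneg[OF r] t(1)] .
  have *: "stop_at (r n) t = stop_at (r n) ?p" if "n \<le> m" for n
    using time_grid_mono[OF r that] t p by (metis order_trans stop_at_below)
  have "gint r u t = (\<Sum>n<max m M. u n (stop_at (r (Suc n)) t) - u n (stop_at (r n) t))"
    by (rule gint_eq_sum[OF r order_trans[OF t(2) time_grid_mono[OF r]]]) simp
  also have "\<dots> = (\<Sum>n<m. u n (stop_at (r (Suc n)) t) - u n (stop_at (r n) t))"
    by (rule sum.mono_neutral_right)
      (use const[of _ "stop_at (r (Suc _)) t" "stop_at (r _) t"] in auto)
  also have "\<dots> = gint r u ?p"
    using p by (subst gint_eq_sum[OF r, where m = m]) (auto intro!: sum.cong simp: *)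
  finally show ?thesis .
qed

text \<open>Each merged cell lies in one cell of \<open>P\<close>, over which both integrals grow by
  the same function \<open>u\<close>; \<open>gint_unique\<close> does the rest.\<close>

lemma gint_refine:
  assumes P: "time_grid P" and Q: "time_grid Q" and t: "0 \<le> t" "ereal t \<le> merge_times P Q M"
  shows "gint (merge_times P Q) (\<lambda>m. u (last_index P (merge_times P Q) m)) t = gint P u t"
proof -
  have "gint (merge_times P Q) (\<lambda>m. u (last_index P (merge_times P Q) m)) t = gint P u t - gint P u 0"
  proof (rule gint_unique[OF time_grid_merge[OF P Q] t])
    fix m s
    let ?i = "last_index P (merge_times P Q) m" and ?p = "real_of_ereal (merge_times P Q m)"
    assume s: "merge_times P Q m \<le> ereal s" "ereal s \<le> merge_times P Q (Suc m)"
    have p: "ereal ?p = merge_times P Q m"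
      by (rule real_of_finite_time[OF time_grid_nonneg[OF time_grid_merge[OF P Q]] s(1)])
    show "gint P u s - gint P u ?p = u ?i s - u ?i ?p"
    proof (rule gint_step2[OF P])
      show "P ?i \<le> ereal ?p" unfolding p by (rule merge_interval(1)[OF P Q])
      show "?p \<le> s" using p s(1) by (metis ereal_less_eq(3))
      show "ereal s \<le> P (Suc ?i)" using s(2) merge_interval(2)[OF P Q] by (rule order_trans)
    qed
  qed
  then show ?thesis by (simp add: gint_0[OF P])
qed

lemma gint_add:
  assumes "time_grid r" "ereal t \<le> r m"
  shows "gint r (\<lambda>n s. u n s + v n s) t = gint r u t + gint r v t"
  by (simp add: gint_eq_sum[OF assms] sum.distrib[symmetric] algebra_simps)

lemma gint_scale:
  assumes "time_grid r" "ereal t \<le> r m"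
  shows "gint r (\<lambda>n s. c * u n s) t = c * gint r u t"
  by (simp add: gint_eq_sum[OF assms] sum_distrib_left algebra_simps)

definition gain :: "nat \<Rightarrow> (nat \<Rightarrow> path \<Rightarrow> nat \<Rightarrow> real) \<Rightarrow> path \<Rightarrow> nat \<Rightarrow> real \<Rightarrow> real" where
  "gain Js h \<omega> n s = (\<Sum>j<Js. h n \<omega> j * \<omega> j s)"

definition strategy :: "nat \<Rightarrow> nat \<Rightarrow> (nat \<Rightarrow> path \<Rightarrow> ereal) \<Rightarrow> (nat \<Rightarrow> path \<Rightarrow> nat \<Rightarrow> real) \<Rightarrow> bool" where
  "strategy J Js \<tau> h \<longleftrightarrow> st_grid J \<tau> \<and> exhausting J \<tau> \<and>
     (\<forall>n. \<forall>j<Js. tau_measurable J (\<tau> n) (\<lambda>\<omega>. h n \<omega> j)) \<and>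
     (\<forall>n. \<exists>C. \<forall>\<omega>\<in>Omega J. \<forall>j<Js. \<bar>h n \<omega> j\<bar> \<le> C)"

definition capital :: "nat \<Rightarrow> real \<Rightarrow> (nat \<Rightarrow> path \<Rightarrow> ereal) \<Rightarrow> (nat \<Rightarrow> path \<Rightarrow> nat \<Rightarrow> real) \<Rightarrow>
    real \<Rightarrow> path \<Rightarrow> real" where
  "capital Js c \<tau> h t \<omega> = c + gint (\<lambda>n. \<tau> n \<omega>) (gain Js h \<omega>) t"

lemma strategyD:
  assumes "strategy J Js \<tau> h"
  shows "st_grid J \<tau>" "exhausting J \<tau>"
    "\<And>n j. j < Js \<Longrightarrow> tau_measurable J (\<tau> n) (\<lambda>\<omega>. h n \<omega> j)"
    "\<And>n. \<exists>C. \<forall>\<omega>\<in>Omega J. \<forall>j<Js. \<bar>h n \<omega> j\<bar> \<le> C"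
    "\<And>\<omega>. \<omega> \<in> Omega J \<Longrightarrow> time_grid (\<lambda>n. \<tau> n \<omega>)"
    "\<And>\<omega> t. \<omega> \<in> Omega J \<Longrightarrow> \<exists>k. ereal t < \<tau> k \<omega>"
  using assms unfolding strategy_def st_grid_def exhausting_def by blast+

lemma gain_diff: "gain Js h \<omega> n s - gain Js h \<omega> n s' = (\<Sum>j<Js. h n \<omega> j * (\<omega> j s - \<omega> j s'))"
  by (simp add: gain_def sum_subtractf right_diff_distrib)

lemma simple_capital_capital:
  assumes "strategy J Js \<tau> h"
  shows "simple_capital J Js (capital Js c \<tau> h)"
  unfolding simple_capital_def capital_def gint_def gain_diff
  using strategyD[OF assms] st_gridD(1)[OF strategyD(1)[OF assms]]
    time_grid_mono[OF strategyD(5)[OF assms] le_SucI[OF order_refl]]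
    exhausting_tendsto[OF strategyD(1,2)[OF assms]]
  by (intro exI[of _ c] exI[of _ \<tau>] exI[of _ h]) auto

text \<open>The definition of simple capital processes does not require the first stopping time to be 0.\<close>

lemma simple_capital_strategy:
  assumes "simple_capital J Js K"
  obtains c \<tau> h where "strategy J Js \<tau> h"
    "\<And>t \<omega>. 0 \<le> t \<Longrightarrow> \<omega> \<in> Omega J \<Longrightarrow> K t \<omega> = capital Js c \<tau> h t \<omega>"
proof -
  obtain c \<tau> h where st: "\<And>n. stopping_time J (\<tau> n)"
    and mono: "\<And>n \<omega>. \<omega> \<in> Omega J \<Longrightarrow> \<tau> n \<omega> \<le> \<tau> (Suc n) \<omega>"
    and lim: "\<And>\<omega>. \<omega> \<in> Omega J \<Longrightarrow> (\<lambda>n. \<tau> n \<omega>) \<longlonglongrightarrow> \<infinity>"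
    and h: "\<And>n j. j < Js \<Longrightarrow> tau_measurable J (\<tau> n) (\<lambda>\<omega>. h n \<omega> j)"
    and bdd: "\<And>n. \<exists>C. \<forall>\<omega>\<in>Omega J. \<forall>j<Js. \<bar>h n \<omega> j\<bar> \<le> C"
    and K: "\<And>t \<omega>. K t \<omega> = c + (\<Sum>n. \<Sum>j<Js. h n \<omega> j *
              (\<omega> j (stop_at (\<tau> (Suc n) \<omega>) t) - \<omega> j (stop_at (\<tau> n \<omega>) t)))"
    using assms unfolding simple_capital_def
    apply (elim exE conjE)
    subgoal for c \<tau> h by (rule that[of \<tau> h c]) simp_all
    done
  define \<tau>' where "\<tau>' n = (case n of 0 \<Rightarrow> \<lambda>_. 0 | Suc n \<Rightarrow> \<tau> n)" for n
  define h' where "h' n = (case n of 0 \<Rightarrow> \<lambda>_ _. 0 | Suc n \<Rightarrow> h n)" for n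
  have tg: "time_grid (\<lambda>n. \<tau>' n \<omega>)" if "\<omega> \<in> Omega J" for \<omega>
    unfolding time_grid_def
    by (auto intro!: incseq_SucI simp: \<tau>'_def mono[OF that] stopping_time_nonneg[OF st that] split: nat.split)
  have ex: "\<exists>k. ereal t < \<tau> k \<omega>" if "\<omega> \<in> Omega J" for \<omega> t
    using order_tendstoD(1)[OF lim[OF that], of "ereal t"] by (auto simp: eventually_sequentially)
  have "strategy J Js \<tau>' h'"
    unfolding strategy_def
  proof (intro conjI allI impI)
    show "st_grid J \<tau>'"
      unfolding st_grid_def using tg st by (auto simp: \<tau>'_def stopping_time_const split: nat.split)
    show "exhausting J \<tau>'"
      unfolding exhausting_def
    proof (intro ballI allI)
      fix \<omega> t assume "\<omega> \<in> Omega J"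
      then obtain k where "ereal t < \<tau> k \<omega>" using ex by blast
      then show "\<exists>k. ereal t < \<tau>' k \<omega>" by (intro exI[of _ "Suc k"]) (simp add: \<tau>'_def)
    qed
    show "tau_measurable J (\<tau>' n) (\<lambda>\<omega>. h' n \<omega> j)" if "j < Js" for n j
      using h[OF that] by (auto simp: \<tau>'_def h'_def tau_measurable_const split: nat.split)
    show "\<exists>C. \<forall>\<omega>\<in>Omega J. \<forall>j<Js. \<bar>h' n \<omega> j\<bar> \<le> C" for n
      using bdd by (cases n) (auto simp: h'_def)
  qed
  moreover have "K t \<omega> = capital Js c \<tau>' h' t \<omega>" if t: "0 \<le> t" and \<omega>: "\<omega> \<in> Omega J" for t \<omega>
  proof -
    let ?d = "\<lambda>n. \<Sum>j<Js. h n \<omega> j * (\<omega> j (stop_at (\<tau> (Suc n) \<omega>) t) - \<omega> j (stop_at (\<tau> n \<omega>) t))"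
    obtain k where k: "ereal t < \<tau> k \<omega>" using ex[OF \<omega>] by blast
    have "stop_at (\<tau> n \<omega>) t = t" if "k \<le> n" for n
      using k time_grid_mono[OF tg[OF \<omega>], of "Suc k" "Suc n"] that
      by (intro stop_at_above) (simp add: \<tau>'_def)
    then have "(\<Sum>n. ?d n) = (\<Sum>n<k. ?d n)" by (intro suminf_finite) auto
    also have "\<dots> = gint (\<lambda>n. \<tau>' n \<omega>) (gain Js h' \<omega>) t"
    proof -
      have "gint (\<lambda>n. \<tau>' n \<omega>) (gain Js h' \<omega>) t = (\<Sum>n<Suc k. \<Sum>j<Js. h' n \<omega> j *
          (\<omega> j (stop_at (\<tau>' (Suc n) \<omega>) t) - \<omega> j (stop_at (\<tau>' n \<omega>) t)))"
        using k by (subst gint_eq_sum[OF tg[OF \<omega>], where m = "Suc k"]) (simp_all add: \<tau>'_def gain_diff)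
      also have "\<dots> = (\<Sum>n<k. ?d n)"
        unfolding sum.lessThan_Suc_shift by (simp add: \<tau>'_def h'_def)
      finally show ?thesis by simp
    qed
    finally show ?thesis by (simp add: K capital_def)
  qed
  ultimately show thesis by (rule that)
qed

text \<open>Positions are bounded index by index only, but any initial segment has a common bound.
  Since \<open>last_index\<close> at \<open>m\<close> is at most \<open>m\<close>, this suffices to
  bound positions carried to a refinement.\<close>

lemma strategy_bound_upto:
  assumes "strategy J Js \<tau> h"
  obtains B where "0 \<le> B" "\<And>n \<omega> j. n \<le> N \<Longrightarrow> \<omega> \<in> Omega J \<Longrightarrow> j < Js \<Longrightarrow> \<bar>h n \<omega> j\<bar> \<le> B"
proof -
  obtain C where C: "\<And>n \<omega> j. \<omega> \<in> Omega J \<Longrightarrow> j < Js \<Longrightarrow> \<bar>h n \<omega> j\<bar> \<le> C n"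
    using strategyD(4)[OF assms] by metis
  show thesis
  proof (rule that)
    show "0 \<le> (\<Sum>n\<le>N. \<bar>C n\<bar>)" by (simp add: sum_nonneg)
    fix n \<omega> j assume "n \<le> N" "\<omega> \<in> Omega J" "j < Js"
    then have "\<bar>h n \<omega> j\<bar> \<le> \<bar>C n\<bar>" using C[of \<omega> j n] by linarith
    also have "\<dots> \<le> (\<Sum>n\<le>N. \<bar>C n\<bar>)" using \<open>n \<le> N\<close> by (intro member_le_sum) auto
    finally show "\<bar>h n \<omega> j\<bar> \<le> (\<Sum>n\<le>N. \<bar>C n\<bar>)" .
  qed
qed

lemma strategy_refine:
  assumes s: "strategy J Js \<tau> h" and \<sigma>: "st_grid J \<sigma>" "exhausting J \<sigma>"
  defines "h' \<equiv> \<lambda>m \<omega>. h (last_index (\<lambda>k. \<tau> k \<omega>) (\<lambda>k. mergeg \<tau> \<sigma> k \<omega>) m) \<omega>"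
  shows "strategy J Js (mergeg \<tau> \<sigma>) h'"
    and "\<And>t \<omega>. 0 \<le> t \<Longrightarrow> \<omega> \<in> Omega J \<Longrightarrow>
      gint (\<lambda>m. mergeg \<tau> \<sigma> m \<omega>) (gain Js h' \<omega>) t = gint (\<lambda>n. \<tau> n \<omega>) (gain Js h \<omega>) t"
proof -
  note \<tau> = strategyD[OF s]
  have g: "st_grid J (mergeg \<tau> \<sigma>)" by (rule st_grid_merge[OF \<tau>(1) \<sigma>(1)])
  have e: "exhausting J (mergeg \<tau> \<sigma>)" by (rule exhausting_merge[OF \<tau>(1) \<sigma>(1) \<tau>(2) \<sigma>(2)])
  show "strategy J Js (mergeg \<tau> \<sigma>) h'"
    unfolding strategy_def
  proof (intro conjI allI impI g e)
    fix m j assume "j < Js"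
    then show "tau_measurable J (mergeg \<tau> \<sigma> m) (\<lambda>\<omega>. h' m \<omega> j)"
      unfolding h'_def
      using tau_measurable_last_index[OF \<tau>(1) g, of "\<lambda>k \<omega>. h k \<omega> j" m] \<tau>(3) by blast
  next
    fix m
    obtain B where B: "\<And>n \<omega> j. n \<le> m \<Longrightarrow> \<omega> \<in> Omega J \<Longrightarrow> j < Js \<Longrightarrow> \<bar>h n \<omega> j\<bar> \<le> B"
      using strategy_bound_upto[OF s] by metis
    have "\<bar>h' m \<omega> j\<bar> \<le> B" if "\<omega> \<in> Omega J" "j < Js" for \<omega> j
      unfolding h'_def
      by (rule B[OF merge_interval(3)[OF \<tau>(5)[OF that(1)] st_gridD(2)[OF \<sigma>(1) that(1)]] that])
    then show "\<exists>C. \<forall>\<omega>\<in>Omega J. \<forall>j<Js. \<bar>h' m \<omega> j\<bar> \<le> C" by blast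
  qed
  fix t \<omega> assume t: "0 \<le> (t::real)" and \<omega>: "\<omega> \<in> Omega J"
  obtain M where "ereal t < mergeg \<tau> \<sigma> M \<omega>" using e \<omega> unfolding exhausting_def by blast
  then have "gint (\<lambda>m. mergeg \<tau> \<sigma> m \<omega>) (\<lambda>m. gain Js h \<omega> (last_index (\<lambda>k. \<tau> k \<omega>) (\<lambda>m. mergeg \<tau> \<sigma> m \<omega>) m)) t
      = gint (\<lambda>n. \<tau> n \<omega>) (gain Js h \<omega>) t"
    by (intro gint_refine[OF \<tau>(5)[OF \<omega>] st_gridD(2)[OF \<sigma>(1) \<omega>] t]) (rule less_imp_le)
  moreover have "(\<lambda>m. gain Js h \<omega> (last_index (\<lambda>k. \<tau> k \<omega>) (\<lambda>m. mergeg \<tau> \<sigma> m \<omega>) m)) = gain Js h' \<omega>"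
    by (simp add: h'_def gain_def fun_eq_iff)
  ultimately show "gint (\<lambda>m. mergeg \<tau> \<sigma> m \<omega>) (gain Js h' \<omega>) t = gint (\<lambda>n. \<tau> n \<omega>) (gain Js h \<omega>) t"
    by simp
qed

lemma strategy_add:
  assumes s1: "strategy J Js \<tau>1 h1" and s2: "strategy J Js \<tau>2 h2"
  obtains \<tau> h where "strategy J Js \<tau> h"
    "\<And>t \<omega>. 0 \<le> t \<Longrightarrow> \<omega> \<in> Omega J \<Longrightarrow>
       capital Js (c1 + c2) \<tau> h t \<omega> = capital Js c1 \<tau>1 h1 t \<omega> + capital Js c2 \<tau>2 h2 t \<omega>"
proof -
  let ?\<tau> = "mergeg \<tau>1 \<tau>2"
  have comm: "mergeg \<tau>2 \<tau>1 = ?\<tau>" by (intro ext) (rule merge_times_commute[THEN fun_cong])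
  obtain k1 where k1: "strategy J Js ?\<tau> k1" "\<And>t \<omega>. 0 \<le> t \<Longrightarrow> \<omega> \<in> Omega J \<Longrightarrow>
      gint (\<lambda>m. ?\<tau> m \<omega>) (gain Js k1 \<omega>) t = gint (\<lambda>n. \<tau>1 n \<omega>) (gain Js h1 \<omega>) t"
    using strategy_refine[OF s1 strategyD(1,2)[OF s2]] by blast
  obtain k2 where k2: "strategy J Js ?\<tau> k2" "\<And>t \<omega>. 0 \<le> t \<Longrightarrow> \<omega> \<in> Omega J \<Longrightarrow>
      gint (\<lambda>m. ?\<tau> m \<omega>) (gain Js k2 \<omega>) t = gint (\<lambda>n. \<tau>2 n \<omega>) (gain Js h2 \<omega>) t"
    using strategy_refine[OF s2 strategyD(1,2)[OF s1]] unfolding comm fun_cong[OF fun_cong[OF comm]] by blast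
  let ?h = "\<lambda>m \<omega> j. k1 m \<omega> j + k2 m \<omega> j"
  have st: "strategy J Js ?\<tau> ?h"
    unfolding strategy_def
  proof (intro conjI allI impI strategyD(1,2)[OF k1(1)])
    fix m j assume j: "j < Js"
    show "tau_measurable J (?\<tau> m) (\<lambda>\<omega>. ?h m \<omega> j)"
      by (rule tau_measurable_comp2[where F = "(+)", OF strategyD(3)[OF k1(1) j] strategyD(3)[OF k2(1) j]])
  next
    fix m
    obtain C1 C2 where "\<forall>\<omega>\<in>Omega J. \<forall>j<Js. \<bar>k1 m \<omega> j\<bar> \<le> C1" "\<forall>\<omega>\<in>Omega J. \<forall>j<Js. \<bar>k2 m \<omega> j\<bar> \<le> C2"
      using strategyD(4)[OF k1(1), of m] strategyD(4)[OF k2(1), of m] by blast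
    then show "\<exists>C. \<forall>\<omega>\<in>Omega J. \<forall>j<Js. \<bar>?h m \<omega> j\<bar> \<le> C"
      by (intro exI[of _ "C1 + C2"]) (meson abs_triangle_ineq add_mono order_trans)
  qed
  moreover have "capital Js (c1 + c2) ?\<tau> ?h t \<omega> = capital Js c1 \<tau>1 h1 t \<omega> + capital Js c2 \<tau>2 h2 t \<omega>"
    if t: "0 \<le> t" and \<omega>: "\<omega> \<in> Omega J" for t \<omega>
  proof -
    obtain M where M: "ereal t < ?\<tau> M \<omega>" using strategyD(6)[OF st \<omega>] by blast
    have "gain Js ?h \<omega> = (\<lambda>n s. gain Js k1 \<omega> n s + gain Js k2 \<omega> n s)"
      by (simp add: gain_def fun_eq_iff sum.distrib distrib_right)
    then show ?thesis
      using gint_add[OF strategyD(5)[OF st \<omega>] less_imp_le[OF M]] k1(2)[OF t \<omega>] k2(2)[OF t \<omega>]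
      by (simp add: capital_def)
  qed
  ultimately show thesis by (rule that)
qed

lemma strategy_scale:
  assumes s: "strategy J Js \<tau> h"
  shows "strategy J Js \<tau> (\<lambda>n \<omega> j. b * h n \<omega> j)"
    and "\<And>t \<omega>. 0 \<le> t \<Longrightarrow> \<omega> \<in> Omega J \<Longrightarrow>
       capital Js (b * c) \<tau> (\<lambda>n \<omega> j. b * h n \<omega> j) t \<omega> = b * capital Js c \<tau> h t \<omega>"
proof -
  show "strategy J Js \<tau> (\<lambda>n \<omega> j. b * h n \<omega> j)"
    unfolding strategy_def
  proof (intro conjI allI impI strategyD(1,2)[OF s])
    fix m j assume j: "j < Js"
    show "tau_measurable J (\<tau> m) (\<lambda>\<omega>. b * h m \<omega> j)"
      by (rule tau_measurable_comp[where F = "\<lambda>x. b * x", OF strategyD(3)[OF s j]])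
  next
    fix m
    obtain C where "\<forall>\<omega>\<in>Omega J. \<forall>j<Js. \<bar>h m \<omega> j\<bar> \<le> C"
      using strategyD(4)[OF s, of m] by blast
    then show "\<exists>C. \<forall>\<omega>\<in>Omega J. \<forall>j<Js. \<bar>b * h m \<omega> j\<bar> \<le> C"
      by (intro exI[of _ "\<bar>b\<bar> * C"]) (simp add: abs_mult mult_left_mono)
  qed
  fix t \<omega> assume t: "0 \<le> (t::real)" and \<omega>: "\<omega> \<in> Omega J"
  obtain M where M: "ereal t < \<tau> M \<omega>" using strategyD(6)[OF s \<omega>] by blast
  have "gain Js (\<lambda>n \<omega> j. b * h n \<omega> j) \<omega> = (\<lambda>n s. b * gain Js h \<omega> n s)"
    by (simp add: gain_def fun_eq_iff sum_distrib_left mult.assoc)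
  then show "capital Js (b * c) \<tau> (\<lambda>n \<omega> j. b * h n \<omega> j) t \<omega> = b * capital Js c \<tau> h t \<omega>"
    using gint_scale[OF strategyD(5)[OF s \<omega>] less_imp_le[OF M], of b "gain Js h \<omega>"]
    by (simp add: capital_def distrib_left)
qed

text \<open>A cell starting after \<open>t\<close> contributes nothing. In a cell with
  \<open>\<tau> n \<omega> \<le> t\<close> the position and the stopped times are determined by the
  path up to \<open>t\<close>; \<open>Js \<le> J\<close> makes the traded prices part of that
  path.\<close>

lemma capital_adapted:
  assumes s: "strategy J Js \<tau> h" and Js: "Js \<le> J"
  shows "adapted J (capital Js c \<tau> h)"
  unfolding adapted_def
proof (intro allI ballI impI)
  fix t :: real and \<omega> \<omega>'
  assume t: "0 \<le> t" and *: "\<omega> \<in> Omega J" "\<omega>' \<in> Omega J" "agree_upto J (ereal t) \<omega> \<omega>'"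
  note st = st_gridD(1)[OF strategyD(1)[OF s]]
  obtain M where M: "ereal t < \<tau> M \<omega>" using strategyD(6)[OF s *(1)] by blast
  have M': "ereal t < \<tau> M \<omega>'"
    using M stopping_time_le_iff[OF st * , of M] by (simp add: not_le[symmetric])
  have path: "\<omega> j u = \<omega>' j u" if "j < Js" "0 \<le> u" "u \<le> t" for j u
    using *(3) Js that by (simp add: agree_upto_def)
  have "gain Js h \<omega> n (stop_at (\<tau> (Suc n) \<omega>) t) - gain Js h \<omega> n (stop_at (\<tau> n \<omega>) t) =
        gain Js h \<omega>' n (stop_at (\<tau> (Suc n) \<omega>') t) - gain Js h \<omega>' n (stop_at (\<tau> n \<omega>') t)" for n
  proof (cases "\<tau> n \<omega> \<le> ereal t")
    case True
    have h: "h n \<omega> j = h n \<omega>' j" if "j < Js" for j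
      using strategyD(3)[OF s that, of n] * agree_upto_mono[OF *(3) True]
      unfolding tau_measurable_def by blast
    have b: "0 \<le> stop_at (\<tau> k \<omega>) t \<and> stop_at (\<tau> k \<omega>) t \<le> t" for k
      using stop_at_bounds[OF stopping_time_nonneg[OF st *(1)] t] .
    show ?thesis
      unfolding gain_diff stop_at_adapted[OF st *, symmetric]
      using h path b by (intro sum.cong) auto
  next
    case False
    then have "ereal t \<le> \<tau> n \<omega>" "ereal t \<le> \<tau> (Suc n) \<omega>"
      using time_grid_mono[OF strategyD(5)[OF s *(1)], of n "Suc n"] by auto
    then show ?thesis
      unfolding gain_diff stop_at_adapted[OF st *, symmetric] by (simp add: stop_at_above)
  qed
  then show "capital Js c \<tau> h t \<omega> = capital Js c \<tau> h t \<omega>'"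
    unfolding capital_def
    by (simp add: gint_eq_sum[OF strategyD(5)[OF s *(1)] less_imp_le[OF M]]
        gint_eq_sum[OF strategyD(5)[OF s *(2)] less_imp_le[OF M']])
qed

text \<open>Positions need not be measurable, so the hitting time of a level by a capital process need
  not be a stopping time. Instead the strategy is stopped at the first point, where the capital is
  below \<open>\<epsilon>\<close>, of a grid so fine that the capital moves by at most \<open>\<epsilon>\<close> between grid points.\<close>

lemma strategy_stopped_nonneg:
  assumes s: "strategy J Js \<tau> h" and Js: "Js \<le> J" and a: "0 \<le> a" and \<epsilon>: "0 < \<epsilon>"
    and B: "\<And>n \<omega> j. \<omega> \<in> Omega J \<Longrightarrow> j < Js \<Longrightarrow> \<bar>h n \<omega> j\<bar> \<le> B" "0 \<le> B"
  obtains r h' where "strategy J Js r h'"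
    "\<And>t \<omega>. 0 \<le> t \<Longrightarrow> \<omega> \<in> Omega J \<Longrightarrow> 0 \<le> capital Js a r h' t \<omega>"
    "\<And>t \<omega>. 0 \<le> t \<Longrightarrow> \<omega> \<in> Omega J \<Longrightarrow> (\<And>s. 0 \<le> s \<Longrightarrow> s \<le> t \<Longrightarrow> \<epsilon> \<le> capital Js a \<tau> h s \<omega>) \<Longrightarrow>
       capital Js a r h' t \<omega> = capital Js a \<tau> h t \<omega>"
proof -
  \<comment> \<open>The factor 2 accounts for two displacements from a common base point, and
    \<open>B + 1\<close> avoids division by zero.\<close>
  define \<delta> where "\<delta> = \<epsilon> / (2 * (B + 1))"
  have \<delta>: "0 < \<delta>" "B * (\<delta> + \<delta>) \<le> \<epsilon>"
  proof -
    show "0 < \<delta>" using B(2) \<epsilon> by (simp add: \<delta>_def)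
    have "B * (\<delta> + \<delta>) \<le> (B + 1) * (\<delta> + \<delta>)"
      using \<open>0 < \<delta>\<close> by (intro mult_right_mono) auto
    also have "\<dots> = \<epsilon>" using B(2) by (simp add: \<delta>_def add_divide_distrib[symmetric] del: distrib_left_numeral)
    finally show "B * (\<delta> + \<delta>) \<le> \<epsilon>" .
  qed
  define G where "G = osc_grid J \<delta>"
  have G: "st_grid J G" "exhausting J G"
    unfolding G_def by (rule st_grid_osc_grid[OF \<delta>(1)], rule exhausting_osc_grid[OF \<delta>(1)])
  define r where "r = mergeg \<tau> G"
  define k where "k = (\<lambda>m \<omega>. h (last_index (\<lambda>k. \<tau> k \<omega>) (\<lambda>k. mergeg \<tau> G k \<omega>) m) \<omega>)"
  have sk: "strategy J Js r k" unfolding r_def k_def by (rule strategy_refine(1)[OF s G])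
  define K where "K = capital Js a \<tau> h"
  have K: "K t \<omega> = capital Js a r k t \<omega>" if "0 \<le> t" "\<omega> \<in> Omega J" for t \<omega>
    unfolding K_def capital_def r_def k_def using strategy_refine(2)[OF s G that] by simp
  have kB: "\<bar>k m \<omega> j\<bar> \<le> B" if "\<omega> \<in> Omega J" "j < Js" for m \<omega> j
    unfolding k_def by (rule B(1)[OF that])
  \<comment> \<open>The positions are closed at the first grid point where the capital is below
    \<epsilon>. This only looks at grid times already passed, so it is admissible although
    \<open>K\<close> need not be measurable.\<close>
  define alive where "alive m \<omega> \<longleftrightarrow> (\<forall>i\<le>m. \<epsilon> \<le> K (real_of_ereal (r i \<omega>)) \<omega>)" for m \<omega>
  define h' where "h' m \<omega> j = (if alive m \<omega> then k m \<omega> j else 0)" for m \<omega> j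
  have K_meas: "tau_measurable J (r m) (\<lambda>\<omega>. K (real_of_ereal (r i \<omega>)) \<omega>)" if "i \<le> m" for i m
  proof (rule tau_measurable_mono)
    show "tau_measurable J (r i) (\<lambda>\<omega>. K (real_of_ereal (r i \<omega>)) \<omega>)"
      unfolding K_def
      by (rule tau_measurable_at[OF capital_adapted[OF s Js] st_gridD(1)[OF strategyD(1)[OF sk]]])
    show "r i \<omega> \<le> r m \<omega>" if "\<omega> \<in> Omega J" for \<omega>
      using time_grid_mono[OF strategyD(5)[OF sk that] \<open>i \<le> m\<close>] .
  qed
  have alive_meas: "tau_measurable J (r m) (alive m)" for m
    unfolding tau_measurable_def
  proof (intro ballI impI)
    fix \<omega> \<omega>' assume *: "\<omega> \<in> Omega J" "\<omega>' \<in> Omega J" "agree_upto J (r m \<omega>) \<omega> \<omega>'"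
    have "K (real_of_ereal (r i \<omega>)) \<omega> = K (real_of_ereal (r i \<omega>')) \<omega>'" if "i \<le> m" for i
      using K_meas[OF that] * unfolding tau_measurable_def by blast
    then show "alive m \<omega> = alive m \<omega>'" unfolding alive_def by simp
  qed
  have s': "strategy J Js r h'"
    unfolding strategy_def
  proof (intro conjI allI impI strategyD(1,2)[OF sk])
    fix m j assume j: "j < Js"
    show "tau_measurable J (r m) (\<lambda>\<omega>. h' m \<omega> j)"
      unfolding h'_def
      by (rule tau_measurable_comp2[where F = "\<lambda>b x. if b then x else 0", OF alive_meas strategyD(3)[OF sk j]])
  next
    fix m show "\<exists>C. \<forall>\<omega>\<in>Omega J. \<forall>j<Js. \<bar>h' m \<omega> j\<bar> \<le> C"
      using kB B(2) by (auto simp: h'_def intro!: exI[of _ B])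
  qed
  define Z where "Z = capital Js a r h'"
  have Z_alive: "Z s \<omega> = K s \<omega>"
    if \<omega>: "\<omega> \<in> Omega J" and m: "alive m \<omega>" and s: "0 \<le> s" "ereal s \<le> r (Suc m) \<omega>" for \<omega> m s
  proof -
    note tg = strategyD(5)[OF s' \<omega>]
    have "gain Js h' \<omega> n u = gain Js k \<omega> n u" if "n \<le> m" for n u
      using m that unfolding gain_def h'_def alive_def by auto
    then have "gint (\<lambda>n. r n \<omega>) (gain Js h' \<omega>) s = gint (\<lambda>n. r n \<omega>) (gain Js k \<omega>) s"
      unfolding gint_eq_sum[OF tg s(2)] by (intro sum.cong) auto
    then show ?thesis by (simp add: Z_def K[OF s(1) \<omega>] capital_def)
  qed
  have Z_alive_nonneg: "0 \<le> Z s \<omega>"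
    if \<omega>: "\<omega> \<in> Omega J" and m: "alive m \<omega>" and s: "r m \<omega> \<le> ereal s" "ereal s \<le> r (Suc m) \<omega>" for \<omega> m s
  proof -
    note tg = strategyD(5)[OF s' \<omega>]
    let ?p = "real_of_ereal (r m \<omega>)"
    have p: "ereal ?p = r m \<omega>" by (rule real_of_finite_time[OF time_grid_nonneg[OF tg] s(1)])
    have p0: "0 \<le> ?p" using time_grid_nonneg[OF tg, of m] p by (metis ereal_less_eq(5))
    have ps: "?p \<le> s" using p s(1) by (metis ereal_less_eq(3))
    have tG: "time_grid (\<lambda>k. G k \<omega>)" by (rule st_gridD(2)[OF G(1) \<omega>])
    have t\<tau>: "time_grid (\<lambda>k. \<tau> k \<omega>)" by (rule strategyD(5)[OF assms(1) \<omega>])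
    let ?i = "last_index (\<lambda>k. G k \<omega>) (\<lambda>k. mergeg \<tau> G k \<omega>) m"
    note mi = merge_interval2[OF t\<tau> tG, of m]
    have Gp: "G ?i \<omega> \<le> ereal ?p" "ereal ?p \<le> G (Suc ?i) \<omega>" "G ?i \<omega> \<le> ereal s" "ereal s \<le> G (Suc ?i) \<omega>"
      using mi(1,2) s unfolding p unfolding r_def
      by (auto intro: order_trans time_grid_mono[OF tg[unfolded r_def], of m "Suc m"])
    let ?g = "real_of_ereal (G ?i \<omega>)"
    have osc: "(\<Sum>j<J. \<bar>\<omega> j u - \<omega> j ?g\<bar>) \<le> \<delta>" if "G ?i \<omega> \<le> ereal u" "ereal u \<le> G (Suc ?i) \<omega>" for u
      using osc_grid_Suc(2)[OF \<delta>(1) \<omega> refl, of ?i u] that unfolding G_def by simp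
    \<comment> \<open>Both \<open>s\<close> and the left end of cell \<open>m\<close> lie in one
      cell of the oscillation grid, so each is within \<delta> of the path at the start of that
      cell. The capital is at least \<epsilon> at the left end and loses at most \<epsilon> before
      the next decision.\<close>
    have "\<bar>gain Js k \<omega> m s - gain Js k \<omega> m ?p\<bar> \<le> \<epsilon>"
    proof -
      have "\<bar>gain Js k \<omega> m s - gain Js k \<omega> m ?p\<bar> \<le> (\<Sum>j<Js. \<bar>k m \<omega> j * (\<omega> j s - \<omega> j ?p)\<bar>)"
        unfolding gain_diff by (rule sum_abs)
      also have "\<dots> \<le> (\<Sum>j<Js. B * (\<bar>\<omega> j s - \<omega> j ?g\<bar> + \<bar>\<omega> j ?p - \<omega> j ?g\<bar>))"
        unfolding abs_mult using kB[OF \<omega>] B(2) by (intro sum_mono mult_mono) auto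
      also have "\<dots> \<le> (\<Sum>j<J. B * (\<bar>\<omega> j s - \<omega> j ?g\<bar> + \<bar>\<omega> j ?p - \<omega> j ?g\<bar>))"
        using Js B(2) by (intro sum_mono2) auto
      also have "\<dots> = B * ((\<Sum>j<J. \<bar>\<omega> j s - \<omega> j ?g\<bar>) + (\<Sum>j<J. \<bar>\<omega> j ?p - \<omega> j ?g\<bar>))"
        by (simp add: sum_distrib_left[symmetric] sum.distrib)
      also have "\<dots> \<le> B * (\<delta> + \<delta>)"
        using osc[OF Gp(1,2)] osc[OF Gp(3,4)] B(2) by (intro mult_left_mono add_mono)
      finally show ?thesis using \<delta>(2) by simp
    qed
    moreover have "K s \<omega> - K ?p \<omega> = gain Js k \<omega> m s - gain Js k \<omega> m ?p"
      using gint_step[OF tg s, of "gain Js k \<omega>"] p0 ps by (simp add: K[OF _ \<omega>] capital_def)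
    moreover have "\<epsilon> \<le> K ?p \<omega>" using m by (simp add: alive_def)
    moreover have "Z s \<omega> = K s \<omega>" using Z_alive[OF \<omega> m _ s(2)] p0 ps by simp
    ultimately show ?thesis by linarith
  qed
  show thesis
  proof (rule that[of r h', folded Z_def, OF s'])
    fix t :: real and \<omega> assume t: "0 \<le> t" and \<omega>: "\<omega> \<in> Omega J"
    note tg = strategyD(5)[OF s' \<omega>]
    obtain M where "ereal t < r M \<omega>" using strategyD(6)[OF s' \<omega>] by blast
    then obtain m where m: "r m \<omega> \<le> ereal t" "ereal t < r (Suc m) \<omega>"
      using time_grid_interval[OF tg t] by metis
    show "0 \<le> Z t \<omega>"
    proof (cases "alive m \<omega>")
      case True
      then show ?thesis by (rule Z_alive_nonneg[OF \<omega> _ m(1) less_imp_le[OF m(2)]])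
    next
      case False
      define m0 where "m0 = (LEAST i. \<not> alive i \<omega>)"
      have m0: "\<not> alive m0 \<omega>" unfolding m0_def by (rule LeastI) (rule False)
      have "m0 \<le> m" unfolding m0_def by (rule Least_le) (rule False)
      then have r0: "r m0 \<omega> \<le> ereal t" using time_grid_mono[OF tg, of m0 m] m(1) by (metis order_trans)
      have dead: "\<not> alive i \<omega>" if "m0 \<le> i" for i
        using m0 that unfolding alive_def by (meson order_trans)
      let ?p = "real_of_ereal (r m0 \<omega>)"
      have Zt: "Z t \<omega> = Z ?p \<omega>"
        unfolding Z_def capital_def
        by (simp, rule gint_frozen[OF tg r0 less_imp_le[OF m(2)]]) (simp add: gain_def h'_def dead)
      show ?thesis
      \<comment> \<open>If trading stops at index 0, the capital stays at \<open>a\<close>.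
        Otherwise cell \<open>m0 - 1\<close> was still alive, and nonnegativity holds up to and
        including its right end, where the capital is frozen.\<close>
      proof (cases m0)
        case 0
        then have "Z ?p \<omega> = a" by (simp add: Z_def capital_def time_grid_zero[OF tg] gint_0[OF tg])
        with a Zt show ?thesis by simp
      next
        case (Suc m1)
        have "alive m1 \<omega>" using not_less_Least[of m1 "\<lambda>i. \<not> alive i \<omega>"] Suc unfolding m0_def by simp
        moreover have "ereal ?p = r m0 \<omega>" by (rule real_of_finite_time[OF time_grid_nonneg[OF tg] r0])
        ultimately have "0 \<le> Z ?p \<omega>"
          using time_grid_mono[OF tg, of m1 m0] Suc by (intro Z_alive_nonneg[OF \<omega>, of m1]) auto
        with Zt show ?thesis by simp
      qed
    qed
    assume ge: "\<And>s. 0 \<le> s \<Longrightarrow> s \<le> t \<Longrightarrow> \<epsilon> \<le> capital Js a \<tau> h s \<omega>"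
    have "alive m \<omega>"
      unfolding alive_def
    proof (intro allI impI)
      fix i assume "i \<le> m"
      then have "r i \<omega> \<le> ereal t" using time_grid_mono[OF tg, of i m] m(1) by (metis order_trans)
      then have "0 \<le> real_of_ereal (r i \<omega>)" "real_of_ereal (r i \<omega>) \<le> t"
        using time_grid_nonneg[OF tg, of i] by (cases "r i \<omega>"; simp)+
      then show "\<epsilon> \<le> K (real_of_ereal (r i \<omega>)) \<omega>" unfolding K_def by (rule ge)
    qed
    then show "Z t \<omega> = capital Js a \<tau> h t \<omega>"
      using Z_alive[OF \<omega> _ t less_imp_le[OF m(2)]] by (simp add: K_def)
  qed
qed

section \<open>Superhedging integrals against continuous martingales\<close>

text \<open>The times \<sigma> may accumulate and \<open>g\<close> may be unbounded, neither of
  which a strategy allows, and stopping at a positive level needs one bound for all positions. So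
  everything is cut off at level \<open>N\<close>. At a fixed time and path the hypotheses of the
  last conclusion are met for all large \<open>N\<close>, provided some \<sigma>-time lies beyond
  \<open>t\<close>.\<close>

lemma strategy_truncated_integral:
  assumes s: "strategy J Js \<tau> h" and \<sigma>: "st_grid J \<sigma>"
    and g: "\<And>k. tau_measurable J (\<sigma> k) (g k)"
  obtains r hh B where "strategy J Js r hh" "0 \<le> B"
    "\<And>n \<omega> j. \<omega> \<in> Omega J \<Longrightarrow> j < Js \<Longrightarrow> \<bar>hh n \<omega> j\<bar> \<le> B"
    "\<And>t \<omega> M. 0 \<le> t \<Longrightarrow> \<omega> \<in> Omega J \<Longrightarrow> ereal t < \<sigma> M \<omega> \<Longrightarrow> M \<le> N \<Longrightarrow> ereal t < \<tau> N \<omega> \<Longrightarrow>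
       (\<forall>i<M. \<bar>g i \<omega>\<bar> \<le> real N) \<Longrightarrow>
       gint (\<lambda>k. r k \<omega>) (gain Js hh \<omega>) t = gint (\<lambda>k. \<sigma> k \<omega>) (\<lambda>k s. g k \<omega> * capital Js c \<tau> h s \<omega>) t"
proof -
  \<comment> \<open>After index \<open>N\<close> the time jumps to infinity, which makes the grid
    exhausting; \<open>g'\<close> vanishes from index \<open>N\<close> on, so that nothing is held
    in the long last cell.\<close>
  define \<sigma>' where "\<sigma>' k = (if k \<le> N then \<sigma> k else (\<lambda>_. \<infinity>))" for k
  define g' where "g' k \<omega> = (if k < N then max (- real N) (min (g k \<omega>) (real N)) else 0)" for k \<omega>
  define h' where "h' n \<omega> j = (if n < N then h n \<omega> j else 0)" for n \<omega> j
  note tg\<sigma> = st_gridD(2)[OF \<sigma>]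
  have tg': "time_grid (\<lambda>k. \<sigma>' k \<omega>)" if "\<omega> \<in> Omega J" for \<omega>
    using time_grid_mono[OF tg\<sigma>[OF that]] time_grid_zero[OF tg\<sigma>[OF that]]
    unfolding time_grid_def by (auto intro!: incseq_SucI simp: \<sigma>'_def)
  have \<sigma>': "st_grid J \<sigma>'"
    unfolding st_grid_def using tg' st_gridD(1)[OF \<sigma>] by (simp add: \<sigma>'_def stopping_time_const)
  have e\<sigma>': "exhausting J \<sigma>'"
    unfolding exhausting_def by (auto intro!: exI[of _ "Suc N"] simp: \<sigma>'_def)
  note \<tau> = strategyD[OF s]
  define r where "r = mergeg \<sigma>' \<tau>"
  have r: "st_grid J r" "exhausting J r"
    unfolding r_def by (rule st_grid_merge[OF \<sigma>' \<tau>(1)], rule exhausting_merge[OF \<sigma>' \<tau>(1) e\<sigma>' \<tau>(2)])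
  let ?i = "\<lambda>\<omega> m. last_index (\<lambda>k. \<sigma>' k \<omega>) (\<lambda>k. r k \<omega>) m"
  let ?n = "\<lambda>\<omega> m. last_index (\<lambda>k. \<tau> k \<omega>) (\<lambda>k. r k \<omega>) m"
  \<comment> \<open>Holding \<open>g\<close> units of the capital process means holding
    \<open>g\<close> times its own positions in the securities, cell by cell of the common
    refinement.\<close>
  define hh where "hh m \<omega> j = g' (?i \<omega> m) \<omega> * h' (?n \<omega> m) \<omega> j" for m \<omega> j
  obtain B where B: "0 \<le> B" "\<And>n \<omega> j. n \<le> N \<Longrightarrow> \<omega> \<in> Omega J \<Longrightarrow> j < Js \<Longrightarrow> \<bar>h n \<omega> j\<bar> \<le> B"
    using strategy_bound_upto[OF s] by blast
  have h'B: "\<bar>h' n \<omega> j\<bar> \<le> B" if "\<omega> \<in> Omega J" "j < Js" for n \<omega> j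
    using B(1) B(2)[of n, OF _ that] by (simp add: h'_def)
  have g'N: "\<bar>g' k \<omega>\<bar> \<le> real N" for k \<omega> by (auto simp: g'_def)
  have hhB: "\<bar>hh n \<omega> j\<bar> \<le> real N * B" if "\<omega> \<in> Omega J" "j < Js" for n \<omega> j
    unfolding hh_def abs_mult using g'N h'B[OF that] by (intro mult_mono) auto
  have g'_meas: "tau_measurable J (\<sigma>' k) (g' k)" for k
    using tau_measurable_comp[where F = "\<lambda>x. max (- real N) (min x (real N))", OF g[of k]]
    by (cases "k < N") (auto simp: g'_def[abs_def] \<sigma>'_def tau_measurable_const)
  have h'_meas: "tau_measurable J (\<tau> n) (\<lambda>\<omega>. h' n \<omega> j)" if "j < Js" for n j
    using \<tau>(3)[OF that, of n] by (cases "n < N") (auto simp: h'_def tau_measurable_const)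
  have "strategy J Js r hh"
    unfolding strategy_def
  proof (intro conjI allI impI r)
    fix m j assume j: "j < Js"
    show "tau_measurable J (r m) (\<lambda>\<omega>. hh m \<omega> j)"
      unfolding hh_def
      by (rule tau_measurable_comp2[where F = "(*)",
            OF tau_measurable_last_index[of J \<sigma>' r g', OF \<sigma>' r(1) g'_meas]
               tau_measurable_last_index[of J \<tau> r "\<lambda>n \<omega>. h' n \<omega> j", OF \<tau>(1) r(1) h'_meas[OF j]]])
  next
    fix m show "\<exists>C. \<forall>\<omega>\<in>Omega J. \<forall>j<Js. \<bar>hh m \<omega> j\<bar> \<le> C" using hhB by blast
  qed
  moreover have "gint (\<lambda>k. r k \<omega>) (gain Js hh \<omega>) t =
      gint (\<lambda>k. \<sigma> k \<omega>) (\<lambda>k s. g k \<omega> * capital Js c \<tau> h s \<omega>) t"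
    if t: "0 \<le> t" and \<omega>: "\<omega> \<in> Omega J" and M: "ereal t < \<sigma> M \<omega>" "M \<le> N" and N: "ereal t < \<tau> N \<omega>"
      and gN: "\<forall>i<M. \<bar>g i \<omega>\<bar> \<le> real N" for t \<omega> M
  proof -
    let ?u = "\<lambda>k s. g k \<omega> * capital Js c \<tau> h s \<omega>"
    let ?F = "gint (\<lambda>k. \<sigma> k \<omega>) ?u"
    note tg = st_gridD(2)[OF r(1) \<omega>]
    obtain R where R: "ereal t < r R \<omega>" using r(2) \<omega> unfolding exhausting_def by blast
    have "gint (\<lambda>k. r k \<omega>) (gain Js hh \<omega>) t = ?F t - ?F 0"
    proof (rule gint_unique[OF tg t less_imp_le[OF R]])
      fix m s assume s: "0 \<le> s" "s \<le> t" "r m \<omega> \<le> ereal s" "ereal s \<le> r (Suc m) \<omega>"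
      let ?p = "real_of_ereal (r m \<omega>)"
      have p: "ereal ?p = r m \<omega>" by (rule real_of_finite_time[OF time_grid_nonneg[OF tg] s(3)])
      have ps: "?p \<le> s" using p s(3) by (metis ereal_less_eq(3))
      note mi = merge_interval[OF tg'[OF \<omega>] \<tau>(5)[OF \<omega>], of m, folded r_def]
      note mn = merge_interval2[OF tg'[OF \<omega>] \<tau>(5)[OF \<omega>], of m, folded r_def]
      have mi': "\<sigma>' (?i \<omega> m) \<omega> \<le> r m \<omega>" "r (Suc m) \<omega> \<le> \<sigma>' (Suc (?i \<omega> m)) \<omega>"
        using mi(1,2) by (simp_all add: r_def)
      have mn': "\<tau> (?n \<omega> m) \<omega> \<le> r m \<omega>" "r (Suc m) \<omega> \<le> \<tau> (Suc (?n \<omega> m)) \<omega>"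
        using mn(1,2) by (simp_all add: r_def)
      have st: "ereal s \<le> ereal t" using s(2) by simp
      \<comment> \<open>A merged cell that starts no later than \<open>t\<close> lies in a
        \<sigma>-cell of index below \<open>M\<close> and a \<tau>-cell of index below
        \<open>N\<close>, where no truncation is in force.\<close>
      have iM: "?i \<omega> m < M"
      proof (rule ccontr)
        assume "\<not> ?i \<omega> m < M"
        then have "\<sigma>' M \<omega> \<le> \<sigma>' (?i \<omega> m) \<omega>" by (intro time_grid_mono[OF tg'[OF \<omega>]]) simp
        also have "\<dots> \<le> ereal t" using mi'(1) s(3) st by (meson order_trans)
        finally show False using M by (simp add: \<sigma>'_def)
      qed
      have nN: "?n \<omega> m < N"
      proof (rule ccontr)
        assume "\<not> ?n \<omega> m < N"
        then have "\<tau> N \<omega> \<le> \<tau> (?n \<omega> m) \<omega>" by (intro time_grid_mono[OF \<tau>(5)[OF \<omega>]]) simp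
        also have "\<dots> \<le> ereal t" using mn'(1) s(3) st by (meson order_trans)
        finally show False using N by simp
      qed
      have F: "?F s - ?F ?p = ?u (?i \<omega> m) s - ?u (?i \<omega> m) ?p"
      proof (rule gint_step2[OF tg\<sigma>[OF \<omega>]])
        show "\<sigma> (?i \<omega> m) \<omega> \<le> ereal ?p" using mi'(1) iM M(2) p by (simp add: \<sigma>'_def)
        have "\<sigma>' (Suc (?i \<omega> m)) \<omega> = \<sigma> (Suc (?i \<omega> m)) \<omega>" using iM M(2) by (simp add: \<sigma>'_def)
        then show "ereal s \<le> \<sigma> (Suc (?i \<omega> m)) \<omega>" using mi'(2) s(4) by (metis order_trans)
      qed (rule ps)
      have X: "capital Js c \<tau> h s \<omega> - capital Js c \<tau> h ?p \<omega> = gain Js h \<omega> (?n \<omega> m) s - gain Js h \<omega> (?n \<omega> m) ?p"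
        unfolding capital_def
        using gint_step2[OF \<tau>(5)[OF \<omega>], of "?n \<omega> m" ?p s "gain Js h \<omega>"] mn' p ps s(4)
        by (simp add: order_trans[OF s(4) mn'(2)])
      have "gain Js hh \<omega> m s - gain Js hh \<omega> m ?p =
          g (?i \<omega> m) \<omega> * (gain Js h \<omega> (?n \<omega> m) s - gain Js h \<omega> (?n \<omega> m) ?p)"
      proof -
        have "g' (?i \<omega> m) \<omega> = g (?i \<omega> m) \<omega>" using gN iM M(2) by (auto simp: g'_def)
        then show ?thesis
          using nN unfolding gain_diff by (simp add: hh_def h'_def sum_distrib_left mult.assoc)
      qed
      then show "?F s - ?F ?p = gain Js hh \<omega> m s - gain Js hh \<omega> m ?p"
        unfolding F X[symmetric] by (simp add: right_diff_distrib)
    qed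
    then show ?thesis by (simp add: gint_0[OF tg\<sigma>[OF \<omega>]])
  qed
  ultimately show thesis using that[of r hh "real N * B"] hhB B(1) by (simp add: mult_nonneg_nonneg)
qed

lemma NSM_capital:
  assumes "strategy J Js \<tau> h" "\<And>t \<omega>. 0 \<le> t \<Longrightarrow> \<omega> \<in> Omega J \<Longrightarrow> 0 \<le> capital Js c \<tau> h t \<omega>"
  shows "(\<lambda>t \<omega>. ereal (capital Js c \<tau> h t \<omega>)) \<in> NSM J Js"
  by (rule NSM.base) (use simple_capital_capital[OF assms(1)] assms(2) in auto)

text \<open>\<open>Z\<close> dominates \<open>a + \<integral> g dX\<close> as long as the latter stays away from 0. Neither \<open>X\<close> nor the
  integral is stopped, which is what makes this property stable under limits of \<open>X\<close>.\<close>

definition hedges :: "nat \<Rightarrow> nat \<Rightarrow> (real \<Rightarrow> path \<Rightarrow> real option) \<Rightarrow> (nat \<Rightarrow> path \<Rightarrow> ereal) \<Rightarrow>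
    (nat \<Rightarrow> path \<Rightarrow> real) \<Rightarrow> real \<Rightarrow> (real \<Rightarrow> path \<Rightarrow> ereal) \<Rightarrow> bool" where
  "hedges J Js X \<sigma> g a Z \<longleftrightarrow> Z \<in> NSM J Js \<and> (\<forall>\<omega>\<in>Omega J. Z 0 \<omega> = ereal a) \<and>
     (\<forall>t \<omega> \<epsilon> M. 0 \<le> t \<longrightarrow> \<omega> \<in> Omega J \<longrightarrow> 0 < \<epsilon> \<longrightarrow> X t \<omega> \<noteq> None \<longrightarrow> ereal t < \<sigma> M \<omega> \<longrightarrow>
       (\<forall>s. 0 \<le> s \<longrightarrow> s \<le> t \<longrightarrow>
          \<epsilon> \<le> a + gint (\<lambda>k. \<sigma> k \<omega>) (\<lambda>k u. g k \<omega> * the (X u \<omega>)) s) \<longrightarrow>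
       ereal (a + gint (\<lambda>k. \<sigma> k \<omega>) (\<lambda>k u. g k \<omega> * the (X u \<omega>)) t) \<le> Z t \<omega>)"

lemma gint_cong:
  assumes "time_grid r" "0 \<le> t" "\<And>n s. 0 \<le> s \<Longrightarrow> s \<le> t \<Longrightarrow> u n s = v n s"
  shows "gint r u t = gint r v t"
  unfolding gint_def
  using stop_at_bounds[OF time_grid_nonneg[OF assms(1)] assms(2)] assms(3) by simp

text \<open>For each \<open>N\<close> the integral truncated at \<open>N\<close> is stopped below
  the level 1/(N+1), which gives a nonnegative capital process. Where the untruncated integral has
  stayed above some \<epsilon> up to \<open>t\<close>, all but finitely many of these processes
  equal it at \<open>t\<close>, and so their liminf dominates it.\<close>

lemma hedges_simple_capital:
  assumes K: "simple_capital J Js K" and Js: "Js \<le> J" and \<sigma>: "st_grid J \<sigma>"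
    and g: "\<And>k. tau_measurable J (\<sigma> k) (g k)" and a: "0 \<le> a"
  shows "\<exists>Z. hedges J Js (\<lambda>t \<omega>. Some (K t \<omega>)) \<sigma> g a Z"
proof -
  obtain c \<tau> h where s: "strategy J Js \<tau> h"
    and Kc: "\<And>t \<omega>. 0 \<le> t \<Longrightarrow> \<omega> \<in> Omega J \<Longrightarrow> K t \<omega> = capital Js c \<tau> h t \<omega>"
    by (rule simple_capital_strategy[OF K]) (rule that)
  let ?I = "\<lambda>t \<omega>. gint (\<lambda>k. \<sigma> k \<omega>) (\<lambda>k u. g k \<omega> * K u \<omega>) t"
  define good where "good N r h' \<longleftrightarrow> strategy J Js r h' \<and>
      (\<forall>t \<omega>. 0 \<le> t \<longrightarrow> \<omega> \<in> Omega J \<longrightarrow> 0 \<le> capital Js a r h' t \<omega>) \<and>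
      (\<forall>t \<omega> M. 0 \<le> t \<longrightarrow> \<omega> \<in> Omega J \<longrightarrow> ereal t < \<sigma> M \<omega> \<longrightarrow> M \<le> N \<longrightarrow> ereal t < \<tau> N \<omega> \<longrightarrow>
        (\<forall>i<M. \<bar>g i \<omega>\<bar> \<le> real N) \<longrightarrow> (\<forall>s. 0 \<le> s \<longrightarrow> s \<le> t \<longrightarrow> 1 / real (Suc N) \<le> a + ?I s \<omega>) \<longrightarrow>
        capital Js a r h' t \<omega> = a + ?I t \<omega>)" for N r h'
  have "\<exists>r h'. good N r h'" for N
  proof -
    obtain r0 hh B where r0: "strategy J Js r0 hh" and B: "0 \<le> B"
      "\<And>n \<omega> j. \<omega> \<in> Omega J \<Longrightarrow> j < Js \<Longrightarrow> \<bar>hh n \<omega> j\<bar> \<le> B"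
      and I: "\<And>t \<omega> M. 0 \<le> t \<Longrightarrow> \<omega> \<in> Omega J \<Longrightarrow> ereal t < \<sigma> M \<omega> \<Longrightarrow> M \<le> N \<Longrightarrow> ereal t < \<tau> N \<omega> \<Longrightarrow>
       (\<forall>i<M. \<bar>g i \<omega>\<bar> \<le> real N) \<Longrightarrow>
       gint (\<lambda>k. r0 k \<omega>) (gain Js hh \<omega>) t = gint (\<lambda>k. \<sigma> k \<omega>) (\<lambda>k s. g k \<omega> * capital Js c \<tau> h s \<omega>) t"
      apply (rule strategy_truncated_integral[where N = N and c = c, OF s \<sigma> g])
      subgoal for r0 hh B by (rule that[of r0 hh B]) simp_all
      done
    obtain r h' where r: "strategy J Js r h'"
      "\<And>t \<omega>. 0 \<le> t \<Longrightarrow> \<omega> \<in> Omega J \<Longrightarrow> 0 \<le> capital Js a r h' t \<omega>"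
      "\<And>t \<omega>. 0 \<le> t \<Longrightarrow> \<omega> \<in> Omega J \<Longrightarrow> (\<And>s. 0 \<le> s \<Longrightarrow> s \<le> t \<Longrightarrow> 1 / real (Suc N) \<le> capital Js a r0 hh s \<omega>) \<Longrightarrow>
         capital Js a r h' t \<omega> = capital Js a r0 hh t \<omega>"
      by (rule strategy_stopped_nonneg[OF r0 Js a, of "1 / real (Suc N)" B]) (use B in auto)
    have "capital Js a r h' t \<omega> = a + ?I t \<omega>"
      if t: "0 \<le> t" and \<omega>: "\<omega> \<in> Omega J" and M: "ereal t < \<sigma> M \<omega>" "M \<le> N" and N: "ereal t < \<tau> N \<omega>"
        and gN: "\<forall>i<M. \<bar>g i \<omega>\<bar> \<le> real N"
        and pos: "\<And>s. 0 \<le> s \<Longrightarrow> s \<le> t \<Longrightarrow> 1 / real (Suc N) \<le> a + ?I s \<omega>" for t \<omega> M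
    proof -
      have eq: "capital Js a r0 hh s \<omega> = a + ?I s \<omega>" if "0 \<le> s" "s \<le> t" for s
      proof -
        have "ereal s \<le> ereal t" using that by simp
        then have "ereal s < \<sigma> M \<omega>" "ereal s < \<tau> N \<omega>" by (rule le_less_trans[OF _ M(1)], rule le_less_trans[OF _ N])
        then have "gint (\<lambda>k. r0 k \<omega>) (gain Js hh \<omega>) s = gint (\<lambda>k. \<sigma> k \<omega>) (\<lambda>k s. g k \<omega> * capital Js c \<tau> h s \<omega>) s"
          by (intro I[OF that(1) \<omega> _ M(2) _ gN])
        also have "\<dots> = ?I s \<omega>"
          by (rule gint_cong[OF st_gridD(2)[OF \<sigma> \<omega>] that(1)]) (simp add: Kc[OF _ \<omega>])
        finally show ?thesis by (simp add: capital_def)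
      qed
      show ?thesis using r(3)[OF t \<omega>] pos eq t by simp
    qed
    with r(1,2) show ?thesis unfolding good_def by blast
  qed
  then obtain r h' where good: "\<And>N. good N (r N) (h' N)" by metis
  have r: "\<And>N. strategy J Js (r N) (h' N)"
    "\<And>N t \<omega>. 0 \<le> t \<Longrightarrow> \<omega> \<in> Omega J \<Longrightarrow> 0 \<le> capital Js a (r N) (h' N) t \<omega>"
    "\<And>N t \<omega> M. 0 \<le> t \<Longrightarrow> \<omega> \<in> Omega J \<Longrightarrow> ereal t < \<sigma> M \<omega> \<Longrightarrow> M \<le> N \<Longrightarrow> ereal t < \<tau> N \<omega> \<Longrightarrow>
        (\<forall>i<M. \<bar>g i \<omega>\<bar> \<le> real N) \<Longrightarrow> (\<forall>s. 0 \<le> s \<longrightarrow> s \<le> t \<longrightarrow> 1 / real (Suc N) \<le> a + ?I s \<omega>) \<Longrightarrow>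
        capital Js a (r N) (h' N) t \<omega> = a + ?I t \<omega>"
    using good unfolding good_def by blast+
  let ?Z = "\<lambda>t \<omega>. liminf (\<lambda>N. ereal (capital Js a (r N) (h' N) t \<omega>))"
  have "hedges J Js (\<lambda>t \<omega>. Some (K t \<omega>)) \<sigma> g a ?Z"
    unfolding hedges_def option.sel
  proof (intro conjI allI ballI impI)
    show "?Z \<in> NSM J Js" by (rule NSM.liminf) (rule NSM_capital[OF r(1,2)])
    show "?Z 0 \<omega> = ereal a" if "\<omega> \<in> Omega J" for \<omega>
      by (simp add: capital_def gint_0[OF strategyD(5)[OF r(1) that]] Liminf_const)
    fix t \<omega> \<epsilon> M
    assume t: "0 \<le> (t::real)" and \<omega>: "\<omega> \<in> Omega J" and \<epsilon>: "0 < (\<epsilon>::real)" and M: "ereal t < \<sigma> M \<omega>"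
      and pos: "\<forall>s. 0 \<le> s \<longrightarrow> s \<le> t \<longrightarrow> \<epsilon> \<le> a + ?I s \<omega>"
    obtain k where k: "ereal t < \<tau> k \<omega>" using strategyD(6)[OF s \<omega>] by blast
    obtain n1 where n1: "(\<Sum>i<M. \<bar>g i \<omega>\<bar>) \<le> real n1" using real_arch_simple by blast
    obtain n2 where n2: "1 / real (Suc n2) < \<epsilon>" using nat_approx_posE[OF \<epsilon>] by blast
    have "ereal (a + ?I t \<omega>) \<le> ereal (capital Js a (r N) (h' N) t \<omega>)" if N: "M + k + n1 + n2 \<le> N" for N
    proof -
      have "ereal t < \<tau> N \<omega>"
        using k time_grid_mono[OF strategyD(5)[OF s \<omega>], of k N] N by (auto intro: less_le_trans)
      moreover have "\<bar>g i \<omega>\<bar> \<le> real N" if "i < M" for i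
      proof -
        have "\<bar>g i \<omega>\<bar> \<le> (\<Sum>i<M. \<bar>g i \<omega>\<bar>)" using that by (intro member_le_sum) auto
        then show ?thesis using n1 N by linarith
      qed
      moreover have "1 / real (Suc N) \<le> \<epsilon>"
      proof -
        have "1 / real (Suc N) \<le> 1 / real (Suc n2)" using N by (intro divide_left_mono) auto
        then show ?thesis using n2 by linarith
      qed
      ultimately have "capital Js a (r N) (h' N) t \<omega> = a + ?I t \<omega>"
        using N pos by (intro r(3)[OF t \<omega> M]) (auto intro: order_trans)
      then show ?thesis by simp
    qed
    then show "ereal (a + ?I t \<omega>) \<le> ?Z t \<omega>"
      by (intro Liminf_bounded) (auto simp: eventually_sequentially)
  qed
  then show ?thesis by blast
qed

lemma cont_processD:
  assumes "cont_process J Js X"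
  shows "adapted J X" "qa J Js (\<lambda>t \<omega>. X t \<omega> \<noteq> None)"
    "\<And>\<omega> s t. \<omega> \<in> Omega J \<Longrightarrow> 0 \<le> s \<Longrightarrow> s \<le> t \<Longrightarrow> X t \<omega> \<noteq> None \<Longrightarrow> X s \<omega> \<noteq> None"
proof -
  show "adapted J X" "qa J Js (\<lambda>t \<omega>. X t \<omega> \<noteq> None)"
    using assms unfolding cont_process_def adapted_def by blast+
  fix \<omega> s t assume \<omega>: "\<omega> \<in> Omega J" and s: "0 \<le> s" "s \<le> t" and X: "X t \<omega> \<noteq> None"
  let ?D = "{t. 0 \<le> t \<and> X t \<omega> \<noteq> None}"
  have "connected ?D" "0 \<in> ?D" using assms \<omega> unfolding cont_process_def by blast+
  moreover have "t \<in> ?D" using s X by auto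
  ultimately have "{0..t} \<subseteq> ?D" by (intro connected_contains_Icc)
  then show "X s \<omega> \<noteq> None" using s by auto
qed

lemma gint_diff_bound:
  assumes r: "time_grid r" and s: "0 \<le> s" "s \<le> t" "ereal t \<le> r M"
    and d: "\<And>u. 0 \<le> u \<Longrightarrow> u \<le> t \<Longrightarrow> \<bar>x u - y u\<bar> \<le> d"
  shows "\<bar>gint r (\<lambda>k u. g k * x u) s - gint r (\<lambda>k u. g k * y u) s\<bar> \<le> (\<Sum>i<M. \<bar>g i\<bar>) * (2 * d)"
proof -
  have sM: "ereal s \<le> r M" using s(2,3) by (metis ereal_less_eq(3) order_trans)
  let ?e = "\<lambda>u. x u - y u"
  have "gint r (\<lambda>k u. g k * x u) s - gint r (\<lambda>k u. g k * y u) s =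
      (\<Sum>i<M. g i * (?e (stop_at (r (Suc i)) s) - ?e (stop_at (r i) s)))"
    unfolding gint_eq_sum[OF r sM] sum_subtractf[symmetric] by (simp add: algebra_simps)
  also have "\<bar>\<dots>\<bar> \<le> (\<Sum>i<M. \<bar>g i\<bar> * (2 * d))"
  proof (rule order_trans[OF sum_abs sum_mono])
    fix i
    have "\<bar>?e (stop_at (r k) s)\<bar> \<le> d" for k
      using stop_at_bounds[OF time_grid_nonneg[OF r] s(1), of k] s(2) by (intro d) auto
    from this[of i] this[of "Suc i"]
    have "\<bar>?e (stop_at (r (Suc i)) s) - ?e (stop_at (r i) s)\<bar> \<le> 2 * d" by linarith
    then show "\<bar>g i * (?e (stop_at (r (Suc i)) s) - ?e (stop_at (r i) s))\<bar> \<le> \<bar>g i\<bar> * (2 * d)"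
      unfolding abs_mult by (rule mult_left_mono) simp
  qed
  finally show ?thesis by (simp add: sum_distrib_right)
qed

text \<open>Only \<open>M\<close> cells start before \<open>t\<close>, so uniform closeness of the
  processes on \<open>{0..t}\<close> makes the integrals uniformly close. If the limit integral
  stays above \<epsilon>, late approximants stay above \<epsilon>/2; this loss is harmless because
  \<open>hedges\<close> quantifies over all positive \<epsilon>.\<close>

lemma hedges_limit:
  assumes Z: "\<And>k. hedges J Js (Xk k) \<sigma> g a (Z k)" and \<sigma>: "st_grid J \<sigma>"
    and dom: "\<And>\<omega> k t. \<omega> \<in> Omega J \<Longrightarrow> 0 \<le> t \<Longrightarrow> X t \<omega> \<noteq> None \<Longrightarrow> Xk k t \<omega> \<noteq> None"
    and conv: "\<And>\<omega> t. \<omega> \<in> Omega J \<Longrightarrow> 0 \<le> t \<Longrightarrow> X t \<omega> \<noteq> None \<Longrightarrow>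
        (\<lambda>k. SUP s\<in>{0..t}. ereal \<bar>the (Xk k s \<omega>) - the (X s \<omega>)\<bar>) \<longlonglongrightarrow> 0"
  shows "hedges J Js X \<sigma> g a (\<lambda>t \<omega>. liminf (\<lambda>k. Z k t \<omega>))"
  unfolding hedges_def
proof (intro conjI ballI allI impI)
  show "(\<lambda>t \<omega>. liminf (\<lambda>k. Z k t \<omega>)) \<in> NSM J Js"
    by (rule NSM.liminf) (use Z in \<open>simp add: hedges_def\<close>)
  show "liminf (\<lambda>k. Z k 0 \<omega>) = ereal a" if "\<omega> \<in> Omega J" for \<omega>
    using Z that by (simp add: hedges_def Liminf_const)
  fix t \<omega> \<epsilon> M
  let ?I = "\<lambda>x s. gint (\<lambda>k. \<sigma> k \<omega>) (\<lambda>k u. g k \<omega> * the (x u \<omega>)) s"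
  assume t: "0 \<le> (t::real)" and \<omega>: "\<omega> \<in> Omega J" and \<epsilon>: "0 < (\<epsilon>::real)" and X: "X t \<omega> \<noteq> None"
    and M: "ereal t < \<sigma> M \<omega>" and pos: "\<forall>s. 0 \<le> s \<longrightarrow> s \<le> t \<longrightarrow> \<epsilon> \<le> a + ?I X s"
  note tg = st_gridD(2)[OF \<sigma> \<omega>]
  define C where "C = (\<Sum>i<M. \<bar>g i \<omega>\<bar>)"
  have C: "0 \<le> C" by (simp add: C_def sum_nonneg)
  have close: "\<forall>\<^sub>F k in sequentially. \<forall>s. 0 \<le> s \<longrightarrow> s \<le> t \<longrightarrow> \<bar>?I (Xk k) s - ?I X s\<bar> < \<eta>"
    if \<eta>: "0 < \<eta>" for \<eta> :: real
  proof -
    define d where "d = \<eta> / (2 * C + 1)"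
    have d: "0 < d" "C * (2 * d) < \<eta>"
      using C \<eta> by (auto simp: d_def field_simps)
    have "\<forall>\<^sub>F k in sequentially. (SUP s\<in>{0..t}. ereal \<bar>the (Xk k s \<omega>) - the (X s \<omega>)\<bar>) < ereal d"
      by (rule order_tendstoD(2)[OF conv[OF \<omega> t X]]) (use d in simp)
    then show ?thesis
    proof (rule eventually_mono, intro allI impI)
      fix k s assume sup: "(SUP s\<in>{0..t}. ereal \<bar>the (Xk k s \<omega>) - the (X s \<omega>)\<bar>) < ereal d"
        and s: "0 \<le> s" "s \<le> t"
      have "\<bar>the (Xk k u \<omega>) - the (X u \<omega>)\<bar> \<le> d" if "0 \<le> u" "u \<le> t" for u
      proof -
        have "ereal \<bar>the (Xk k u \<omega>) - the (X u \<omega>)\<bar> \<le> (SUP s\<in>{0..t}. ereal \<bar>the (Xk k s \<omega>) - the (X s \<omega>)\<bar>)"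
          using that by (intro SUP_upper) auto
        also note sup
        finally show ?thesis by simp
      qed
      then have "\<bar>?I (Xk k) s - ?I X s\<bar> \<le> C * (2 * d)"
        unfolding C_def by (intro gint_diff_bound[OF tg s less_imp_le[OF M]])
      then show "\<bar>?I (Xk k) s - ?I X s\<bar> < \<eta>" using d(2) by linarith
    qed
  qed
  have "(\<lambda>k. ?I (Xk k) t) \<longlonglongrightarrow> ?I X t"
  proof (rule tendstoI)
    fix e :: real assume "0 < e"
    from close[OF this] show "\<forall>\<^sub>F k in sequentially. dist (?I (Xk k) t) (?I X t) < e"
      by (rule eventually_mono) (use t in \<open>auto simp: dist_real_def\<close>)
  qed
  then have "(\<lambda>k. ereal (a + ?I (Xk k) t)) \<longlonglongrightarrow> ereal (a + ?I X t)"
    by (intro tendsto_intros)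
  then have "ereal (a + ?I X t) = liminf (\<lambda>k. ereal (a + ?I (Xk k) t))"
    by (intro lim_imp_Liminf[symmetric]) auto
  also have "\<dots> \<le> liminf (\<lambda>k. Z k t \<omega>)"
  proof (rule Liminf_mono)
    have "0 < \<epsilon> / 2" using \<epsilon> by simp
    from close[OF this] show "\<forall>\<^sub>F k in sequentially. ereal (a + ?I (Xk k) t) \<le> Z k t \<omega>"
    proof (rule eventually_mono)
      fix k assume *: "\<forall>s. 0 \<le> s \<longrightarrow> s \<le> t \<longrightarrow> \<bar>?I (Xk k) s - ?I X s\<bar> < \<epsilon> / 2"
      have "\<forall>s. 0 \<le> s \<longrightarrow> s \<le> t \<longrightarrow> \<epsilon> / 2 \<le> a + ?I (Xk k) s"
      proof (intro allI impI)
        fix s assume s: "0 \<le> s" "s \<le> t"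
        then have "\<bar>?I (Xk k) s - ?I X s\<bar> < \<epsilon> / 2" "\<epsilon> \<le> a + ?I X s" using * pos by blast+
        then show "\<epsilon> / 2 \<le> a + ?I (Xk k) s" unfolding abs_less_iff by linarith
      qed
      then show "ereal (a + ?I (Xk k) t) \<le> Z k t \<omega>"
        using Z[of k] t \<omega> \<open>0 < \<epsilon> / 2\<close> dom[OF \<omega> t X, of k] M unfolding hedges_def by blast
    qed
  qed
  finally show "ereal (a + ?I X t) \<le> liminf (\<lambda>k. Z k t \<omega>)" .
qed

lemma CM_hedges:
  assumes X: "X \<in> CM J Js" and Js: "Js \<le> J" and \<sigma>: "st_grid J \<sigma>"
    and g: "\<And>k. tau_measurable J (\<sigma> k) (g k)" and a: "0 \<le> a"
  shows "\<exists>Z. hedges J Js X \<sigma> g a Z"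
  using X
proof (induction rule: CM.induct)
  case (base K)
  then show ?case by (rule hedges_simple_capital[OF _ Js \<sigma> g a])
next
  case (limit X Xk)
  obtain Z where "\<And>k. hedges J Js (Xk k) \<sigma> g a (Z k)" using limit.IH by metis
  then have "hedges J Js X \<sigma> g a (\<lambda>t \<omega>. liminf (\<lambda>k. Z k t \<omega>))"
    by (rule hedges_limit[where Xk = Xk and Z = Z, OF _ \<sigma>]) (use limit.hyps in blast)+
  then show ?case by blast
qed

section \<open>Closure of nonnegative supermartingales and of quasi-always statements\<close>

lemma NSM_nonneg:
  assumes "Z \<in> NSM J Js" "0 \<le> t" "\<omega> \<in> Omega J"
  shows "0 \<le> Z t \<omega>"
  using assms by induction (auto intro: Liminf_bounded)

lemma trivial_strategy: "strategy J Js (\<lambda>k _. ereal (real k)) (\<lambda>_ _ _. 0)"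
  unfolding strategy_def
proof (intro conjI allI impI)
  show "st_grid J (\<lambda>k _. ereal (real k))"
    by (auto simp: st_grid_def time_grid_def stopping_time_const intro!: incseq_SucI)
  show "exhausting J (\<lambda>k _. ereal (real k))"
    using reals_Archimedean2 by (auto simp: exhausting_def)
qed (auto simp: tau_measurable_const)

lemma NSM_const:
  assumes "0 \<le> c"
  obtains Z where "Z \<in> NSM J Js" "\<And>t \<omega>. 0 \<le> t \<Longrightarrow> \<omega> \<in> Omega J \<Longrightarrow> Z t \<omega> = ereal c"
proof -
  have "capital Js c (\<lambda>k _. ereal (real k)) (\<lambda>_ _ _. 0) t \<omega> = c" for t \<omega>
    by (simp add: capital_def gint_def gain_def)
  with NSM_capital[OF trivial_strategy, of J Js c] assms that show thesis by simp
qed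

text \<open>A liminf does not distribute over a sum of two sequences, but it does when one summand
  is fixed. Hence two nested inductions: on \<open>X\<close>, and in its base case on
  \<open>Y\<close>. If the fixed \<open>Y t \<omega>\<close> is infinite, both sides are.\<close>

lemma NSM_add:
  assumes X: "X \<in> NSM J Js" and Y: "Y \<in> NSM J Js"
  shows "\<exists>Z\<in>NSM J Js. \<forall>t\<ge>0. \<forall>\<omega>\<in>Omega J. Z t \<omega> = X t \<omega> + Y t \<omega>"
  using X
proof induction
  case (base K)
  note K = base
  from Y show ?case
  proof induction
    case (base L)
    obtain c1 \<tau>1 h1 where 1: "strategy J Js \<tau>1 h1"
      "\<And>t \<omega>. 0 \<le> t \<Longrightarrow> \<omega> \<in> Omega J \<Longrightarrow> K t \<omega> = capital Js c1 \<tau>1 h1 t \<omega>"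
      by (rule simple_capital_strategy[OF K(1)]) (rule that)
    obtain c2 \<tau>2 h2 where 2: "strategy J Js \<tau>2 h2"
      "\<And>t \<omega>. 0 \<le> t \<Longrightarrow> \<omega> \<in> Omega J \<Longrightarrow> L t \<omega> = capital Js c2 \<tau>2 h2 t \<omega>"
      by (rule simple_capital_strategy[OF base(1)]) (rule that)
    obtain \<tau> h where s: "strategy J Js \<tau> h" "\<And>t \<omega>. 0 \<le> t \<Longrightarrow> \<omega> \<in> Omega J \<Longrightarrow>
       capital Js (c1 + c2) \<tau> h t \<omega> = capital Js c1 \<tau>1 h1 t \<omega> + capital Js c2 \<tau>2 h2 t \<omega>"
      by (rule strategy_add[OF 1(1) 2(1)]) (rule that)
    have eq: "capital Js (c1 + c2) \<tau> h t \<omega> = K t \<omega> + L t \<omega>" if "0 \<le> t" "\<omega> \<in> Omega J" for t \<omega>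
      using s(2)[OF that] 1(2)[OF that] 2(2)[OF that] by simp
    have "(\<lambda>t \<omega>. ereal (capital Js (c1 + c2) \<tau> h t \<omega>)) \<in> NSM J Js"
      using K(2) base(2) by (intro NSM_capital[OF s(1)]) (simp add: eq)
    then show ?case by (rule bexI[rotated]) (simp add: eq)
  next
    case (liminf Y)
    from liminf.IH obtain Z where Z: "\<And>k. Z k \<in> NSM J Js"
      "\<And>k t \<omega>. 0 \<le> t \<Longrightarrow> \<omega> \<in> Omega J \<Longrightarrow> Z k t \<omega> = ereal (K t \<omega>) + Y k t \<omega>"
      by metis
    show ?case
      by (rule bexI[OF _ NSM.liminf[of Z, OF Z(1)]]) (simp add: Z(2) Liminf_add_ereal_left)
  qed
next
  case (liminf X)
  from liminf.IH obtain Z where Z: "\<And>k. Z k \<in> NSM J Js"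
    "\<And>k t \<omega>. 0 \<le> t \<Longrightarrow> \<omega> \<in> Omega J \<Longrightarrow> Z k t \<omega> = X k t \<omega> + Y t \<omega>"
    by metis
  have "liminf (\<lambda>k. X k t \<omega> + Y t \<omega>) = liminf (\<lambda>k. X k t \<omega>) + Y t \<omega>" if "0 \<le> t" "\<omega> \<in> Omega J" for t \<omega>
  proof (cases "Y t \<omega> = \<infinity>")
    case True
    then show ?thesis by (simp add: Liminf_const)
  next
    case False
    then show ?thesis using NSM_nonneg[OF Y that] by (intro Liminf_add_ereal_right) auto
  qed
  then show ?case
    by (intro bexI[OF _ NSM.liminf[of Z, OF Z(1)]]) (simp add: Z(2))
qed

lemma NSM_scale:
  assumes X: "X \<in> NSM J Js" and b: "0 \<le> (b::real)"
  shows "\<exists>Z\<in>NSM J Js. \<forall>t\<ge>0. \<forall>\<omega>\<in>Omega J. Z t \<omega> = ereal b * X t \<omega>"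
  using X
proof induction
  case (base K)
  obtain c \<tau> h where s: "strategy J Js \<tau> h"
    "\<And>t \<omega>. 0 \<le> t \<Longrightarrow> \<omega> \<in> Omega J \<Longrightarrow> K t \<omega> = capital Js c \<tau> h t \<omega>"
    by (rule simple_capital_strategy[OF base(1)]) (rule that)
  have eq: "capital Js (b * c) \<tau> (\<lambda>n \<omega> j. b * h n \<omega> j) t \<omega> = b * K t \<omega>"
    if "0 \<le> t" "\<omega> \<in> Omega J" for t \<omega>
    using strategy_scale(2)[OF s(1) that] s(2)[OF that] by simp
  have "(\<lambda>t \<omega>. ereal (capital Js (b * c) \<tau> (\<lambda>n \<omega> j. b * h n \<omega> j) t \<omega>)) \<in> NSM J Js"
    using base(2) b by (intro NSM_capital strategy_scale(1)[OF s(1)]) (simp add: eq)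
  then show ?case by (rule bexI[rotated]) (simp add: eq)
next
  case (liminf X)
  from liminf.IH obtain Z where Z: "\<And>k. Z k \<in> NSM J Js"
    "\<And>k t \<omega>. 0 \<le> t \<Longrightarrow> \<omega> \<in> Omega J \<Longrightarrow> Z k t \<omega> = ereal b * X k t \<omega>"
    by metis
  show ?case
    by (rule bexI[OF _ NSM.liminf[of Z, OF Z(1)]]) (simp add: Z(2) Liminf_ereal_mult_left[OF _ b])
qed

lemma NSM_suminf:
  fixes X :: "nat \<Rightarrow> real \<Rightarrow> path \<Rightarrow> ereal"
  assumes X: "\<And>n. X n \<in> NSM J Js"
  shows "\<exists>Z\<in>NSM J Js. \<forall>t\<ge>0. \<forall>\<omega>\<in>Omega J. Z t \<omega> = (\<Sum>n. X n t \<omega>)"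
proof -
  have "\<exists>Z\<in>NSM J Js. \<forall>t\<ge>0. \<forall>\<omega>\<in>Omega J. Z t \<omega> = (\<Sum>n<N. X n t \<omega>)" for N
  proof (induction N)
    case 0
    obtain Z where "Z \<in> NSM J Js" "\<And>t \<omega>. 0 \<le> t \<Longrightarrow> \<omega> \<in> Omega J \<Longrightarrow> Z t \<omega> = ereal 0"
      by (rule NSM_const[of 0]) auto
    then show ?case by (intro bexI[of _ Z]) (simp_all add: zero_ereal_def)
  next
    case (Suc N)
    then obtain Z where Z: "Z \<in> NSM J Js" "\<forall>t\<ge>0. \<forall>\<omega>\<in>Omega J. Z t \<omega> = (\<Sum>n<N. X n t \<omega>)" by blast
    from NSM_add[OF Z(1) X[of N]] Z(2) show ?case by simp
  qed
  then obtain Z where Z: "\<And>N. Z N \<in> NSM J Js"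
    "\<And>N t \<omega>. 0 \<le> t \<Longrightarrow> \<omega> \<in> Omega J \<Longrightarrow> Z N t \<omega> = (\<Sum>n<N. X n t \<omega>)" by metis
  have "liminf (\<lambda>N. \<Sum>n<N. X n t \<omega>) = (\<Sum>n. X n t \<omega>)" if "0 \<le> t" "\<omega> \<in> Omega J" for t \<omega>
    using NSM_nonneg[OF X that]
    by (intro lim_imp_Liminf summable_LIMSEQ summable_ereal_pos) auto
  then show ?thesis
    by (intro bexI[OF _ NSM.liminf[of Z, OF Z(1)]]) (simp add: Z(2))
qed

lemma qa_mono:
  assumes "qa J Js P" "\<And>t \<omega>. 0 \<le> t \<Longrightarrow> \<omega> \<in> Omega J \<Longrightarrow> P t \<omega> \<Longrightarrow> Q t \<omega>"
  shows "qa J Js Q"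
  using assms unfolding qa_def by meson

text \<open>The witnesses are added with weights 1/2, 1/4, ..., which sum to 1 and so keep the
  initial value 1. One infinite summand makes the sum infinite, all summands being
  nonnegative.\<close>

lemma qa_countable:
  fixes P :: "nat \<Rightarrow> real \<Rightarrow> path \<Rightarrow> bool"
  assumes "\<And>n. qa J Js (P n)"
  shows "qa J Js (\<lambda>t \<omega>. \<forall>n. P n t \<omega>)"
proof -
  obtain X where X: "\<And>n. X n \<in> NSM J Js" "\<And>n \<omega>. \<omega> \<in> Omega J \<Longrightarrow> X n 0 \<omega> = 1"
    "\<And>n t \<omega>. 0 \<le> t \<Longrightarrow> \<omega> \<in> Omega J \<Longrightarrow> \<not> P n t \<omega> \<Longrightarrow> X n t \<omega> = \<infinity>"
    using assms unfolding qa_def by metis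
  have "\<exists>Z\<in>NSM J Js. \<forall>t\<ge>0. \<forall>\<omega>\<in>Omega J. Z t \<omega> = ereal ((1/2)^Suc n) * X n t \<omega>" for n
    by (rule NSM_scale[OF X(1)]) simp
  then obtain Y where Y: "\<And>n. Y n \<in> NSM J Js"
    "\<And>n t \<omega>. 0 \<le> t \<Longrightarrow> \<omega> \<in> Omega J \<Longrightarrow> Y n t \<omega> = ereal ((1/2)^Suc n) * X n t \<omega>" by metis
  obtain Z where Z: "Z \<in> NSM J Js" "\<And>t \<omega>. 0 \<le> t \<Longrightarrow> \<omega> \<in> Omega J \<Longrightarrow> Z t \<omega> = (\<Sum>n. Y n t \<omega>)"
    using NSM_suminf[of Y, OF Y(1)] by blast
  show ?thesis
    unfolding qa_def
  proof (intro bexI[of _ Z] conjI ballI allI impI Z(1))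
    fix \<omega> assume \<omega>: "\<omega> \<in> Omega J"
    have "(\<lambda>n. ereal ((1/2)^Suc n)) sums ereal 1"
      unfolding sums_ereal by (rule power_half_series)
    then show "Z 0 \<omega> = 1"
      using \<omega> by (simp add: Z(2) Y(2) X(2) one_ereal_def sums_iff)
  next
    fix t \<omega> assume t: "0 \<le> (t::real)" and \<omega>: "\<omega> \<in> Omega J" and "\<not> (\<forall>n. P n t \<omega>)"
    then obtain n where "\<not> P n t \<omega>" by blast
    then have "Y n t \<omega> = \<infinity>" using X(3) t \<omega> by (simp add: Y(2))
    then have "(\<Sum>n. Y n t \<omega>) = \<infinity>" using suminf_PInfty[of "\<lambda>n. Y n t \<omega>" n] NSM_nonneg[OF Y(1) t \<omega>] by blast
    then show "Z t \<omega> = \<infinity>" using Z(2)[OF t \<omega>] by simp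
  qed
qed

lemma qa_conj:
  assumes "qa J Js P" "qa J Js Q"
  shows "qa J Js (\<lambda>t \<omega>. P t \<omega> \<and> Q t \<omega>)"
proof -
  have "qa J Js (\<lambda>t \<omega>. \<forall>n::nat. (if n = 0 then P else Q) t \<omega>)"
    by (rule qa_countable) (use assms in simp)
  then show ?thesis by (rule qa_mono) (metis zero_neq_one)
qed

text \<open>The sum of all \<open>W n\<close> starts at a finite value and is infinite wherever
  \<open>W n\<close> is at least 1 infinitely often.\<close>

lemma qa_Borel_Cantelli:
  assumes W: "\<And>n. W n \<in> NSM J Js" "\<And>n \<omega>. \<omega> \<in> Omega J \<Longrightarrow> W n 0 \<omega> = ereal (w n)"
    and w: "summable w" "\<And>n. 0 \<le> w n"
  shows "qa J Js (\<lambda>t \<omega>. \<forall>\<^sub>F n in sequentially. W n t \<omega> < 1)"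
proof -
  obtain S where S: "S \<in> NSM J Js" "\<And>t \<omega>. 0 \<le> t \<Longrightarrow> \<omega> \<in> Omega J \<Longrightarrow> S t \<omega> = (\<Sum>n. W n t \<omega>)"
    using NSM_suminf[of W, OF W(1)] by blast
  obtain U where U: "U \<in> NSM J Js" "\<And>t \<omega>. 0 \<le> t \<Longrightarrow> \<omega> \<in> Omega J \<Longrightarrow> U t \<omega> = ereal 1"
    by (rule NSM_const[of 1]) auto
  obtain V where V: "V \<in> NSM J Js" "\<And>t \<omega>. 0 \<le> t \<Longrightarrow> \<omega> \<in> Omega J \<Longrightarrow> V t \<omega> = S t \<omega> + U t \<omega>"
    using NSM_add[OF S(1) U(1)] by blast
  \<comment> \<open>The added constant 1 makes the initial value positive even if all
    \<open>w n\<close> vanish, so that it can be normalised to 1.\<close>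
  define A where "A = suminf w + 1"
  have A: "0 < A" using suminf_nonneg[OF w] by (simp add: A_def)
  obtain Z where Z: "Z \<in> NSM J Js" "\<And>t \<omega>. 0 \<le> t \<Longrightarrow> \<omega> \<in> Omega J \<Longrightarrow> Z t \<omega> = ereal (1 / A) * V t \<omega>"
    using NSM_scale[OF V(1), of "1 / A"] A by auto
  show ?thesis
    unfolding qa_def
  proof (intro bexI[of _ Z] conjI ballI allI impI Z(1))
    fix \<omega> assume \<omega>: "\<omega> \<in> Omega J"
    then have "V 0 \<omega> = ereal A"
      by (simp add: V(2) S(2) U(2) W(2) suminf_ereal'[OF w(1)] A_def)
    then show "Z 0 \<omega> = 1" using \<omega> A by (simp add: Z(2) one_ereal_def)
  next
    fix t \<omega> assume t: "0 \<le> (t::real)" and \<omega>: "\<omega> \<in> Omega J"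
      and ne: "\<not> (\<forall>\<^sub>F n in sequentially. W n t \<omega> < 1)"
    have nn: "\<And>n. 0 \<le> W n t \<omega>" by (rule NSM_nonneg[OF W(1) t \<omega>])
    have "(\<Sum>n. W n t \<omega>) = \<infinity>"
    proof (rule ccontr)
      assume fin: "(\<Sum>n. W n t \<omega>) \<noteq> \<infinity>"
      have "(\<lambda>n. real_of_ereal (W n t \<omega>)) \<longlonglongrightarrow> 0"
        by (rule summable_LIMSEQ_zero[OF summable_real_of_ereal[OF nn fin]])
      then have "\<forall>\<^sub>F n in sequentially. real_of_ereal (W n t \<omega>) < 1"
        by (rule order_tendstoD(2)) simp
      then have "\<forall>\<^sub>F n in sequentially. W n t \<omega> < 1"
      proof (rule eventually_mono)
        fix n assume "real_of_ereal (W n t \<omega>) < 1"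
        then show "W n t \<omega> < 1"
          using suminf_PInfty[OF nn fin, of n] nn[of n] by (cases "W n t \<omega>") auto
      qed
      with ne show False by simp
    qed
    then have "V t \<omega> = \<infinity>" by (simp add: V(2)[OF t \<omega>] S(2)[OF t \<omega>])
    then show "Z t \<omega> = \<infinity>" using A by (simp add: Z(2)[OF t \<omega>])
  qed
qed

lemma qa_True: "qa J Js (\<lambda>t \<omega>. True)"
proof -
  obtain U where U: "U \<in> NSM J Js" "\<And>t \<omega>. 0 \<le> t \<Longrightarrow> \<omega> \<in> Omega J \<Longrightarrow> U t \<omega> = ereal 1"
    by (rule NSM_const[of 1]) auto
  then show ?thesis unfolding qa_def by (intro bexI[of _ U]) (auto simp: one_ereal_def)
qed

text \<open>No induction is involved: simple capital processes are nowhere \<open>None\<close>, and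
  the limit rule itself demands a continuous process.\<close>

lemma CM_D:
  assumes X: "X \<in> CM J Js" and Js: "Js \<le> J"
  shows "adapted J X" "qa J Js (\<lambda>t \<omega>. X t \<omega> \<noteq> None)"
    "\<And>\<omega> s t. \<omega> \<in> Omega J \<Longrightarrow> 0 \<le> s \<Longrightarrow> s \<le> t \<Longrightarrow> X t \<omega> \<noteq> None \<Longrightarrow> X s \<omega> \<noteq> None"
proof -
  have "adapted J X \<and> qa J Js (\<lambda>t \<omega>. X t \<omega> \<noteq> None) \<and>
    (\<forall>\<omega>\<in>Omega J. \<forall>s t. 0 \<le> s \<longrightarrow> s \<le> t \<longrightarrow> X t \<omega> \<noteq> None \<longrightarrow> X s \<omega> \<noteq> None)"
    using X
  proof cases
    case (base K)
    obtain c \<tau> h where s: "strategy J Js \<tau> h"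
      "\<And>t \<omega>. 0 \<le> t \<Longrightarrow> \<omega> \<in> Omega J \<Longrightarrow> K t \<omega> = capital Js c \<tau> h t \<omega>"
      by (rule simple_capital_strategy[OF base(2)]) (rule that)
    have "adapted J X"
      unfolding adapted_def
    proof (intro allI ballI impI)
      fix t \<omega> \<omega>' assume *: "0 \<le> t" "\<omega> \<in> Omega J" "\<omega>' \<in> Omega J" "agree_upto J (ereal t) \<omega> \<omega>'"
      then have "capital Js c \<tau> h t \<omega> = capital Js c \<tau> h t \<omega>'"
        using capital_adapted[OF s(1) Js, of c] unfolding adapted_def by blast
      then show "X t \<omega> = X t \<omega>'" using * by (simp add: base(1) s(2))
    qed
    then show ?thesis by (simp add: base(1) qa_True)
  next
    case (limit Xk)
    then show ?thesis using cont_processD[of J Js X] by blast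
  qed
  then show "adapted J X" "qa J Js (\<lambda>t \<omega>. X t \<omega> \<noteq> None)"
    "\<And>\<omega> s t. \<omega> \<in> Omega J \<Longrightarrow> 0 \<le> s \<Longrightarrow> s \<le> t \<Longrightarrow> X t \<omega> \<noteq> None \<Longrightarrow> X s \<omega> \<noteq> None"
    by blast+
qed

section \<open>Comparison of two Riemann sums\<close>

lemma gint_diff:
  assumes "time_grid r" "ereal t \<le> r m"
  shows "gint r (\<lambda>n s. u n s - v n s) t = gint r u t - gint r v t"
  by (simp add: gint_eq_sum[OF assms] sum_subtractf[symmetric] algebra_simps)

lemma gint_at_grid:
  assumes r: "time_grid r" and t: "r m \<le> ereal t"
  shows "gint r u (real_of_ereal (r m)) =
    (\<Sum>n<m. u n (real_of_ereal (r (Suc n))) - u n (real_of_ereal (r n)))"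
proof -
  let ?p = "real_of_ereal (r m)"
  have p: "ereal ?p = r m" using real_of_finite_time[OF time_grid_nonneg[OF r] t] .
  have "stop_at (r n) ?p = real_of_ereal (r n)" if "n \<le> m" for n
    using time_grid_mono[OF r that] p by (simp add: stop_at_below)
  then show ?thesis
    using p by (subst gint_eq_sum[OF r, where m = m]) (auto intro!: sum.cong)
qed

text \<open>The pairwise form of the condition in \<open>fine_for\<close>. It avoids subtraction of
  extended reals, and on cells outside the domain of \<open>Y\<close>, where the supremum is minus
  infinity, it is plainly vacuous.\<close>

definition osc_le :: "nat \<Rightarrow> (nat \<Rightarrow> path \<Rightarrow> ereal) \<Rightarrow> (real \<Rightarrow> path \<Rightarrow> real option) \<Rightarrow> real \<Rightarrow> bool" where
  "osc_le J T Y \<delta> \<longleftrightarrow> (\<forall>k. \<forall>\<omega>\<in>Omega J. \<forall>a b. 0 \<le> a \<and> 0 \<le> b \<and> Y a \<omega> \<noteq> None \<and> Y b \<omega> \<noteq> None \<and>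
     T k \<omega> \<le> ereal a \<and> ereal a \<le> T (Suc k) \<omega> \<and> T k \<omega> \<le> ereal b \<and> ereal b \<le> T (Suc k) \<omega> \<longrightarrow>
     \<bar>the (Y a \<omega>) - the (Y b \<omega>)\<bar> \<le> \<delta>)"

lemma osc_leD:
  assumes "osc_le J T Y \<delta>" "\<omega> \<in> Omega J" "0 \<le> a" "0 \<le> b" "Y a \<omega> \<noteq> None" "Y b \<omega> \<noteq> None"
    "T k \<omega> \<le> ereal a" "ereal a \<le> T (Suc k) \<omega>" "T k \<omega> \<le> ereal b" "ereal b \<le> T (Suc k) \<omega>"
  shows "\<bar>the (Y a \<omega>) - the (Y b \<omega>)\<bar> \<le> \<delta>"
  using assms unfolding osc_le_def by blast

abbreviation riemann_sum :: "(nat \<Rightarrow> path \<Rightarrow> ereal) \<Rightarrow> (real \<Rightarrow> path \<Rightarrow> real option) \<Rightarrow>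
    (real \<Rightarrow> path \<Rightarrow> real option) \<Rightarrow> real \<Rightarrow> path \<Rightarrow> real" where
  "riemann_sum T H X t \<omega> \<equiv> gint (\<lambda>k. T k \<omega>)
     (\<lambda>k u. the (H (real_of_ereal (T k \<omega>)) \<omega>) * the (X u \<omega>)) t"

text \<open>\<open>riemann_sum\<close> samples \<open>H\<close> at the unstopped grid time, so that
  the coefficient of a cell does not depend on \<open>t\<close>. The sampling times differ only in
  cells starting after \<open>t\<close>, where the increment of \<open>X\<close> is zero.\<close>

lemma riemann_eq_riemann_sum:
  assumes "time_grid (\<lambda>k. TT n k \<omega>)"
  shows "riemann TT H X n t \<omega> = riemann_sum (TT n) H X t \<omega>"
proof -
  have "the (H (stop_at (TT n k \<omega>) t) \<omega>) *
      (the (X (stop_at (TT n (Suc k) \<omega>) t) \<omega>) - the (X (stop_at (TT n k \<omega>) t) \<omega>)) =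
    the (H (real_of_ereal (TT n k \<omega>)) \<omega>) * the (X (stop_at (TT n (Suc k) \<omega>) t) \<omega>) -
    the (H (real_of_ereal (TT n k \<omega>)) \<omega>) * the (X (stop_at (TT n k \<omega>) t) \<omega>)" for k
  proof (cases "TT n k \<omega> \<le> ereal t")
    case True
    then show ?thesis by (simp add: stop_at_below right_diff_distrib)
  next
    case False
    then have "ereal t \<le> TT n k \<omega>" "ereal t \<le> TT n (Suc k) \<omega>"
      using time_grid_mono[OF assms, of k "Suc k"] by auto
    then show ?thesis by (simp add: stop_at_above)
  qed
  then show ?thesis unfolding riemann_def gint_def by simp
qed

text \<open>With \<open>\<sigma>\<close> the common refinement of \<open>P\<close> and \<open>Q\<close>, the difference of the two Riemann sums is
  \<open>\<integral> f dX\<close> with \<open>\<bar>f\<bar> \<le> \<delta>\<close>. Let \<open>D'\<close> be this integral stopped at the first point of \<open>\<sigma>\<close> where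
  it reaches \<open>\<theta>\<close>. Then \<open>D'\<^sup>2 - \<delta>\<^sup>2 X\<^sup>2\<close> grows by at most \<open>\<integral> (2 D' f' - 2 \<delta>\<^sup>2 X) dX\<close>, because the
  quadratic terms \<open>(f'\<^sup>2 - \<delta>\<^sup>2) (\<Delta>X)\<^sup>2\<close> are negative.\<close>

lemma riemann_sums_close_hedge:
  assumes H: "adapted J H"
    "\<And>\<omega> s t. \<omega> \<in> Omega J \<Longrightarrow> 0 \<le> s \<Longrightarrow> s \<le> t \<Longrightarrow> H t \<omega> \<noteq> None \<Longrightarrow> H s \<omega> \<noteq> None"
    and X: "X \<in> CM J Js" and Js: "Js \<le> J"
    and P: "st_grid J P" "osc_le J P H \<delta>" "osc_le J P X \<delta>"
    and Q: "st_grid J Q" "osc_le J Q H \<delta>"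
    and \<delta>: "0 < \<delta>" "\<delta>\<^sup>2 \<le> \<theta>"
  shows "\<exists>Z\<in>NSM J Js. (\<forall>\<omega>\<in>Omega J. Z 0 \<omega> = ereal (\<delta>\<^sup>2 * (L\<^sup>2 + 1))) \<and>
    (\<forall>t \<omega> i j s. 0 \<le> t \<longrightarrow> \<omega> \<in> Omega J \<longrightarrow> H t \<omega> \<noteq> None \<longrightarrow> X t \<omega> \<noteq> None \<longrightarrow>
      ereal t < P i \<omega> \<longrightarrow> ereal t < Q j \<omega> \<longrightarrow> (\<forall>s. 0 \<le> s \<longrightarrow> s \<le> t \<longrightarrow> \<bar>the (X s \<omega>)\<bar> \<le> L) \<longrightarrow>
      0 \<le> s \<longrightarrow> s \<le> t \<longrightarrow> 2 * \<theta> \<le> \<bar>riemann_sum P H X s \<omega> - riemann_sum Q H X s \<omega>\<bar> \<longrightarrow>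
      ereal (\<theta>\<^sup>2) \<le> Z t \<omega>)"
proof -
  note Xp = CM_D[OF X Js]
  define \<sigma> where "\<sigma> = mergeg P Q"
  have \<sigma>: "st_grid J \<sigma>" unfolding \<sigma>_def by (rule st_grid_merge[OF P(1) Q(1)])
  define HT where "HT T k \<omega> = the (H (real_of_ereal (T k \<omega>)) \<omega>)" for T :: "nat \<Rightarrow> path \<Rightarrow> ereal" and k \<omega>
  let ?i = "\<lambda>T \<omega> m. last_index (\<lambda>k. T k \<omega>) (\<lambda>k. \<sigma> k \<omega>) m"
  define f where "f m \<omega> = HT P (?i P \<omega> m) \<omega> - HT Q (?i Q \<omega> m) \<omega>" for m \<omega>
  define x where "x m \<omega> = the (X (real_of_ereal (\<sigma> m \<omega>)) \<omega>)" for m \<omega>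
  define D where "D m \<omega> = (\<Sum>i<m. f i \<omega> * (x (Suc i) \<omega> - x i \<omega>))" for m \<omega>
  \<comment> \<open>\<open>D\<close> is tested at grid points only, so the decision to freeze is
    known when the next cell starts.\<close>
  define alive where "alive m \<omega> \<longleftrightarrow> (\<forall>i\<le>m. \<bar>D i \<omega>\<bar> < \<theta>)" for m \<omega>
  define f' where "f' m \<omega> = (if alive m \<omega> then f m \<omega> else 0)" for m \<omega>
  define D' where "D' m \<omega> = (\<Sum>i<m. f' i \<omega> * (x (Suc i) \<omega> - x i \<omega>))" for m \<omega>
  define q where "q = \<delta>\<^sup>2"
  define g where "g m \<omega> = 2 * (D' m \<omega> * f' m \<omega>) - 2 * q * x m \<omega>" for m \<omega>

  have mono: "tau_measurable J (\<sigma> m) h" if "tau_measurable J (\<sigma> i) h" "i \<le> m"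
    for i m and h :: "path \<Rightarrow> real"
    by (rule tau_measurable_mono[OF that(1)]) (rule time_grid_mono[OF st_gridD(2)[OF \<sigma>] that(2)])
  have HT_meas: "tau_measurable J (T k) (HT T k)" if "st_grid J T" for T k
  proof -
    have "adapted J (\<lambda>t \<omega>. the (H t \<omega>))" using H(1) unfolding adapted_def by metis
    then show ?thesis unfolding HT_def[abs_def] by (rule tau_measurable_at[OF _ st_gridD(1)[OF that]])
  qed
  have f_meas: "tau_measurable J (\<sigma> m) (f m)" for m
    unfolding f_def[abs_def]
    by (rule tau_measurable_comp2[where F = "(-)",
          OF tau_measurable_last_index[OF P(1) \<sigma> HT_meas[OF P(1)]]
             tau_measurable_last_index[OF Q(1) \<sigma> HT_meas[OF Q(1)]]])
  have x_meas: "tau_measurable J (\<sigma> m) (x m)" for m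
  proof -
    have "adapted J (\<lambda>t \<omega>. the (X t \<omega>))" using Xp(1) unfolding adapted_def by metis
    then show ?thesis unfolding x_def[abs_def] by (rule tau_measurable_at[OF _ st_gridD(1)[OF \<sigma>]])
  qed
  have sum_meas: "tau_measurable J (\<sigma> m) (\<lambda>\<omega>. \<Sum>i<m. k i \<omega> * (x (Suc i) \<omega> - x i \<omega>))"
    if k: "\<And>i. tau_measurable J (\<sigma> i) (k i)" for k m
  proof (induction m)
    case 0
    then show ?case by (simp add: tau_measurable_const)
  next
    case (Suc m)
    have dx: "tau_measurable J (\<sigma> (Suc m)) (\<lambda>\<omega>. x (Suc m) \<omega> - x m \<omega>)"
      by (rule tau_measurable_comp2[where F = "(-)", OF x_meas mono[OF x_meas]]) simp
    have "tau_measurable J (\<sigma> (Suc m)) (\<lambda>\<omega>. k m \<omega> * (x (Suc m) \<omega> - x m \<omega>))"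
      by (rule tau_measurable_comp2[where F = "(*)", OF mono[OF k] dx]) simp
    then show ?case
      using tau_measurable_comp2[where F = "(+)", OF mono[OF Suc, of "Suc m"]] by simp
  qed
  have D_meas: "tau_measurable J (\<sigma> m) (D m)" for m
    unfolding D_def[abs_def] by (rule sum_meas[OF f_meas])
  have alive_meas: "tau_measurable J (\<sigma> m) (alive m)" for m
    unfolding tau_measurable_def
  proof (intro ballI impI)
    fix \<omega> \<omega>' assume *: "\<omega> \<in> Omega J" "\<omega>' \<in> Omega J" "agree_upto J (\<sigma> m \<omega>) \<omega> \<omega>'"
    have "D i \<omega> = D i \<omega>'" if "i \<le> m" for i
      using mono[OF D_meas that] * unfolding tau_measurable_def by blast
    then show "alive m \<omega> = alive m \<omega>'" unfolding alive_def by simp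
  qed
  have f'_meas: "tau_measurable J (\<sigma> m) (f' m)" for m
    unfolding f'_def[abs_def]
    by (rule tau_measurable_comp2[where F = "\<lambda>b x. if b then x else 0", OF alive_meas f_meas])
  have D'_meas: "tau_measurable J (\<sigma> m) (D' m)" for m
    unfolding D'_def[abs_def] by (rule sum_meas[OF f'_meas])
  have g_meas: "tau_measurable J (\<sigma> m) (g m)" for m
    unfolding g_def[abs_def]
    by (rule tau_measurable_comp2[where F = "\<lambda>a b. 2 * a - 2 * q * b",
          OF tau_measurable_comp2[where F = "(*)", OF D'_meas f'_meas] x_meas])
  have q: "0 < q" using \<delta> by (simp add: q_def)
  \<comment> \<open>\<open>q * L^2\<close> pays for the term -q X^2. The additional \<open>q\<close>
    keeps the hedged integral at or above \<open>q\<close>, which serves as the \<epsilon> of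
    \<open>hedges\<close>.\<close>
  define a where "a = q * (L\<^sup>2 + 1)"
  have "0 \<le> a" using q by (simp add: a_def)
  from CM_hedges[OF X Js \<sigma> g_meas this] obtain Z where Z: "hedges J Js X \<sigma> g a Z" by blast
  have "ereal (\<theta>\<^sup>2) \<le> Z t \<omega>"
    if t: "0 \<le> t" and \<omega>: "\<omega> \<in> Omega J" and Ht: "H t \<omega> \<noteq> None" and Xt: "X t \<omega> \<noteq> None"
      and i: "ereal t < P i \<omega>" and j: "ereal t < Q j \<omega>"
      and XL: "\<forall>s. 0 \<le> s \<longrightarrow> s \<le> t \<longrightarrow> \<bar>the (X s \<omega>)\<bar> \<le> L"
      and s0: "0 \<le> s0" "s0 \<le> t" "2 * \<theta> \<le> \<bar>riemann_sum P H X s0 \<omega> - riemann_sum Q H X s0 \<omega>\<bar>"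
    for t \<omega> i j s0
  proof -
    let ?x = "\<lambda>u. the (X u \<omega>)"
    note tg = st_gridD(2)[OF \<sigma> \<omega>] and tP = st_gridD(2)[OF P(1) \<omega>] and tQ = st_gridD(2)[OF Q(1) \<omega>]
    define M where "M = i + j"
    have M: "ereal t < \<sigma> M \<omega>" unfolding \<sigma>_def M_def by (rule merge_greater[OF tP tQ i j])
    have sM: "ereal s \<le> \<sigma> M \<omega>" if "s \<le> t" for s
      using M that by (metis ereal_less_eq(3) less_imp_le order_trans)
    have pos: "ereal (real_of_ereal (T k \<omega>)) = T k \<omega>" "0 \<le> real_of_ereal (T k \<omega>)" "real_of_ereal (T k \<omega>) \<le> t"
      if "time_grid (\<lambda>k. T k \<omega>)" "T k \<omega> \<le> ereal t" for T :: "nat \<Rightarrow> path \<Rightarrow> ereal" and k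
      using time_grid_nonneg[OF that(1), of k] that(2) by (cases "T k \<omega>"; simp)+
    have iP: "P (?i P \<omega> m) \<omega> \<le> \<sigma> m \<omega>" "\<sigma> (Suc m) \<omega> \<le> P (Suc (?i P \<omega> m)) \<omega>" for m
      using merge_interval(1,2)[OF tP tQ, of m] unfolding \<sigma>_def by auto
    have iQ: "Q (?i Q \<omega> m) \<omega> \<le> \<sigma> m \<omega>" "\<sigma> (Suc m) \<omega> \<le> Q (Suc (?i Q \<omega> m)) \<omega>" for m
      using merge_interval2(1,2)[OF tP tQ, of m] unfolding \<sigma>_def by auto
    \<comment> \<open>Of the two sampling points, the later one lies in the cell of the earlier one,
      because both cells contain merged cell \<open>m\<close>. So one oscillation bound for
      \<open>H\<close> suffices.\<close>
    have fb: "\<bar>f m \<omega>\<bar> \<le> \<delta>" if m: "\<sigma> m \<omega> \<le> ereal t" for m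
    proof -
      let ?p = "real_of_ereal (P (?i P \<omega> m) \<omega>)" and ?q = "real_of_ereal (Q (?i Q \<omega> m) \<omega>)"
      note p = pos[where T = P, OF tP order_trans[OF iP(1) m]] and q = pos[where T = Q, OF tQ order_trans[OF iQ(1) m]]
      note mS = time_grid_mono[OF tg, of m "Suc m", simplified]
      have "H ?p \<omega> \<noteq> None" "H ?q \<omega> \<noteq> None"
        using H(2)[OF \<omega> p(2,3) Ht] H(2)[OF \<omega> q(2,3) Ht] by auto
      note pq = p(1,2) q(1,2) this
      have up: "P (?i P \<omega> m) \<omega> \<le> Q (Suc (?i Q \<omega> m)) \<omega>" "Q (?i Q \<omega> m) \<omega> \<le> P (Suc (?i P \<omega> m)) \<omega>"
        using iP[of m] iQ[of m] mS by (meson order_trans)+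
      show ?thesis
      proof (cases "P (?i P \<omega> m) \<omega> \<le> Q (?i Q \<omega> m) \<omega>")
        case True
        then show ?thesis
          unfolding f_def HT_def using pq up time_grid_mono[OF tP, of "?i P \<omega> m" "Suc (?i P \<omega> m)"]
          by (intro osc_leD[OF P(2) \<omega>, where k = "?i P \<omega> m"]) simp_all
      next
        case False
        then show ?thesis
          unfolding f_def HT_def using pq up time_grid_mono[OF tQ, of "?i Q \<omega> m" "Suc (?i Q \<omega> m)"]
          by (intro osc_leD[OF Q(2) \<omega>, where k = "?i Q \<omega> m"]) simp_all
      qed
    qed
    have xb: "\<bar>?x s - x m \<omega>\<bar> \<le> \<delta>"
      if s: "0 \<le> s" "s \<le> t" "\<sigma> m \<omega> \<le> ereal s" "ereal s \<le> \<sigma> (Suc m) \<omega>" for s m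
    proof -
      have m: "\<sigma> m \<omega> \<le> ereal t" using s(2,3) by (metis ereal_less_eq(3) order_trans)
      note p = pos[where T = \<sigma>, OF tg m]
      have "P (?i P \<omega> m) \<omega> \<le> ereal s" "ereal s \<le> P (Suc (?i P \<omega> m)) \<omega>"
        "\<sigma> m \<omega> \<le> P (Suc (?i P \<omega> m)) \<omega>"
        using iP[of m] s time_grid_mono[OF tg, of m "Suc m", simplified] by (meson order_trans)+
      then show ?thesis
        unfolding x_def using p iP(1)[of m] s Xp(3)[OF \<omega> s(1,2) Xt] Xp(3)[OF \<omega> p(2,3) Xt]
        by (intro osc_leD[OF P(3) \<omega>, where k = "?i P \<omega> m"]) simp_all
    qed
    have RD: "riemann_sum P H X s \<omega> - riemann_sum Q H X s \<omega> = gint (\<lambda>k. \<sigma> k \<omega>) (\<lambda>k u. f k \<omega> * ?x u) s"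
      if s: "0 \<le> s" "s \<le> t" for s
    proof -
      have \<sigma>': "merge_times (\<lambda>k. Q k \<omega>) (\<lambda>k. P k \<omega>) = (\<lambda>k. \<sigma> k \<omega>)"
        unfolding \<sigma>_def by (rule merge_times_commute)
      have "riemann_sum P H X s \<omega> = gint (\<lambda>k. \<sigma> k \<omega>) (\<lambda>m u. HT P (?i P \<omega> m) \<omega> * ?x u) s"
        using gint_refine[OF tP tQ s(1), of M "\<lambda>k u. HT P k \<omega> * ?x u"] sM[OF s(2)]
        unfolding HT_def \<sigma>_def by simp
      moreover have "riemann_sum Q H X s \<omega> = gint (\<lambda>k. \<sigma> k \<omega>) (\<lambda>m u. HT Q (?i Q \<omega> m) \<omega> * ?x u) s"
        using gint_refine[OF tQ tP s(1), of M "\<lambda>k u. HT Q k \<omega> * ?x u"] sM[OF s(2)]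
        unfolding \<sigma>' HT_def by simp
      ultimately show ?thesis
        unfolding f_def left_diff_distrib by (simp only: gint_diff[OF tg sM[OF s(2)]])
    qed
    let ?F = "\<lambda>s. gint (\<lambda>k. \<sigma> k \<omega>) (\<lambda>k u. f k \<omega> * ?x u) s"
    let ?F' = "\<lambda>s. gint (\<lambda>k. \<sigma> k \<omega>) (\<lambda>k u. f' k \<omega> * ?x u) s"
    let ?G = "\<lambda>s. gint (\<lambda>k. \<sigma> k \<omega>) (\<lambda>k u. g k \<omega> * ?x u) s"
    have F_grid: "?F (real_of_ereal (\<sigma> m \<omega>)) = D m \<omega>" "?F' (real_of_ereal (\<sigma> m \<omega>)) = D' m \<omega>"
      if "\<sigma> m \<omega> \<le> ereal t" for m
      unfolding gint_at_grid[OF tg that] D_def D'_def x_def by (simp_all add: right_diff_distrib)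
    have aG: "(?F' s)\<^sup>2 + q \<le> a + ?G s" if s: "0 \<le> s" "s \<le> t" for s
    proof -
      define \<Phi> where "\<Phi> u = (?F' u)\<^sup>2 - q * (?x u)\<^sup>2" for u
      have "\<Phi> s - \<Phi> 0 \<le> ?G s"
      proof (rule gint_compare[OF tg s(1) sM[OF s(2)]])
        fix k u assume u: "0 \<le> u" "u \<le> s" "\<sigma> k \<omega> \<le> ereal u" "ereal u \<le> \<sigma> (Suc k) \<omega>"
        let ?p = "real_of_ereal (\<sigma> k \<omega>)"
        have kt: "\<sigma> k \<omega> \<le> ereal t" using u(2,3) s(2) by (metis ereal_less_eq(3) order_trans)
        define \<Delta> where "\<Delta> = ?x u - ?x ?p"
        have "?F' u - ?F' ?p = f' k \<omega> * \<Delta>"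
          using gint_step[OF tg u(3,4), of "\<lambda>k u. f' k \<omega> * ?x u"] by (simp add: \<Delta>_def right_diff_distrib)
        then have F': "?F' u = D' k \<omega> + f' k \<omega> * \<Delta>" "?F' ?p = D' k \<omega>" using F_grid(2)[OF kt] by simp_all
        have xu: "?x u = x k \<omega> + \<Delta>" "?x ?p = x k \<omega>" by (simp_all add: \<Delta>_def x_def)
        have "\<bar>f' k \<omega>\<bar> \<le> \<bar>\<delta>\<bar>" using fb[OF kt] \<delta>(1) by (simp add: f'_def)
        then have "(f' k \<omega>)\<^sup>2 \<le> q" unfolding q_def by (rule abs_le_square_iff[THEN iffD1])
        then have "((f' k \<omega>)\<^sup>2 - q) * \<Delta>\<^sup>2 \<le> 0" by (intro mult_nonpos_nonneg) auto
        \<comment> \<open>Exact expansion of the two squares. The terms linear in \<Delta> are what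
          \<open>g\<close> was made from.\<close>
        moreover have "\<Phi> u - \<Phi> ?p = g k \<omega> * \<Delta> + ((f' k \<omega>)\<^sup>2 - q) * \<Delta>\<^sup>2"
          unfolding \<Phi>_def F' unfolding xu g_def by (simp add: algebra_simps power2_eq_square)
        ultimately show "\<Phi> u - \<Phi> ?p \<le> g k \<omega> * ?x u - g k \<omega> * ?x ?p"
          by (simp add: \<Delta>_def right_diff_distrib)
      qed
      moreover have "\<Phi> 0 \<le> 0" using q by (simp add: \<Phi>_def gint_0[OF tg])
      moreover have "(?x s)\<^sup>2 \<le> L\<^sup>2"
      proof (rule abs_le_square_iff[THEN iffD1])
        have "\<bar>?x s\<bar> \<le> L" using XL s by blast
        then show "\<bar>?x s\<bar> \<le> \<bar>L\<bar>" by simp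
      qed
      then have "q * (?x s)\<^sup>2 \<le> q * L\<^sup>2" using q by (intro mult_left_mono) auto
      ultimately show ?thesis unfolding \<Phi>_def a_def by (simp add: algebra_simps)
    qed
    obtain k where k: "\<sigma> k \<omega> \<le> ereal s0" "ereal s0 \<le> \<sigma> (Suc k) \<omega>"
    proof -
      have "ereal s0 < \<sigma> M \<omega>" using M s0(2) by (metis ereal_less_eq(3) le_less_trans)
      from time_grid_interval[OF tg s0(1) this] that show thesis by (metis less_imp_le)
    qed
    have kt: "\<sigma> k \<omega> \<le> ereal t" using k(1) s0(2) by (metis ereal_less_eq(3) order_trans)
    \<comment> \<open>Inside a cell the integrand and the displacement of \<open>X\<close> are both
      at most \<delta>, so \<open>D\<close> moves by at most \<delta>^2 <= \<theta>. Having 2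
      \<theta> at \<open>s0\<close> thus forces at least \<theta> at the grid point before it. This
      is where the factor 2 in the final bound comes from.\<close>
    have Dk: "\<theta> \<le> \<bar>D k \<omega>\<bar>"
    proof -
      have "?F s0 - D k \<omega> = f k \<omega> * (?x s0 - x k \<omega>)"
        using gint_step[OF tg k, of "\<lambda>k u. f k \<omega> * ?x u"] F_grid(1)[OF kt]
        by (simp add: right_diff_distrib x_def)
      then have "\<bar>?F s0 - D k \<omega>\<bar> \<le> \<delta> * \<delta>"
        unfolding abs_mult using fb[OF kt] xb[OF s0(1,2) k] \<delta>(1) by (simp add: abs_mult mult_mono)
      then have "\<bar>?F s0 - D k \<omega>\<bar> \<le> \<theta>" using \<delta>(2) by (simp add: power2_eq_square)
      moreover have "2 * \<theta> \<le> \<bar>?F s0\<bar>" using s0(3) unfolding RD[OF s0(1,2)] .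
      ultimately show ?thesis by linarith
    qed
    then have dead_k: "\<not> alive k \<omega>" unfolding alive_def by (meson not_le order_refl)
    define m where "m = (LEAST i. \<not> alive i \<omega>)"
    have dead_m: "\<not> alive m \<omega>" unfolding m_def by (rule LeastI) (rule dead_k)
    have "m \<le> k" unfolding m_def by (rule Least_le) (rule dead_k)
    then have mt: "\<sigma> m \<omega> \<le> ereal t" using time_grid_mono[OF tg, of m k] kt by (metis order_trans)
    have alive_below: "alive i \<omega>" if "i < m" for i using not_less_Least that unfolding m_def by blast
    have dead_above: "\<not> alive i \<omega>" if "m \<le> i" for i
      using dead_m that unfolding alive_def by (meson order_trans)
    have Dm: "\<theta> \<le> \<bar>D m \<omega>\<bar>"
    proof (rule ccontr)
      assume "\<not> \<theta> \<le> \<bar>D m \<omega>\<bar>"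
      then have "\<bar>D i \<omega>\<bar> < \<theta>" if "i \<le> m" for i
        using alive_below[of i] that unfolding alive_def by (cases "i = m") auto
      with dead_m show False unfolding alive_def by blast
    qed
    \<comment> \<open>Freezing carries the crossing at grid point \<open>m\<close> forward to the
      time \<open>t\<close> at which the hedge is read off.\<close>
    have "?F' t = ?F' (real_of_ereal (\<sigma> m \<omega>))"
      by (rule gint_frozen[OF tg mt sM[OF order_refl]]) (simp add: f'_def dead_above)
    also have "\<dots> = D' m \<omega>" by (rule F_grid(2)[OF mt])
    also have "\<dots> = D m \<omega>"
      unfolding D'_def D_def by (intro sum.cong) (auto simp: f'_def alive_below)
    finally have F't: "?F' t = D m \<omega>" .
    have "0 \<le> \<theta>" using \<delta>(2) by (meson order_trans zero_le_power2)
    then have "\<theta>\<^sup>2 \<le> (D m \<omega>)\<^sup>2" using Dm by (intro abs_le_square_iff[THEN iffD1]) simp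
    also have "\<dots> \<le> a + ?G t" using aG[OF t order_refl] q unfolding F't by linarith
    finally have "ereal (\<theta>\<^sup>2) \<le> ereal (a + ?G t)" by simp
    also have "\<dots> \<le> Z t \<omega>"
    proof -
      have "\<forall>s. 0 \<le> s \<longrightarrow> s \<le> t \<longrightarrow> q \<le> a + ?G s"
        using aG by (meson add_increasing order_refl order_trans zero_le_power2)
      then show ?thesis using Z t \<omega> q Xt M unfolding hedges_def by blast
    qed
    finally show ?thesis .
  qed
  moreover have "Z \<in> NSM J Js" "\<forall>\<omega>\<in>Omega J. Z 0 \<omega> = ereal (\<delta>\<^sup>2 * (L\<^sup>2 + 1))"
    using Z unfolding hedges_def a_def q_def by blast+
  ultimately show ?thesis by blast
qed

section \<open>From fine sequences of partitions to convergence\<close>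

lemma osc_le_mono: "osc_le J T Y \<delta> \<Longrightarrow> \<delta> \<le> \<delta>' \<Longrightarrow> osc_le J T Y \<delta>'"
  unfolding osc_le_def by (meson order_trans)

lemma partition_st_grid: "partition J Js T \<Longrightarrow> st_grid J T"
  unfolding partition_def st_grid_def time_grid_def by (auto intro!: incseq_SucI)

lemma fine_for_osc_le:
  assumes "fine_for J Js TT Y" "1 \<le> n"
  shows "partition J Js (TT n)" "osc_le J (TT n) Y ((1/2) ^ n)"
proof -
  show "partition J Js (TT n)" using assms unfolding fine_for_def by blast
  show "osc_le J (TT n) Y ((1/2) ^ n)"
    unfolding osc_le_def
  proof (intro allI ballI impI, elim conjE)
    fix k \<omega> a b
    assume \<omega>: "\<omega> \<in> Omega J"
      and ab: "0 \<le> a" "0 \<le> b" "Y a \<omega> \<noteq> None" "Y b \<omega> \<noteq> None" "TT n k \<omega> \<le> ereal a"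
        "ereal a \<le> TT n (Suc k) \<omega>" "TT n k \<omega> \<le> ereal b" "ereal b \<le> TT n (Suc k) \<omega>"
    define S where "S = {t. 0 \<le> t \<and> TT n k \<omega> \<le> ereal t \<and> ereal t \<le> TT n (Suc k) \<omega> \<and> Y t \<omega> \<noteq> None}"
    have "(SUP t\<in>S. ereal (the (Y t \<omega>))) - (INF t\<in>S. ereal (the (Y t \<omega>))) \<le> ereal (2 powr (- real n))"
      using assms \<omega> unfolding fine_for_def Let_def S_def
      by (elim conjE) (drule spec[of _ n], drule mp, assumption, drule spec[of _ "Suc k"], simp)
    moreover have "ereal (the (Y u \<omega>)) - ereal (the (Y v \<omega>)) \<le>
        (SUP t\<in>S. ereal (the (Y t \<omega>))) - (INF t\<in>S. ereal (the (Y t \<omega>)))" if "u \<in> S" "v \<in> S" for u v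
      using that by (intro ereal_minus_mono SUP_upper INF_lower)
    ultimately have "ereal (the (Y u \<omega>)) - ereal (the (Y v \<omega>)) \<le> ereal (2 powr (- real n))"
      if "u \<in> S" "v \<in> S" for u v
      using that by (meson order_trans)
    then have *: "the (Y u \<omega>) - the (Y v \<omega>) \<le> 2 powr (- real n)" if "u \<in> S" "v \<in> S" for u v
      using that by fastforce
    have "a \<in> S" "b \<in> S" using ab by (simp_all add: S_def)
    moreover have "2 powr (- real n) = (1/2::real) ^ n"
      by (simp add: powr_minus powr_realpow inverse_eq_divide power_one_over)
    ultimately show "\<bar>the (Y a \<omega>) - the (Y b \<omega>)\<bar> \<le> (1/2) ^ n"
      using *[of a b] *[of b a] by linarith
  qed
qed

text \<open>Before \<open>t\<close> there are at most \<open>M\<close> cells, and \<open>X\<close>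
  varies by at most \<delta> in each. The bound thus comes from the partition rather than from
  compactness.\<close>

lemma osc_le_bounded:
  assumes T: "time_grid (\<lambda>k. T k \<omega>)" and osc: "osc_le J T X \<delta>" and \<omega>: "\<omega> \<in> Omega J"
    and dom: "\<And>s. 0 \<le> s \<Longrightarrow> s \<le> t \<Longrightarrow> X s \<omega> \<noteq> None" and t: "0 \<le> t" "ereal t < T M \<omega>"
  obtains L where "\<And>s. 0 \<le> s \<Longrightarrow> s \<le> t \<Longrightarrow> \<bar>the (X s \<omega>)\<bar> \<le> L"
proof (rule that)
  let ?x = "\<lambda>k. the (X (real_of_ereal (T k \<omega>)) \<omega>)"
  fix s assume s: "0 \<le> s" "s \<le> t"
  have "ereal s < T M \<omega>" using t(2) s(2) by (metis ereal_less_eq(3) le_less_trans)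
  then obtain m where m: "m < M" "T m \<omega> \<le> ereal s" "ereal s < T (Suc m) \<omega>"
    using time_grid_interval[OF T s(1)] by metis
  have p: "ereal (real_of_ereal (T m \<omega>)) = T m \<omega>" "0 \<le> real_of_ereal (T m \<omega>)" "real_of_ereal (T m \<omega>) \<le> t"
    using time_grid_nonneg[OF T, of m] m(2) s(2) by (cases "T m \<omega>"; simp)+
  have "\<bar>the (X s \<omega>) - ?x m\<bar> \<le> \<delta>"
    using p s m time_grid_mono[OF T, of m "Suc m"] dom[OF s] dom[OF p(2,3)]
    by (intro osc_leD[OF osc \<omega>, where k = m]) (simp_all add: less_imp_le)
  moreover have "\<bar>?x m\<bar> \<le> (\<Sum>k<M. \<bar>?x k\<bar>)" using m(1) by (intro member_le_sum) auto
  ultimately show "\<bar>the (X s \<omega>)\<bar> \<le> (\<Sum>k<M. \<bar>?x k\<bar>) + \<delta>" by linarith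
qed

text \<open>The hedge needs a bound \<open>L\<close> on \<open>X\<close> fixed in advance, whereas
  the actual bound depends on the time and the path. So Borel-Cantelli is applied for every natural
  number in place of \<open>L\<close>, and the countably many quasi-always statements are
  combined.\<close>

lemma riemann_sums_close:
  fixes P Q :: "nat \<Rightarrow> nat \<Rightarrow> path \<Rightarrow> ereal"
  assumes H: "cont_process J Js H" and X: "X \<in> CM J Js" and Js: "Js \<le> J"
    and P: "\<And>n. partition J Js (P n)" "\<And>n. osc_le J (P n) H ((1/2) ^ n)" "\<And>n. osc_le J (P n) X ((1/2) ^ n)"
    and Q: "\<And>n. partition J Js (Q n)" "\<And>n. osc_le J (Q n) H ((1/2) ^ n)"
  shows "qa J Js (\<lambda>t \<omega>. \<forall>\<^sub>F n in sequentially. \<forall>s. 0 \<le> s \<longrightarrow> s \<le> t \<longrightarrow>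
    \<bar>riemann_sum (P n) H X s \<omega> - riemann_sum (Q n) H X s \<omega>\<bar> \<le> 2 * (3/4) ^ n)"
proof -
  note Hp = cont_processD[OF H] and Xp = CM_D[OF X Js]
  let ?D = "\<lambda>n s \<omega>. \<bar>riemann_sum (P n) H X s \<omega> - riemann_sum (Q n) H X s \<omega>\<bar>"
  define hedge where "hedge L n Z \<longleftrightarrow> (\<forall>\<omega>\<in>Omega J. Z 0 \<omega> = ereal (((1/2) ^ n)\<^sup>2 * (L\<^sup>2 + 1))) \<and>
    (\<forall>t \<omega> i j s. 0 \<le> t \<longrightarrow> \<omega> \<in> Omega J \<longrightarrow> H t \<omega> \<noteq> None \<longrightarrow> X t \<omega> \<noteq> None \<longrightarrow>
      ereal t < P n i \<omega> \<longrightarrow> ereal t < Q n j \<omega> \<longrightarrow> (\<forall>s. 0 \<le> s \<longrightarrow> s \<le> t \<longrightarrow> \<bar>the (X s \<omega>)\<bar> \<le> L) \<longrightarrow>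
      0 \<le> s \<longrightarrow> s \<le> t \<longrightarrow> 2 * (3/4) ^ n \<le> ?D n s \<omega> \<longrightarrow> ereal (((3/4) ^ n)\<^sup>2) \<le> Z t \<omega>)"
    for L :: real and n Z
  have "\<exists>Z\<in>NSM J Js. hedge L n Z" for L n
    unfolding hedge_def
  proof (rule riemann_sums_close_hedge[OF Hp(1,3) X Js partition_st_grid[OF P(1)] P(2,3)
        partition_st_grid[OF Q(1)] Q(2)])
    have "((1/2) ^ n)\<^sup>2 = ((1/2 * (1/2)) ^ n :: real)"
      by (simp only: power_mult_distrib power2_eq_square)
    also have "\<dots> \<le> (3/4) ^ n" by (rule power_mono) auto
    finally show "((1/2) ^ n)\<^sup>2 \<le> ((3/4) ^ n :: real)" .
  qed auto
  then obtain Z where Z: "\<And>L n. Z L n \<in> NSM J Js" "\<And>L n. hedge L n (Z L n)" by metis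
  \<comment> \<open>16/9 is the inverse of (3/4)^2, so the threshold becomes 1. The initial values
    become multiples of (16/9 * 1/4)^n = (4/9)^n, which is summable.\<close>
  define scaled where "scaled L n W \<longleftrightarrow>
    (\<forall>t\<ge>0. \<forall>\<omega>\<in>Omega J. W t \<omega> = ereal ((16/9) ^ n) * Z L n t \<omega>)" for L n W
  have "\<exists>W\<in>NSM J Js. scaled L n W" for L n
    unfolding scaled_def by (rule NSM_scale[OF Z(1)]) simp
  then obtain W where W: "\<And>L n. W L n \<in> NSM J Js" "\<And>L n. scaled L n (W L n)" by metis
  note W(2)[unfolded scaled_def, rule_format]
  note W = W(1) this
  have "qa J Js (\<lambda>t \<omega>. \<forall>\<^sub>F n in sequentially. W L n t \<omega> < 1)" for L
  proof (rule qa_Borel_Cantelli[where w = "\<lambda>n. (4/9) ^ n * (L\<^sup>2 + 1)"])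
    show "summable (\<lambda>n. (4/9) ^ n * (L\<^sup>2 + 1))"
      by (intro summable_mult2 summable_geometric) simp
    fix n \<omega> assume \<omega>: "\<omega> \<in> Omega J"
    have "(16/9) ^ n * (((1/2) ^ n)\<^sup>2 * (L\<^sup>2 + 1)) = (16/9 * (1/2 * (1/2))) ^ n * (L\<^sup>2 + 1)"
      by (simp only: power_mult_distrib power2_eq_square mult.assoc)
    then show "W L n 0 \<omega> = ereal ((4/9) ^ n * (L\<^sup>2 + 1))"
      using Z(2)[of L n] \<omega> unfolding hedge_def by (simp add: W(2))
  qed (simp_all add: W(1))
  from qa_countable[where P = "\<lambda>N t \<omega>. \<forall>\<^sub>F n in sequentially. W (real N) n t \<omega> < 1", OF this]
  have W1: "qa J Js (\<lambda>t \<omega>. \<forall>N. \<forall>\<^sub>F n in sequentially. W (real N) n t \<omega> < 1)" .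
  have dom: "qa J Js (\<lambda>t \<omega>. \<forall>n. ereal t < (SUP k. T n k \<omega>))" if "\<And>n. partition J Js (T n)"
    for T :: "nat \<Rightarrow> nat \<Rightarrow> path \<Rightarrow> ereal"
    by (rule qa_countable) (use that in \<open>simp add: partition_def\<close>)
  show ?thesis
  proof (rule qa_mono[OF qa_conj[OF W1 qa_conj[OF qa_conj[OF Hp(2) Xp(2)] qa_conj[OF dom[OF P(1)] dom[OF Q(1)]]]]],
      elim conjE)
    fix t \<omega> assume t: "0 \<le> (t::real)" and \<omega>: "\<omega> \<in> Omega J"
      and W1: "\<forall>N. \<forall>\<^sub>F n in sequentially. W (real N) n t \<omega> < 1"
      and Ht: "H t \<omega> \<noteq> None" and Xt: "X t \<omega> \<noteq> None"
      and Pt: "\<forall>n. ereal t < (SUP k. P n k \<omega>)" and Qt: "\<forall>n. ereal t < (SUP k. Q n k \<omega>)"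
    have tP: "\<exists>i. ereal t < P n i \<omega>" and tQ: "\<exists>i. ereal t < Q n i \<omega>" for n
      using Pt Qt unfolding less_SUP_iff by auto
    obtain M where "ereal t < P 0 M \<omega>" using tP by blast
    note bounded = osc_le_bounded[where T = "P 0",
        OF st_gridD(2)[OF partition_st_grid[OF P(1)] \<omega>] P(3)[of 0] \<omega> Xp(3)[OF \<omega> _ _ Xt] t this]
    obtain L where L: "\<And>s. 0 \<le> s \<Longrightarrow> s \<le> t \<Longrightarrow> \<bar>the (X s \<omega>)\<bar> \<le> L"
      by (rule bounded) auto
    obtain N where "L \<le> real N" using real_arch_simple by blast
    then have LN: "\<forall>s. 0 \<le> s \<longrightarrow> s \<le> t \<longrightarrow> \<bar>the (X s \<omega>)\<bar> \<le> real N" using L order_trans by blast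
    have "\<forall>\<^sub>F n in sequentially. W (real N) n t \<omega> < 1" using W1 by blast
    then show "\<forall>\<^sub>F n in sequentially. \<forall>s. 0 \<le> s \<longrightarrow> s \<le> t \<longrightarrow> ?D n s \<omega> \<le> 2 * (3/4) ^ n"
    proof (rule eventually_mono, intro allI impI)
      fix n s assume w: "W (real N) n t \<omega> < 1" and s: "0 \<le> s" "s \<le> t"
      show "?D n s \<omega> \<le> 2 * (3/4) ^ n"
      proof (rule ccontr)
        assume "\<not> ?D n s \<omega> \<le> 2 * (3/4) ^ n"
        then have D: "2 * (3/4) ^ n \<le> ?D n s \<omega>" by linarith
        obtain i j where "ereal t < P n i \<omega>" "ereal t < Q n j \<omega>" using tP tQ by blast
        then have "ereal (((3/4) ^ n)\<^sup>2) \<le> Z (real N) n t \<omega>"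
          using Z(2)[of "real N" n] t \<omega> Ht Xt LN s D unfolding hedge_def by blast
        then have "ereal ((16/9) ^ n) * ereal (((3/4) ^ n)\<^sup>2) \<le> W (real N) n t \<omega>"
          unfolding W(2)[OF t \<omega>] by (intro ereal_mult_left_mono) auto
        moreover have "(16/9) ^ n * ((3/4) ^ n)\<^sup>2 = (16/9 * (3/4 * (3/4)) :: real) ^ n"
          by (simp only: power_mult_distrib power2_eq_square)
        ultimately show False using w by (simp add: one_ereal_def)
      qed
    qed
  qed
qed

lemma geometric_increments_lim:
  fixes x :: "nat \<Rightarrow> real"
  assumes step: "\<And>n. N \<le> n \<Longrightarrow> \<bar>x (Suc n) - x n\<bar> \<le> 2 * (3/4) ^ n" and n: "N \<le> n"
  shows "\<bar>x n - lim x\<bar> \<le> 8 * (3/4) ^ n"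
proof -
  \<comment> \<open>The subtracted term makes the induction close: 2 (3/4)^m equals 8 (3/4)^m - 8
    (3/4)^(m+1). Hence also the constant 8.\<close>
  have diff: "\<bar>x (n + k) - x n\<bar> \<le> 8 * (3/4) ^ n - 8 * (3/4) ^ (n + k)" if "N \<le> n" for n k
  proof (induction k)
    case (Suc k)
    have "\<bar>x (Suc (n + k)) - x (n + k)\<bar> \<le> 2 * (3/4) ^ (n + k)" using that by (intro step) simp
    with Suc show ?case by simp
  qed simp
  have diff': "\<bar>x m - x n\<bar> \<le> 8 * (3/4) ^ n" if "N \<le> n" "n \<le> m" for n m
  proof -
    have "0 \<le> (3/4::real) ^ m" by simp
    moreover have "\<bar>x m - x n\<bar> \<le> 8 * (3/4) ^ n - 8 * (3/4) ^ m"
      using diff[OF that(1), of "m - n"] that(2) by simp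
    ultimately show ?thesis by linarith
  qed
  have "Cauchy x"
  proof (rule metric_CauchyI)
    fix e :: real assume "0 < e"
    have "(\<lambda>n. 16 * (3/4::real) ^ n) \<longlonglongrightarrow> 0"
      by (intro tendsto_mult_right_zero LIMSEQ_power_zero) simp
    then have "\<forall>\<^sub>F n in sequentially. 16 * (3/4::real) ^ n < e"
      using \<open>0 < e\<close> by (rule order_tendstoD(2))
    then obtain n0 where n0: "\<And>n. n0 \<le> n \<Longrightarrow> 16 * (3/4::real) ^ n < e"
      by (auto simp: eventually_sequentially)
    let ?K = "max N n0"
    show "\<exists>M. \<forall>m\<ge>M. \<forall>n\<ge>M. dist (x m) (x n) < e"
    proof (intro exI allI impI)
      fix m n assume "?K \<le> m" "?K \<le> n"
      then have "\<bar>x m - x ?K\<bar> \<le> 8 * (3/4) ^ ?K" "\<bar>x n - x ?K\<bar> \<le> 8 * (3/4) ^ ?K"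
        by (auto intro: diff')
      moreover have "16 * (3/4::real) ^ ?K < e" by (rule n0) simp
      ultimately show "dist (x m) (x n) < e" unfolding dist_real_def by linarith
    qed
  qed
  then have "x \<longlonglongrightarrow> lim x" using Cauchy_convergent convergent_LIMSEQ_iff by blast
  then have "(\<lambda>m. \<bar>x m - x n\<bar>) \<longlonglongrightarrow> \<bar>lim x - x n\<bar>" by (intro tendsto_intros)
  then have "\<bar>lim x - x n\<bar> \<le> 8 * (3/4) ^ n"
    by (rule LIMSEQ_le_const2) (use diff'[OF n] in blast)
  then show ?thesis by linarith
qed

lemma SUP_tendsto_0:
  fixes d :: "nat \<Rightarrow> real \<Rightarrow> real"
  assumes "0 \<le> t" "\<And>n s. 0 \<le> d n s" "b \<longlonglongrightarrow> 0"
    and "\<forall>\<^sub>F n in sequentially. \<forall>s. 0 \<le> s \<longrightarrow> s \<le> t \<longrightarrow> d n s \<le> b n"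
  shows "(\<lambda>n. SUP s\<in>{0..t}. ereal (d n s)) \<longlonglongrightarrow> 0"
proof (rule tendsto_sandwich)
  show "\<forall>\<^sub>F n in sequentially. 0 \<le> (SUP s\<in>{0..t}. ereal (d n s))"
    using assms(1,2) by (intro always_eventually allI SUP_upper2[of 0]) auto
  show "\<forall>\<^sub>F n in sequentially. (SUP s\<in>{0..t}. ereal (d n s)) \<le> ereal (b n)"
    using assms(4) by (rule eventually_mono) (auto intro!: SUP_least)
  show "(\<lambda>n. ereal (b n)) \<longlonglongrightarrow> 0"
    using assms(3) by (simp add: zero_ereal_def)
qed simp

lemma SUP_tendsto_0_pointwise:
  fixes R :: "nat \<Rightarrow> real \<Rightarrow> real"
  assumes t: "0 \<le> t" and "(\<lambda>n. SUP s\<in>{0..t}. ereal \<bar>R n s - y s\<bar>) \<longlonglongrightarrow> 0"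
  shows "(\<lambda>n. R n t) \<longlonglongrightarrow> y t"
proof -
  have "(\<lambda>n. ereal \<bar>R n t - y t\<bar>) \<longlonglongrightarrow> 0"
  proof (rule tendsto_sandwich[OF _ _ tendsto_const assms(2)])
    show "\<forall>\<^sub>F n in sequentially. ereal \<bar>R n t - y t\<bar> \<le> (SUP s\<in>{0..t}. ereal \<bar>R n s - y s\<bar>)"
      using t by (intro always_eventually allI SUP_upper) auto
  qed simp
  then have "(\<lambda>n. \<bar>R n t - y t\<bar>) \<longlonglongrightarrow> 0" by (simp add: zero_ereal_def)
  then show ?thesis by (simp add: tendsto_rabs_zero_iff LIM_zero_iff)
qed

theorem theorem5:
  fixes J Js :: nat and H X :: "real \<Rightarrow> path \<Rightarrow> real option"
  assumes "1 \<le> Js" and "Js \<le> J"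
    and "cont_process J Js H" and "X \<in> CM J Js"
  shows "(\<forall>TT. fine_for J Js TT H \<and> fine_for J Js TT X \<longrightarrow>
             (\<exists>Y. ucqa J Js (riemann TT H X) Y)) \<and>
         (\<forall>TT SS Y Y'. fine_for J Js TT H \<and> fine_for J Js TT X \<and>
             fine_for J Js SS H \<and> fine_for J Js SS X \<and>
             ucqa J Js (riemann TT H X) Y \<and> ucqa J Js (riemann SS H X) Y' \<longrightarrow>
             qa J Js (\<lambda>t \<omega>. Y t \<omega> = Y' t \<omega>))"
proof -
  \<comment> \<open>Used twice: with \<open>SS = TT\<close> and \<open>k n = n + 2\<close> it
    compares consecutive partitions of one sequence, with \<open>k n = n + 1\<close> two sequences.
    The shift respects that fineness is only given for indices at least 1; a finer mesh than (1/2)^n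
    does no harm.\<close>
  have close: "qa J Js (\<lambda>t \<omega>. \<forall>\<^sub>F n in sequentially. \<forall>s. 0 \<le> s \<longrightarrow> s \<le> t \<longrightarrow>
      \<bar>riemann TT H X (Suc n) s \<omega> - riemann SS H X (k n) s \<omega>\<bar> \<le> 2 * (3/4) ^ n)"
    if T: "fine_for J Js TT H" "fine_for J Js TT X" and S: "fine_for J Js SS H" and k: "\<And>n. n < k n"
    for TT SS k
  proof -
    have le: "(1/2) ^ m \<le> ((1/2) ^ n :: real)" if "n < m" for m n
      using that by (intro power_decreasing) auto
    have k1: "1 \<le> k n" for n using k[of n] by simp
    note fT = fine_for_osc_le[OF T(1)] and fX = fine_for_osc_le[OF T(2)] and fS = fine_for_osc_le[OF S k1]
    have "qa J Js (\<lambda>t \<omega>. \<forall>\<^sub>F n in sequentially. \<forall>s. 0 \<le> s \<longrightarrow> s \<le> t \<longrightarrow>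
      \<bar>riemann_sum (TT (Suc n)) H X s \<omega> - riemann_sum (SS (k n)) H X s \<omega>\<bar> \<le> 2 * (3/4) ^ n)"
      by (rule riemann_sums_close[where P = "\<lambda>n. TT (Suc n)" and Q = "\<lambda>n. SS (k n)",
            OF assms(3,4,2)])
        (auto intro!: fT(1) fS(1) osc_le_mono[OF fT(2) le] osc_le_mono[OF fX(2) le] osc_le_mono[OF fS(2) le] k)
    then show ?thesis
    proof (rule qa_mono)
      fix t \<omega> assume \<omega>: "\<omega> \<in> Omega J"
      assume "\<forall>\<^sub>F n in sequentially. \<forall>s. 0 \<le> s \<longrightarrow> s \<le> t \<longrightarrow>
        \<bar>riemann_sum (TT (Suc n)) H X s \<omega> - riemann_sum (SS (k n)) H X s \<omega>\<bar> \<le> 2 * (3/4) ^ n"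
      moreover have "time_grid (\<lambda>i. TT (Suc n) i \<omega>)" "time_grid (\<lambda>i. SS (k n) i \<omega>)" for n
        using st_gridD(2)[OF partition_st_grid \<omega>] fT(1)[of "Suc n"] fS(1)[of n] by auto
      ultimately show "\<forall>\<^sub>F n in sequentially. \<forall>s. 0 \<le> s \<longrightarrow> s \<le> t \<longrightarrow>
        \<bar>riemann TT H X (Suc n) s \<omega> - riemann SS H X (k n) s \<omega>\<bar> \<le> 2 * (3/4) ^ n"
        by (simp add: riemann_eq_riemann_sum)
    qed
  qed
  have geo: "(\<lambda>n. c * (3/4::real) ^ n) \<longlonglongrightarrow> 0" for c
    by (intro tendsto_mult_right_zero LIMSEQ_power_zero) simp
  have "\<exists>Y. ucqa J Js (riemann TT H X) Y" if T: "fine_for J Js TT H" "fine_for J Js TT X" for TT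
  proof -
    let ?R = "\<lambda>n s \<omega>. riemann TT H X (Suc n) s \<omega>"
    \<comment> \<open>The pathwise limit, with an unspecified value where the sums do not converge;
      the geometric bound is proved only at points where they do.\<close>
    define Y where "Y s \<omega> = lim (\<lambda>n. ?R n s \<omega>)" for s \<omega>
    have "ucqa J Js (riemann TT H X) Y"
      unfolding ucqa_def
    proof (rule qa_mono[OF close[OF T T(1), of "\<lambda>n. Suc (Suc n)"]])
      fix t \<omega> assume t: "0 \<le> (t::real)"
        and "\<forall>\<^sub>F n in sequentially. \<forall>s. 0 \<le> s \<longrightarrow> s \<le> t \<longrightarrow> \<bar>?R n s \<omega> - ?R (Suc n) s \<omega>\<bar> \<le> 2 * (3/4) ^ n"
      then obtain N where N: "\<And>n s. N \<le> n \<Longrightarrow> 0 \<le> s \<Longrightarrow> s \<le> t \<Longrightarrow> \<bar>?R n s \<omega> - ?R (Suc n) s \<omega>\<bar> \<le> 2 * (3/4) ^ n"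
        unfolding eventually_sequentially by blast
      have "\<bar>?R n s \<omega> - Y s \<omega>\<bar> \<le> 8 * (3/4) ^ n" if "N \<le> n" "0 \<le> s" "s \<le> t" for n s
        unfolding Y_def using N[OF _ that(2,3)]
        by (intro geometric_increments_lim[OF _ that(1)]) (simp add: abs_minus_commute)
      then have "(\<lambda>n. SUP s\<in>{0..t}. ereal \<bar>?R n s \<omega> - Y s \<omega>\<bar>) \<longlonglongrightarrow> 0"
        by (intro SUP_tendsto_0[OF t _ geo[of 8]]) (auto simp: eventually_sequentially)
      then show "(\<lambda>n. SUP s\<in>{0..t}. ereal \<bar>riemann TT H X n s \<omega> - Y s \<omega>\<bar>) \<longlonglongrightarrow> 0"
        by (rule LIMSEQ_imp_Suc)
    qed simp
    then show ?thesis by blast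
  qed
  moreover have "qa J Js (\<lambda>t \<omega>. Y t \<omega> = Y' t \<omega>)"
    if T: "fine_for J Js TT H" "fine_for J Js TT X" and S: "fine_for J Js SS H"
      and Y: "ucqa J Js (riemann TT H X) Y" and Y': "ucqa J Js (riemann SS H X) Y'" for TT SS Y Y'
  proof (rule qa_mono[OF qa_conj[OF close[OF T S, of Suc] qa_conj[OF Y[unfolded ucqa_def] Y'[unfolded ucqa_def]]]],
      simp, elim conjE)
    fix t \<omega>
    let ?R = "\<lambda>n. riemann TT H X n t \<omega>" and ?S = "\<lambda>n. riemann SS H X n t \<omega>"
    assume t: "0 \<le> t"
      and c: "\<forall>\<^sub>F n in sequentially. \<forall>s. 0 \<le> s \<longrightarrow> s \<le> t \<longrightarrow>
        \<bar>riemann TT H X (Suc n) s \<omega> - riemann SS H X (Suc n) s \<omega>\<bar> \<le> 2 * (3/4) ^ n"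
      and y: "(\<lambda>n. SUP s\<in>{0..t}. ereal \<bar>riemann TT H X n s \<omega> - Y s \<omega>\<bar>) \<longlonglongrightarrow> 0"
      and y': "(\<lambda>n. SUP s\<in>{0..t}. ereal \<bar>riemann SS H X n s \<omega> - Y' s \<omega>\<bar>) \<longlonglongrightarrow> 0"
    have "?R \<longlonglongrightarrow> Y t \<omega>" by (rule SUP_tendsto_0_pointwise[OF t y])
    moreover have "?S \<longlonglongrightarrow> Y' t \<omega>" by (rule SUP_tendsto_0_pointwise[OF t y'])
    ultimately have "(\<lambda>n. ?R (Suc n) - ?S (Suc n)) \<longlonglongrightarrow> Y t \<omega> - Y' t \<omega>"
      by (intro tendsto_diff LIMSEQ_Suc)
    moreover have "(\<lambda>n. ?R (Suc n) - ?S (Suc n)) \<longlonglongrightarrow> 0"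
      by (rule tendsto_0_le[OF geo[of 2], where K = 1])
        (rule eventually_mono[OF c], use t in simp)
    ultimately have "Y t \<omega> - Y' t \<omega> = 0" by (rule LIMSEQ_unique)
    then show "Y t \<omega> = Y' t \<omega>" by simp
  qed
  ultimately show ?thesis by blast
qed

end
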